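(* Assume $\rho>\mu-\lambda+\sqrt{\sigma^2+\lambda^2}$. Then: (a) If $\mu-\sigma>0$, then the principle of smooth fit is satisfied by $g(\cdot,-1)$ at $u_-$, i.e. $\displaystyle\lim_{y\uparrow u_-}\frac{\partial g}{\partial y}(y,-1)=1$. (b) If $u_+<+\infty$, then the principle of smooth fit is satisfied by $g(\cdot,+1)$ at $u_+$, i.e. $\displaystyle\lim_{y\uparrow u_+}\frac{\partial g}{\partial y}(y,+1)=1$.
   Context: Fix real parameters $\lambda>0$, $\mu>0$, $\sigma>0$, $a>0$, $\rho>0$. Let $(\xi(t),t\ge 0)$ be the continuous-time Markov chain with (right-continuous) piecewise constant paths in $S=\{-1,+1\}$, which jumps from each state to the other at rate $\lambda$ (infinitesimal generator $\begin{pmatrix}-\lambda&\lambda\\ \lambda&-\lambda\end{pmatrix}$). For $Y_0\ge 0$, let $Y_t=Y_0\exp\left(\mu t+\sigma\int_0^t\xi(u)\,du\right)$, i.e. $dY_t/dt=(\mu+\sigma\xi(t))Y_t$. Let $(\mathcal F_t)$ be the completed natural filtration of $(\xi(t))$. $P_{y,s}$ and $E_{y,s}$ denote probability and expectation given $Y_0=y$, $\xi(0)=s$. The reward process is $X_t=e^{-\rho t}(Y_t-a)$ for $0\le t<\infty$, and $X_{+\infty}=0$. The value function is $g(y,s)=\sup_\tau E_{y,s}(X_\tau)$, the supremum being over all $(\mathcal F_t)$-stopping times $\tau$ with values in $[0,\infty]$. For $s=\pm1$, the set $\{y\in\mathbb R_+=[0,\infty): g(y,s)=y-a\}$ is an interval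 $[u_s,+\infty)$, which defines $u_\pm:=u_{\pm 1}\in[0,+\infty]$ (with $u_s=+\infty$ if the set is empty). It is known that $u_-\le u_+$ and $u_-<\infty$. *)

theory Defs
  imports "HOL-Probability.Probability"
begin

abbreviation states :: "real set"
  where "states \<equiv> {-1, 1}"

definition generator :: "real \<Rightarrow> real \<Rightarrow> real \<Rightarrow> real"
  where "generator l x y = (if x = y then - l else l)"

text \<open>Finitely many jump times on each bounded time interval. The half-open interval below makes
  the path take its new value at the jump time itself, which is right-continuity.\<close>

definition rc_piecewise_constant :: "(real \<Rightarrow> real) \<Rightarrow> bool"
  where "rc_piecewise_constant f \<longleftrightarrow>
    (\<forall>T\<ge>0. \<exists>J. finite J \<and> (\<forall>u v. 0 \<le> u \<and> u \<le> v \<and> v \<le> T \<and> {u<..v} \<inter> J = {} \<longrightarrow> f u = f v))"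

text \<open>Filtrations are indexed by the extended half-line, so that the library's stopping times
  may take the value \<open>\<infinity>\<close>.\<close>

definition natural_events :: "'a set \<Rightarrow> (real \<Rightarrow> 'a \<Rightarrow> real) \<Rightarrow> ennreal \<Rightarrow> 'a set set"
  where "natural_events \<Omega> \<xi> t = {\<xi> u -` B \<inter> \<Omega> |u B. 0 \<le> u \<and> ennreal u \<le> t \<and> B \<in> sets borel}"

definition natural_filtration :: "'a set \<Rightarrow> (real \<Rightarrow> 'a \<Rightarrow> real) \<Rightarrow> ennreal \<Rightarrow> 'a measure"
  where "natural_filtration \<Omega> \<xi> t = sigma \<Omega> (natural_events \<Omega> \<xi> t)"

text \<open>\<open>P s\<close> is the law under which the chain starts in \<open>s\<close>. Hence \<open>P x {\<xi> h = y}\<close> is the transition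
  probability from \<open>x\<close> to \<open>y\<close> in time \<open>h\<close>: the assumption \<open>markov\<close> is the time-homogeneous Markov
  property with respect to the natural filtration, and the assumption \<open>rates\<close> says that the
  infinitesimal generator (the right derivative of the transition function at \<open>0\<close>) is the given
  matrix.\<close>

locale two_state_chain =
  fixes l :: real
    and P :: "real \<Rightarrow> 'a measure"
    and \<xi> :: "real \<Rightarrow> 'a \<Rightarrow> real"
  assumes prob: "\<And>s. s \<in> states \<Longrightarrow> prob_space (P s)"
    and same_events: "sets (P (-1)) = sets (P 1)"
    and measurable_chain: "\<And>t. 0 \<le> t \<Longrightarrow> \<xi> t \<in> borel_measurable (P 1)"
    and chain_in_states: "\<And>t \<omega>. 0 \<le> t \<Longrightarrow> \<omega> \<in> space (P 1) \<Longrightarrow> \<xi> t \<omega> \<in> states"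
    and paths: "\<And>\<omega>. \<omega> \<in> space (P 1) \<Longrightarrow> rc_piecewise_constant (\<lambda>t. \<xi> t \<omega>)"
    and start: "\<And>s. s \<in> states \<Longrightarrow> (AE \<omega> in P s. \<xi> 0 \<omega> = s)"
    and markov: "\<And>s t h A x y. s \<in> states \<Longrightarrow> 0 \<le> t \<Longrightarrow> 0 \<le> h
      \<Longrightarrow> A \<in> sets (natural_filtration (space (P 1)) \<xi> (ennreal t))
      \<Longrightarrow> x \<in> states \<Longrightarrow> y \<in> states
      \<Longrightarrow> measure (P s) {\<omega> \<in> A. \<xi> t \<omega> = x \<and> \<xi> (t + h) \<omega> = y}
        = measure (P s) {\<omega> \<in> A. \<xi> t \<omega> = x} * measure (P x) {\<omega> \<in> space (P x). \<xi> h \<omega> = y}"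
    and rates: "\<And>x y. x \<in> states \<Longrightarrow> y \<in> states
      \<Longrightarrow> ((\<lambda>h. measure (P x) {\<omega> \<in> space (P x). \<xi> h \<omega> = y})
            has_real_derivative generator l x y) (at 0 within {0..})"

text \<open>Natural filtration augmented with all sets that are negligible for both starting states
  (equivalently, for any initial law that charges both states).\<close>

definition completed_filtration ::
    "(real \<Rightarrow> 'a measure) \<Rightarrow> (real \<Rightarrow> 'a \<Rightarrow> real) \<Rightarrow> ennreal \<Rightarrow> 'a measure"
  where "completed_filtration P \<xi> t = sigma (space (P 1))
    (natural_events (space (P 1)) \<xi> t \<union> {N. \<forall>s\<in>states. \<exists>N'\<in>null_sets (P s). N \<subseteq> N'})"

definition price ::
    "real \<Rightarrow> real \<Rightarrow> (real \<Rightarrow> 'a \<Rightarrow> real) \<Rightarrow> real \<Rightarrow> real \<Rightarrow> 'a \<Rightarrow> real"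
  where "price \<mu> \<sigma> \<xi> y t \<omega> = y * exp (\<mu> * t + \<sigma> * integral {0..t} (\<lambda>u. \<xi> u \<omega>))"

definition reward ::
    "real \<Rightarrow> real \<Rightarrow> real \<Rightarrow> real \<Rightarrow> (real \<Rightarrow> 'a \<Rightarrow> real) \<Rightarrow> real \<Rightarrow> ennreal \<Rightarrow> 'a \<Rightarrow> real"
  where "reward \<mu> \<sigma> a \<rho> \<xi> y t \<omega> =
    (if t = \<infinity> then 0 else exp (- \<rho> * enn2real t) * (price \<mu> \<sigma> \<xi> y (enn2real t) \<omega> - a))"

text \<open>The supremum and the integrals are taken in the reals: for
  \<open>\<rho> > \<mu> - l + sqrt (\<sigma>\<^sup>2 + l\<^sup>2)\<close> and \<open>y \<ge> 0\<close>, a suitable positive multiple \<open>c (\<xi> t)\<close> turns the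
  discounted price into a supermartingale, so the rewards are integrable and their expectations
  are bounded over all stopping times. The completion of \<open>P s\<close> is needed because stopping times of
  the completed filtration need not be measurable with respect to \<open>P s\<close>.\<close>

definition value_fun ::
    "real \<Rightarrow> real \<Rightarrow> real \<Rightarrow> real \<Rightarrow> (real \<Rightarrow> 'a measure) \<Rightarrow> (real \<Rightarrow> 'a \<Rightarrow> real) \<Rightarrow> real \<Rightarrow> real \<Rightarrow> real"
  where "value_fun \<mu> \<sigma> a \<rho> P \<xi> y s =
    (SUP \<tau> \<in> {\<tau>. stopping_time (completed_filtration P \<xi>) \<tau>}.
       \<integral>\<omega>. reward \<mu> \<sigma> a \<rho> \<xi> y (\<tau> \<omega>) \<omega> \<partial>completion (P s))"

text \<open>Left end point of the interval on which immediate stopping is optimal; \<open>\<infinity>\<close> if the interval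
  is empty.\<close>

definition threshold ::
    "real \<Rightarrow> real \<Rightarrow> real \<Rightarrow> real \<Rightarrow> (real \<Rightarrow> 'a measure) \<Rightarrow> (real \<Rightarrow> 'a \<Rightarrow> real) \<Rightarrow> real \<Rightarrow> ereal"
  where "threshold \<mu> \<sigma> a \<rho> P \<xi> s = Inf (ereal ` {y. 0 \<le> y \<and> value_fun \<mu> \<sigma> a \<rho> P \<xi> y s = y - a})"

text \<open>The constant \<open>1\<close> is the slope of the payoff \<open>y - a\<close>.\<close>

definition smooth_fit :: "(real \<Rightarrow> real) \<Rightarrow> real \<Rightarrow> bool"
  where "smooth_fit f u \<longleftrightarrow>
    (\<forall>\<^sub>F y in at_left u. f differentiable at y) \<and> (deriv f \<longlongrightarrow> 1) (at_left u)"

end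

theory Submission
  imports Defs
begin

text \<open>Conditioning on the first jump suggests that the value function solves a deterministic fixed-point
  equation: from state \<open>s\<close>, stop at the best fixed time \<open>t\<close> unless the chain jumps earlier, and
  then continue with the value in state \<open>- s\<close>. Under the assumption on the discount rate, this
  operator preserves a class of Lipschitz functions, and by Knaster and Tarski it has a fixed point
  \<open>w\<close> there. Along the flow of a state with upward drift, \<open>w\<close> is excessive everywhere and satisfies
  the dynamic equation exactly where \<open>w s y > y - a\<close>; there it is differentiable, with
  derivative \<open>D y = (q * w s y - l * w (- s) y) / (b s * y)\<close>. At the threshold \<open>u\<close> the limit
  \<open>D u\<close> is at most \<open>1\<close>, because \<open>w s y - (y - a)\<close> is positive below \<open>u\<close> and vanishes at
  \<open>u\<close>, and at least \<open>1\<close>, because waiting at \<open>u\<close> does not improve on the payoff.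

  That \<open>w\<close> is the value function is verified on a time grid. The rates and the Markov
  property show that the discounted \<open>w\<close> is a supermartingale up to \<open>o(h)\<close> per step \<open>h\<close>, and a
  martingale as long as \<open>w\<close> exceeds the payoff by a fixed margin. Jump times are never mentioned:
  only transition probabilities over short intervals and \<open>E \<integral> \<bar>\<xi> u - \<xi> t\<bar> du = O(h\<^sup>2)\<close> are needed.\<close>

text \<open>The discount condition is spectral:
  \<open>\<mu> - l + sqrt (\<sigma>\<^sup>2 + l\<^sup>2)\<close> is the largest eigenvalue of the
  generator plus the diagonal matrix of growth rates \<open>\<mu> + \<sigma> * s\<close>. For larger
  \<open>\<rho>\<close> some positive weight \<open>c\<close> on the states makes
  \<open>c s * y\<close> strictly excessive. This weight has two uses: its values are the Lipschitz
  constants that the operator reproduces, and the strict excess gives exponential decay, which makes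
  the contribution of late times negligible. Uniqueness of the fixed point is never argued at the
  level of the operator. The verification uses only that \<open>w\<close> is admissible and a fixed
  point, so it identifies every such function with the value function on nonnegative prices. Upward
  drift enters because the flow then reaches the threshold from below: the values of
  \<open>w\<close> just under \<open>u\<close> are tied to one upstream value by an explicit
  formula, and waiting at \<open>u\<close> moves into larger prices. In state \<open>1\<close> the
  drift is always upward; in state \<open>-1\<close> this is the hypothesis of (a). The best
  deterministic waiting time need not be attained, so the dynamic equation is derived from a margin
  between \<open>w\<close> and the payoff.\<close>

abbreviation integral_on :: "'b measure \<Rightarrow> 'b set \<Rightarrow> ('b \<Rightarrow> real) \<Rightarrow> real" where
  "integral_on M A f \<equiv> \<integral>x. indicator A x * f x \<partial>M"

section \<open>Elementary exponential bounds and discrete optional stopping\<close>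

lemma exp_diff_le:
  fixes x y m :: real
  assumes "x \<le> m" "y \<le> m"
  shows "\<bar>exp x - exp y\<bar> \<le> exp m * \<bar>x - y\<bar>"
proof -
  have *: "exp x - exp y \<le> exp m * \<bar>x - y\<bar>" if "x \<le> m" for x y :: real
  proof (cases "y \<le> x")
    case True
    have "exp x * (1 + (y - x)) \<le> exp x * exp (y - x)"
      by (intro mult_left_mono exp_ge_add_one_self) auto
    then have "exp x - exp y \<le> exp x * (x - y)"
      by (simp add: exp_add[symmetric] algebra_simps)
    also have "\<dots> \<le> exp m * (x - y)"
      using that True by (intro mult_right_mono) auto
    finally show ?thesis
      using True by simp
  next
    case False
    then have "exp x - exp y \<le> 0"
      by simp
    also have "0 \<le> exp m * \<bar>x - y\<bar>"
      by simp
    finally show ?thesis .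
  qed
  show ?thesis
    using *[OF assms(1), of y] *[OF assms(2), of x] by (simp add: abs_minus_commute)
qed

lemma exp_minus_bounds:
  fixes x :: real
  assumes "0 \<le> x"
  shows "1 - x \<le> exp (- x)" "exp (- x) \<le> 1 / (1 + x)" "exp (- x) \<le> 1 - x + x\<^sup>2"
proof -
  show "1 - x \<le> exp (- x)"
    using exp_ge_add_one_self[of "- x"] by simp
  show *: "exp (- x) \<le> 1 / (1 + x)"
    using assms exp_ge_add_one_self[of x] by (simp add: exp_minus divide_inverse le_imp_inverse_le)
  have "1 \<le> (1 - x + x\<^sup>2) * (1 + x)"
    using assms by (simp add: algebra_simps power2_eq_square)
  then have "1 / (1 + x) \<le> 1 - x + x\<^sup>2"
    using assms by (simp add: divide_le_eq)
  then show "exp (- x) \<le> 1 - x + x\<^sup>2"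
    using * by linarith
qed

lemma sum_states: "(\<Sum>x\<in>states. g x) = g (-1) + g 1"
  by simp

text \<open>Discrete optional stopping with an error \<open>d\<close> per step. \<open>B n\<close>
  is the event that stopping has not occurred by index \<open>n\<close>, so the left side is the
  mean of \<open>Z\<close> at the stopping index, or at \<open>N\<close> if that comes first. The
  step hypothesis concerns only paths still running. It serves twice, with \<open>Z\<close> and with
  \<open>- Z\<close>.\<close>

lemma telescope:
  fixes Z :: "nat \<Rightarrow> 'b \<Rightarrow> real"
  assumes Z: "\<And>n. n \<le> N \<Longrightarrow> integrable M (Z n)" and B: "\<And>n. B n \<in> sets M" "\<And>n. B (Suc n) \<subseteq> B n"
    and step: "\<And>n. n < N \<Longrightarrow> (\<integral>\<omega>. indicator (B n) \<omega> * Z (Suc n) \<omega> \<partial>M) \<le> (\<integral>\<omega>. indicator (B n) \<omega> * Z n \<omega> \<partial>M) + d"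
  shows "(\<Sum>k\<le>N. \<integral>\<omega>. indicator (case k of 0 \<Rightarrow> space M - B 0 | Suc n \<Rightarrow> B n - B (Suc n)) \<omega> * Z k \<omega> \<partial>M)
    + (\<integral>\<omega>. indicator (B N) \<omega> * Z N \<omega> \<partial>M) \<le> (\<integral>\<omega>. Z 0 \<omega> \<partial>M) + real N * d"
  using Z step
proof (induction N)
  case 0
  have int: "integrable M (\<lambda>\<omega>. indicator A \<omega> * Z 0 \<omega>)" if "A \<in> sets M" for A
    using integrable_mult_indicator[OF that 0(1)[of 0]] by simp
  have "(\<integral>\<omega>. indicator (space M - B 0) \<omega> * Z 0 \<omega> \<partial>M) + (\<integral>\<omega>. indicator (B 0) \<omega> * Z 0 \<omega> \<partial>M)
      = (\<integral>\<omega>. indicator (space M - B 0) \<omega> * Z 0 \<omega> + indicator (B 0) \<omega> * Z 0 \<omega> \<partial>M)"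
    using B by (intro Bochner_Integration.integral_add[symmetric] int) auto
  also have "\<dots> = (\<integral>\<omega>. Z 0 \<omega> \<partial>M)"
    by (intro Bochner_Integration.integral_cong) (auto simp: indicator_def)
  finally show ?case
    by simp
next
  case (Suc N)
  have int: "integrable M (\<lambda>\<omega>. indicator A \<omega> * Z (Suc N) \<omega>)" if "A \<in> sets M" for A
    using integrable_mult_indicator[OF that Suc.prems(1)[of "Suc N"]] by simp
  have "(\<integral>\<omega>. indicator (B N - B (Suc N)) \<omega> * Z (Suc N) \<omega> \<partial>M) + (\<integral>\<omega>. indicator (B (Suc N)) \<omega> * Z (Suc N) \<omega> \<partial>M)
      = (\<integral>\<omega>. indicator (B N - B (Suc N)) \<omega> * Z (Suc N) \<omega> + indicator (B (Suc N)) \<omega> * Z (Suc N) \<omega> \<partial>M)"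
    using B by (intro Bochner_Integration.integral_add[symmetric] int) auto
  also have "\<dots> = (\<integral>\<omega>. indicator (B N) \<omega> * Z (Suc N) \<omega> \<partial>M)"
    using B(2)[of N] by (intro Bochner_Integration.integral_cong) (auto simp: indicator_def)
  also have "\<dots> \<le> (\<integral>\<omega>. indicator (B N) \<omega> * Z N \<omega> \<partial>M) + d"
    by (rule Suc.prems(2)) simp
  finally show ?case
    using Suc.IH[OF Suc.prems(1) Suc.prems(2)] by (simp add: distrib_right)
qed

section \<open>The optimality equation\<close>

text \<open>The weight \<open>\<kappa>\<close> is such that the function with values \<open>\<kappa> * y\<close> in state \<open>1\<close> and \<open>y\<close> in
  state \<open>-1\<close> is strictly excessive for the discounted price.\<close>

locale stopping_data =
  fixes l \<mu> \<sigma> a \<rho> \<kappa> :: real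
  assumes pos: "0 < l" "0 < \<mu>" "0 < \<sigma>" "0 < a" "0 < \<rho>"
    and \<kappa>_ge: "1 \<le> \<kappa>"
    and \<kappa>_up: "l < (l + \<rho> - (\<mu> + \<sigma>)) * \<kappa>"
    and \<kappa>_down: "l * \<kappa> < l + \<rho> - (\<mu> - \<sigma>)"
begin

definition b :: "real \<Rightarrow> real" where "b s = \<mu> + \<sigma> * s"
text \<open>Jump intensity plus discount rate: \<open>exp (- q * t)\<close> is the discounted
  probability of no jump before \<open>t\<close>.\<close>

definition q :: real where "q = l + \<rho>"
definition c :: "real \<Rightarrow> real" where "c s = (if s = 1 then \<kappa> else 1)"

lemma neg_state: "s \<in> states \<Longrightarrow> - s \<in> states"
  by auto

lemma q_pos: "0 < q"
  using pos by (simp add: q_def)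

lemma c_ge_1: "1 \<le> c s"
  using \<kappa>_ge by (simp add: c_def)

lemma c_le_\<kappa>: "c s \<le> \<kappa>"
  using \<kappa>_ge by (simp add: c_def)

lemma rate_pos: "s \<in> states \<Longrightarrow> 0 < q - b s"
proof -
  have "0 < (q - b 1) * \<kappa>"
    using \<kappa>_up pos by (simp add: q_def b_def)
  then have "0 < q - b 1"
    using \<kappa>_ge by (simp add: zero_less_mult_iff)
  then show "s \<in> states \<Longrightarrow> 0 < q - b s"
    using pos by (auto simp: b_def)
qed

lemma c_excessive: "s \<in> states \<Longrightarrow> l * c (- s) < (q - b s) * c s"
  using \<kappa>_up \<kappa>_down by (auto simp: q_def b_def c_def)

lemma exp_rate: "exp (- q * r) * exp (b s * r) = exp (- ((q - b s) * r))"
  by (simp add: exp_add[symmetric] algebra_simps)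

section \<open>Admissible functions and the operator of the first-jump equation\<close>

definition admissible :: "(real \<Rightarrow> real \<Rightarrow> real) \<Rightarrow> bool" where
  "admissible v \<longleftrightarrow> (\<forall>s\<in>states. v s 0 = 0 \<and> (\<forall>y. 0 \<le> v s y)
     \<and> (\<forall>y y'. \<bar>v s y - v s y'\<bar> \<le> c s * \<bar>y - y'\<bar>))"

lemma admissible_0: "admissible v \<Longrightarrow> s \<in> states \<Longrightarrow> v s 0 = 0"
  and admissible_nonneg: "admissible v \<Longrightarrow> s \<in> states \<Longrightarrow> 0 \<le> v s y"
  and admissible_lipschitz: "admissible v \<Longrightarrow> s \<in> states \<Longrightarrow> \<bar>v s y - v s y'\<bar> \<le> c s * \<bar>y - y'\<bar>"
  unfolding admissible_def by blast+

lemma admissible_le: "admissible v \<Longrightarrow> s \<in> states \<Longrightarrow> v s y \<le> c s * \<bar>y\<bar>"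
  using admissible_lipschitz[of v s y 0] admissible_0[of v s] by simp

lemma admissible_continuous:
  assumes "admissible v" "s \<in> states"
  shows "continuous_on A (v s)"
proof (rule continuous_on_subset[of UNIV])
  have "(c s)-lipschitz_on UNIV (v s)"
    using assms c_ge_1[of s] by (intro lipschitz_onI) (auto simp: dist_real_def admissible_lipschitz)
  then show "continuous_on UNIV (v s)"
    by (rule lipschitz_on_continuous_on)
qed simp

text \<open>Discounted mean of what \<open>v\<close> pays at the first jump if it comes before
  \<open>t\<close>: the jump time has density \<open>l * exp (- l * r)\<close>, until then the price
  follows the flow of \<open>s\<close>, and afterwards the state is \<open>- s\<close>.\<close>

definition jump_gain :: "(real \<Rightarrow> real \<Rightarrow> real) \<Rightarrow> real \<Rightarrow> real \<Rightarrow> real \<Rightarrow> real" where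
  "jump_gain v s y t = integral {0..t} (\<lambda>r. l * exp (- q * r) * v (- s) (y * exp (b s * r)))"

lemma jump_gain_continuous:
  assumes "admissible v" "s \<in> states"
  shows "continuous_on A (\<lambda>r. l * exp (- q * r) * v (- s) (y * exp (b s * r)))"
proof -
  have "continuous_on A (\<lambda>r. v (- s) (y * exp (b s * r)))"
    by (rule continuous_on_compose2[OF admissible_continuous[OF assms(1) neg_state[OF assms(2)], of UNIV]])
      (auto intro!: continuous_intros)
  then show ?thesis
    by (intro continuous_intros)
qed

lemma jump_gain_integrable:
  "admissible v \<Longrightarrow> s \<in> states \<Longrightarrow>
    (\<lambda>r. l * exp (- q * r) * v (- s) (y * exp (b s * r))) integrable_on {t..t'}"
  by (rule integrable_continuous_real[OF jump_gain_continuous])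

lemma rate_integral:
  assumes "s \<in> states" "0 \<le> t"
  shows "((\<lambda>r. exp (- ((q - b s) * r))) has_integral (1 - exp (- ((q - b s) * t))) / (q - b s)) {0..t}"
proof -
  define d where "d = q - b s"
  have d: "0 < d"
    unfolding d_def by (rule rate_pos[OF assms(1)])
  have "((\<lambda>r. exp (- (d * r))) has_integral - exp (- (d * t)) / d - (- exp (- (d * 0)) / d)) {0..t}"
    using d assms(2)
    by (intro fundamental_theorem_of_calculus)
      (auto intro!: derivative_eq_intros simp: has_real_derivative_iff_has_vector_derivative[symmetric])
  then show ?thesis
    by (simp add: diff_divide_distrib d_def)
qed

text \<open>A price gap grows like \<open>exp (b s * r)\<close> along the flow, against the factor
  \<open>exp (- q * r)\<close>; the Lipschitz constant of \<open>v (- s)\<close> is therefore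
  integrated against \<open>exp (- ((q - b s) * r))\<close>.\<close>

lemma jump_gain_diff_le:
  assumes "admissible v" "s \<in> states" "0 \<le> t"
  shows "\<bar>jump_gain v s y t - jump_gain v s y' t\<bar>
    \<le> l * c (- s) * \<bar>y - y'\<bar> * ((1 - exp (- ((q - b s) * t))) / (q - b s))"
proof -
  have int: "((\<lambda>r. l * c (- s) * \<bar>y - y'\<bar> * exp (- ((q - b s) * r))) has_integral
      l * c (- s) * \<bar>y - y'\<bar> * ((1 - exp (- ((q - b s) * t))) / (q - b s))) {0..t}"
    by (rule has_integral_mult_right[OF rate_integral[OF assms(2,3)]])
  have diff: "jump_gain v s y t - jump_gain v s y' t = integral {0..t} (\<lambda>r. l * exp (- q * r) * v (- s) (y * exp (b s * r))
      - l * exp (- q * r) * v (- s) (y' * exp (b s * r)))"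
    unfolding jump_gain_def by (rule integral_diff[symmetric]) (intro jump_gain_integrable assms)+
  have "\<bar>jump_gain v s y t - jump_gain v s y' t\<bar>
      \<le> integral {0..t} (\<lambda>r. l * c (- s) * \<bar>y - y'\<bar> * exp (- ((q - b s) * r)))"
    unfolding diff real_norm_def[symmetric]
  proof (rule integral_norm_bound_integral)
    show "(\<lambda>r. l * exp (- q * r) * v (- s) (y * exp (b s * r))
      - l * exp (- q * r) * v (- s) (y' * exp (b s * r))) integrable_on {0..t}"
      by (intro integrable_diff jump_gain_integrable assms)
    show "(\<lambda>r. l * c (- s) * norm (y - y') * exp (- ((q - b s) * r))) integrable_on {0..t}"
      using int by (auto simp: integrable_on_def)
    fix r assume "r \<in> {0..t}"
    have "\<bar>v (- s) (y * exp (b s * r)) - v (- s) (y' * exp (b s * r))\<bar> \<le> c (- s) * \<bar>y * exp (b s * r) - y' * exp (b s * r)\<bar>"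
      by (rule admissible_lipschitz[OF assms(1) neg_state[OF assms(2)]])
    also have "\<dots> = c (- s) * \<bar>y - y'\<bar> * exp (b s * r)"
      by (simp add: left_diff_distrib[symmetric] abs_mult)
    finally have "l * exp (- q * r) * \<bar>v (- s) (y * exp (b s * r)) - v (- s) (y' * exp (b s * r))\<bar>
        \<le> l * exp (- q * r) * (c (- s) * \<bar>y - y'\<bar> * exp (b s * r))"
      using pos by (intro mult_left_mono) auto
    also have "\<dots> = l * c (- s) * \<bar>y - y'\<bar> * (exp (- q * r) * exp (b s * r))"
      by (simp only: mult_ac)
    also have "\<dots> = l * c (- s) * \<bar>y - y'\<bar> * exp (- ((q - b s) * r))"
      by (simp only: exp_rate)
    finally show "norm (l * exp (- q * r) * v (- s) (y * exp (b s * r))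
      - l * exp (- q * r) * v (- s) (y' * exp (b s * r))) \<le> l * c (- s) * norm (y - y') * exp (- ((q - b s) * r))"
      using pos by (simp add: right_diff_distrib[symmetric] abs_mult)
  qed
  then show ?thesis
    by (simp only: integral_unique[OF int])
qed

lemma jump_gain_0: "admissible v \<Longrightarrow> s \<in> states \<Longrightarrow> jump_gain v s 0 t = 0"
  by (simp add: jump_gain_def admissible_0[OF _ neg_state])

lemma jump_gain_nonneg: "admissible v \<Longrightarrow> s \<in> states \<Longrightarrow> 0 \<le> jump_gain v s y t"
  unfolding jump_gain_def
  using pos admissible_nonneg[OF _ neg_state, of v s] by (intro integral_nonneg jump_gain_integrable) simp_all

lemma jump_gain_mono:
  assumes "admissible v" "admissible v'" "s \<in> states" "\<And>s y. s \<in> states \<Longrightarrow> v s y \<le> v' s y"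
  shows "jump_gain v s y t \<le> jump_gain v' s y t"
  unfolding jump_gain_def
proof (intro integral_le jump_gain_integrable assms(1-3))
  fix r
  show "l * exp (- q * r) * v (- s) (y * exp (b s * r)) \<le> l * exp (- q * r) * v' (- s) (y * exp (b s * r))"
    using pos assms(4)[OF neg_state[OF assms(3)]] by (simp add: mult_left_mono)
qed

text \<open>The gain of stopping at the deterministic time \<open>t\<close> unless the chain jumps earlier, in which
  case \<open>v\<close> is received.\<close>

definition stop_gain :: "(real \<Rightarrow> real \<Rightarrow> real) \<Rightarrow> real \<Rightarrow> real \<Rightarrow> real \<Rightarrow> real" where
  "stop_gain v s y t = jump_gain v s y t + exp (- q * t) * (y * exp (b s * t) - a)"

text \<open>This is where the weight \<open>c\<close> reproduces itself. With \<open>e\<close> the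
  factor in the proof, the jump part has slope at most
  \<open>(1 - e) * l * c (- s) / (q - b s)\<close>, which excessiveness bounds by
  \<open>(1 - e) * c s\<close>; the payoff has slope \<open>e\<close>, at most
  \<open>e * c s\<close> because \<open>c s\<close> is at least \<open>1\<close>.\<close>

lemma stop_gain_lipschitz:
  assumes "admissible v" "s \<in> states" "0 \<le> t"
  shows "\<bar>stop_gain v s y t - stop_gain v s y' t\<bar> \<le> c s * \<bar>y - y'\<bar>"
proof -
  define e where "e = exp (- ((q - b s) * t))"
  have d: "0 < q - b s"
    by (rule rate_pos[OF assms(2)])
  have e: "0 \<le> e" "e \<le> 1"
    using d assms(3) by (auto simp: e_def)
  have split: "stop_gain v s y t - stop_gain v s y' t
      = jump_gain v s y t - jump_gain v s y' t + (y - y') * e"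
    unfolding stop_gain_def e_def exp_rate[symmetric] by (simp add: algebra_simps)
  have "\<bar>jump_gain v s y t - jump_gain v s y' t\<bar> \<le> l * c (- s) * \<bar>y - y'\<bar> * ((1 - e) / (q - b s))"
    unfolding e_def by (rule jump_gain_diff_le[OF assms])
  also have "\<dots> = \<bar>y - y'\<bar> * (1 - e) * (l * c (- s) / (q - b s))"
    by simp
  also have "\<dots> \<le> \<bar>y - y'\<bar> * (1 - e) * c s"
    using e d c_excessive[OF assms(2)]
    by (intro mult_left_mono) (auto simp: divide_le_eq mult.commute)
  finally have "\<bar>jump_gain v s y t - jump_gain v s y' t\<bar> \<le> \<bar>y - y'\<bar> * (1 - e) * c s" .
  moreover have "\<bar>y - y'\<bar> * e \<le> \<bar>y - y'\<bar> * e * c s"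
    using e c_ge_1[of s] mult_left_mono[of 1 "c s" "\<bar>y - y'\<bar> * e"] by simp
  moreover have "\<bar>y - y'\<bar> * (1 - e) * c s + \<bar>y - y'\<bar> * e * c s = c s * \<bar>y - y'\<bar>"
    by (simp add: algebra_simps)
  moreover have "\<bar>(y - y') * e\<bar> = \<bar>y - y'\<bar> * e"
    using e by (simp add: abs_mult)
  ultimately show ?thesis
    unfolding split using abs_triangle_ineq[of "jump_gain v s y t - jump_gain v s y' t" "(y - y') * e"]
    by linarith
qed

lemma stop_gain_at_0: "admissible v \<Longrightarrow> s \<in> states \<Longrightarrow> stop_gain v s 0 t = - a * exp (- q * t)"
  by (simp add: stop_gain_def jump_gain_0)

lemma stop_gain_le: 
  assumes "admissible v" "s \<in> states" "0 \<le> t"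
  shows "stop_gain v s y t \<le> c s * \<bar>y\<bar>"
proof -
  have "0 \<le> a * exp (- q * t)"
    using pos by simp
  then show ?thesis
    using stop_gain_lipschitz[OF assms, of y 0] stop_gain_at_0[OF assms(1,2), of t] by simp
qed

definition best_gain :: "(real \<Rightarrow> real \<Rightarrow> real) \<Rightarrow> real \<Rightarrow> real \<Rightarrow> real" where
  "best_gain v s y = (SUP t\<in>{0..}. stop_gain v s y t)"

lemma stop_gain_bdd: "admissible v \<Longrightarrow> s \<in> states \<Longrightarrow> bdd_above (stop_gain v s y ` {0..})"
  using stop_gain_le by (intro bdd_aboveI[of _ "c s * \<bar>y\<bar>"]) auto

lemma stop_gain_le_best:
  "admissible v \<Longrightarrow> s \<in> states \<Longrightarrow> 0 \<le> t \<Longrightarrow> stop_gain v s y t \<le> best_gain v s y"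
  unfolding best_gain_def by (rule cSUP_upper[OF _ stop_gain_bdd]) auto

lemma best_gain_le: "(\<And>t. 0 \<le> t \<Longrightarrow> stop_gain v s y t \<le> m) \<Longrightarrow> best_gain v s y \<le> m"
  unfolding best_gain_def by (rule cSUP_least) auto

text \<open>Waiting longer and longer lets the terminal payoff vanish, since both
  \<open>q - b s\<close> and \<open>q\<close> are positive, and the jump part is never negative.
  This is how the convention that never stopping pays \<open>0\<close> enters the operator.\<close>

lemma best_gain_nonneg:
  assumes "admissible v" "s \<in> states"
  shows "0 \<le> best_gain v s y"
proof (rule LIMSEQ_le_const2)
  have d: "0 < q - b s"
    by (rule rate_pos[OF assms(2)])
  have lim: "(\<lambda>n. exp (- (d * real n))) \<longlonglongrightarrow> 0" if "0 < d" for d :: real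
  proof -
    have "(\<lambda>n. exp (- d) ^ n) \<longlonglongrightarrow> 0"
      using that by (intro LIMSEQ_realpow_zero) auto
    then show ?thesis
      by (simp add: exp_of_nat_mult[symmetric] mult.commute)
  qed
  have "(\<lambda>n. y * exp (- ((q - b s) * real n)) - a * exp (- (q * real n))) \<longlonglongrightarrow> y * 0 - a * 0"
    by (intro tendsto_intros lim d q_pos)
  then show "(\<lambda>n. y * exp (- ((q - b s) * real n)) - a * exp (- (q * real n))) \<longlonglongrightarrow> 0"
    by simp
  have "y * exp (- ((q - b s) * real n)) - a * exp (- (q * real n)) \<le> best_gain v s y" for n
  proof -
    have "y * exp (- ((q - b s) * real n)) - a * exp (- (q * real n)) \<le> stop_gain v s y (real n)"
      using jump_gain_nonneg[OF assms, of y "real n"]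
      unfolding stop_gain_def exp_rate[symmetric] by (simp add: algebra_simps)
    also have "\<dots> \<le> best_gain v s y"
      by (rule stop_gain_le_best[OF assms]) simp
    finally show ?thesis .
  qed
  then show "\<exists>N. \<forall>n\<ge>N. y * exp (- ((q - b s) * real n)) - a * exp (- (q * real n)) \<le> best_gain v s y"
    by blast
qed

lemma admissible_best_gain:
  assumes "admissible v"
  shows "admissible (best_gain v)"
  unfolding admissible_def
proof (intro ballI conjI allI)
  fix s y y' :: real
  assume s: "s \<in> states"
  show "0 \<le> best_gain v s y"
    by (rule best_gain_nonneg[OF assms s])
  have "best_gain v s 0 \<le> 0"
    using pos by (intro best_gain_le) (simp add: stop_gain_at_0[OF assms s])
  then show "best_gain v s 0 = 0"
    using best_gain_nonneg[OF assms s, of 0] by simp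
  have *: "best_gain v s y \<le> best_gain v s y' + c s * \<bar>y - y'\<bar>" for y y'
  proof (rule best_gain_le)
    fix t :: real assume "0 \<le> t"
    then show "stop_gain v s y t \<le> best_gain v s y' + c s * \<bar>y - y'\<bar>"
      using stop_gain_lipschitz[OF assms s, of t y y'] stop_gain_le_best[OF assms s, of t y'] by linarith
  qed
  show "\<bar>best_gain v s y - best_gain v s y'\<bar> \<le> c s * \<bar>y - y'\<bar>"
    using *[of y y'] *[of y' y] by (simp add: abs_minus_commute)
qed

lemma best_gain_mono:
  assumes "admissible v" "admissible v'" "s \<in> states" "\<And>s y. s \<in> states \<Longrightarrow> v s y \<le> v' s y"
  shows "best_gain v s y \<le> best_gain v' s y"
proof (rule best_gain_le)
  fix t :: real assume t: "0 \<le> t"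
  have "stop_gain v s y t \<le> stop_gain v' s y t"
    unfolding stop_gain_def using jump_gain_mono[OF assms] by simp
  also have "\<dots> \<le> best_gain v' s y"
    by (rule stop_gain_le_best[OF assms(2,3) t])
  finally show "stop_gain v s y t \<le> best_gain v' s y" .
qed

section \<open>The fixed point as supremum of all improvable functions\<close>

definition improvable :: "(real \<Rightarrow> real \<Rightarrow> real) set" where
  "improvable = {v. admissible v \<and> (\<forall>s\<in>states. \<forall>y. v s y \<le> best_gain v s y)}"

text \<open>The greatest admissible function that the operator does not decrease. The common bound
  \<open>c s * \<bar>y\<bar>\<close> makes the real supremum meaningful, and the common Lipschitz
  constant passes to it, so \<open>w\<close> stays in the class.\<close>

definition w :: "real \<Rightarrow> real \<Rightarrow> real" where
  "w s y = (SUP v\<in>improvable. v s y)"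

lemma improvable_nonempty: "improvable \<noteq> {}"
proof -
  have "admissible (\<lambda>_ _. 0)"
    using order_trans[OF zero_le_one c_ge_1] by (auto simp: admissible_def)
  then have "(\<lambda>_ _. 0) \<in> improvable"
    by (auto simp: improvable_def best_gain_nonneg)
  then show ?thesis
    by blast
qed

lemma improvable_le_w: "v \<in> improvable \<Longrightarrow> s \<in> states \<Longrightarrow> v s y \<le> w s y"
  unfolding w_def
  by (rule cSUP_upper) (auto simp: improvable_def intro!: bdd_aboveI[of _ "c s * \<bar>y\<bar>"] admissible_le)

lemma w_le: "(\<And>v. v \<in> improvable \<Longrightarrow> v s y \<le> m) \<Longrightarrow> w s y \<le> m"
  unfolding w_def using improvable_nonempty by (intro cSUP_least)

lemma admissible_w: "admissible w"
  unfolding admissible_def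
proof (intro ballI conjI allI)
  fix s y y' :: real
  assume s: "s \<in> states"
  obtain v where v: "v \<in> improvable"
    using improvable_nonempty by blast
  show pos: "0 \<le> w s y" for y
    using improvable_le_w[OF v s, of y] admissible_nonneg[of v s y] v s by (auto simp: improvable_def)
  have "w s 0 \<le> 0"
    using s by (intro w_le) (auto simp: improvable_def admissible_0)
  then show "w s 0 = 0"
    using pos[of 0] by simp
  have *: "w s y \<le> w s y' + c s * \<bar>y - y'\<bar>" for y y'
  proof (rule w_le)
    fix v assume v: "v \<in> improvable"
    then show "v s y \<le> w s y' + c s * \<bar>y - y'\<bar>"
      using admissible_lipschitz[of v s y y'] improvable_le_w[OF v s, of y'] s
      by (auto simp: improvable_def simp del: insert_iff)
  qed
  show "\<bar>w s y - w s y'\<bar> \<le> c s * \<bar>y - y'\<bar>"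
    using *[of y y'] *[of y' y] by (simp add: abs_minus_commute)
qed

lemma w_fixed_point:
  assumes s: "s \<in> states"
  shows "best_gain w s y = w s y"
proof (rule antisym)
  have le: "w s y \<le> best_gain w s y" if s: "s \<in> states" for s y
  proof (rule w_le)
    fix v assume v: "v \<in> improvable"
    then have "v s y \<le> best_gain v s y"
      using s by (auto simp: improvable_def)
    also have "\<dots> \<le> best_gain w s y"
      using v by (intro best_gain_mono admissible_w improvable_le_w s) (auto simp: improvable_def)
    finally show "v s y \<le> best_gain w s y" .
  qed
  then show "w s y \<le> best_gain w s y"
    using s by blast
  have "best_gain w \<in> improvable"
    unfolding improvable_def
    by (auto intro!: best_gain_mono admissible_w admissible_best_gain le simp del: insert_iff)
  then show "best_gain w s y \<le> w s y"
    by (rule improvable_le_w[OF _ s])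
qed

section \<open>Dynamic programming along the flow of one state\<close>

definition flow_step :: "(real \<Rightarrow> real \<Rightarrow> real) \<Rightarrow> real \<Rightarrow> real \<Rightarrow> real \<Rightarrow> real" where
  "flow_step v s y h = jump_gain v s y h + exp (- q * h) * v s (y * exp (b s * h))"

lemma jump_gain_add:
  assumes "admissible v" "s \<in> states" "0 \<le> h" "0 \<le> t"
  shows "jump_gain v s y (h + t) = jump_gain v s y h + exp (- q * h) * jump_gain v s (y * exp (b s * h)) t"
proof -
  let ?f = "\<lambda>r. l * exp (- q * r) * v (- s) (y * exp (b s * r))"
  have "jump_gain v s y (h + t) = integral {0..h} ?f + integral {h..h + t} ?f"
    unfolding jump_gain_def using assms
    by (intro Henstock_Kurzweil_Integration.integral_combine[symmetric] jump_gain_integrable) auto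
  also have "integral {h..h + t} ?f = integral {0..t} (?f \<circ> (+) h)"
    using integral_shift_Icc_real[of 0 t ?f h] by (simp only: add_0 add.commute[of t h])
  also have "?f \<circ> (+) h = (\<lambda>r. exp (- q * h) * (l * exp (- q * r) * v (- s) (y * exp (b s * h) * exp (b s * r))))"
    by (rule ext) (simp add: distrib_left distrib_right exp_add exp_diff exp_minus divide_inverse mult_ac)
  finally show ?thesis
    by (simp add: jump_gain_def)
qed

text \<open>Memorylessness of the exponential waiting time: if no jump occurs up to
  \<open>h\<close>, the problem restarts from the price reached by the flow.\<close>

lemma stop_gain_add:
  assumes "admissible v" "s \<in> states" "0 \<le> h" "0 \<le> t"
  shows "stop_gain v s y (h + t) = jump_gain v s y h + exp (- q * h) * stop_gain v s (y * exp (b s * h)) t"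
  unfolding stop_gain_def jump_gain_add[OF assms]
  by (simp add: distrib_left exp_add[symmetric] mult.assoc[symmetric] right_diff_distrib)

lemma payoff_le_w: "s \<in> states \<Longrightarrow> y - a \<le> w s y"
  using stop_gain_le_best[OF admissible_w, of s 0 y]
  by (simp add: w_fixed_point stop_gain_def jump_gain_def)

text \<open>Waiting \<open>h\<close> and then any further time \<open>t\<close> is one of the
  choices available at \<open>y\<close>, so its gain is at most \<open>w s y\<close>. Taking the
  supremum over \<open>t\<close> replaces the continuation by \<open>w\<close> at the new price; the
  factor \<open>exp (q * h)\<close> moves the discount to the other side so that the supremum can be
  taken.\<close>

lemma flow_step_le_w:
  assumes s: "s \<in> states" and h: "0 \<le> h"
  shows "flow_step w s y h \<le> w s y"
proof -
  have "best_gain w s (y * exp (b s * h)) \<le> (w s y - jump_gain w s y h) * exp (q * h)"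
  proof (rule best_gain_le)
    fix t :: real assume t: "0 \<le> t"
    have "stop_gain w s y (h + t) \<le> w s y"
      using stop_gain_le_best[OF admissible_w s, of "h + t" y] h t by (simp add: w_fixed_point[OF s])
    then have "exp (- q * h) * stop_gain w s (y * exp (b s * h)) t \<le> w s y - jump_gain w s y h"
      unfolding stop_gain_add[OF admissible_w s h t] by simp
    from mult_left_mono[OF this, of "exp (q * h)"]
    show "stop_gain w s (y * exp (b s * h)) t \<le> (w s y - jump_gain w s y h) * exp (q * h)"
      by (simp add: mult.assoc[symmetric] exp_add[symmetric] mult.commute)
  qed
  then have "w s (y * exp (b s * h)) \<le> (w s y - jump_gain w s y h) * exp (q * h)"
    by (simp add: w_fixed_point[OF s])
  then have "exp (- q * h) * w s (y * exp (b s * h)) \<le> exp (- q * h) * ((w s y - jump_gain w s y h) * exp (q * h))"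
    by (intro mult_left_mono) auto
  also have "\<dots> = w s y - jump_gain w s y h"
    by (simp add: exp_minus)
  finally show ?thesis
    by (simp add: flow_step_def)
qed

text \<open>Within time \<open>t\<close> the excess over the immediate payoff has two sources: a
  jump into a function of slope at most \<open>\<kappa>\<close>, worth at most
  \<open>l * \<kappa> * y * t\<close>, and the postponed payment of \<open>a\<close>, worth at most
  \<open>a * q * t\<close>.\<close>

lemma stop_gain_short:
  assumes v: "admissible v" and s: "s \<in> states" and t: "0 \<le> t" and y: "0 \<le> y"
  shows "stop_gain v s y t \<le> y - a + t * (l * \<kappa> * y + a * q)"
proof -
  have d: "0 < q - b s"
    by (rule rate_pos[OF s])
  have e: "1 - exp (- x) \<le> x" for x :: real
    using exp_ge_add_one_self[of "- x"] by linarith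
  have "jump_gain v s y t \<le> l * c (- s) * y * ((1 - exp (- ((q - b s) * t))) / (q - b s))"
    using jump_gain_diff_le[OF v s t, of y 0] y by (simp add: jump_gain_0[OF v s])
  also have "\<dots> \<le> l * \<kappa> * y * t"
    using pos y d t e[of "(q - b s) * t"] c_le_\<kappa>[of "- s"] c_ge_1[of "- s"] \<kappa>_ge
    by (intro mult_mono) (auto simp: divide_le_eq mult.commute)
  finally have "jump_gain v s y t \<le> l * \<kappa> * y * t" .
  moreover have "exp (- q * t) * (y * exp (b s * t) - a) = y * exp (- ((q - b s) * t)) - a * exp (- (q * t))"
    unfolding exp_rate[symmetric] by (simp add: algebra_simps)
  moreover have "y * exp (- ((q - b s) * t)) \<le> y"
    using y d t by (simp add: mult_left_le)
  moreover have "a - a * exp (- (q * t)) \<le> a * (q * t)"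
    using mult_left_mono[OF e[of "q * t"], of a] pos by (simp add: right_diff_distrib)
  moreover have "t * (l * \<kappa> * y + a * q) = l * \<kappa> * y * t + a * (q * t)"
    by (simp add: distrib_left)
  ultimately show ?thesis
    unfolding stop_gain_def by linarith
qed

text \<open>By the margin no waiting time up to \<open>h\<close> comes close to
  \<open>w s y\<close>, so the supremum is approached by longer ones, and all of these factor
  through the flow step. No optimal waiting time has to exist.\<close>

lemma flow_step_eq_w:
  assumes s: "s \<in> states" and y: "0 \<le> y" and h: "0 \<le> h"
    and margin: "y - a + h * (l * \<kappa> * y + a * q) < w s y"
  shows "flow_step w s y h = w s y"
proof (rule antisym[OF flow_step_le_w[OF s h]])
  have "best_gain w s y \<le> max (flow_step w s y h) (y - a + h * (l * \<kappa> * y + a * q))"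
  proof (rule best_gain_le)
    fix t :: real assume t: "0 \<le> t"
    show "stop_gain w s y t \<le> max (flow_step w s y h) (y - a + h * (l * \<kappa> * y + a * q))"
    proof (cases "t \<le> h")
      case True
      have "t * (l * \<kappa> * y + a * q) \<le> h * (l * \<kappa> * y + a * q)"
        using True pos y q_pos \<kappa>_ge by (intro mult_right_mono) auto
      then show ?thesis
        using stop_gain_short[OF admissible_w s t y] by linarith
    next
      case False
      have "stop_gain w s y t = jump_gain w s y h + exp (- q * h) * stop_gain w s (y * exp (b s * h)) (t - h)"
        using stop_gain_add[OF admissible_w s h, of "t - h" y] False by simp
      also have "stop_gain w s (y * exp (b s * h)) (t - h) \<le> w s (y * exp (b s * h))"
        using stop_gain_le_best[OF admissible_w s, of "t - h" "y * exp (b s * h)"] False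
        by (simp add: w_fixed_point[OF s])
      finally show ?thesis
        by (simp add: flow_step_def)
    qed
  qed
  then show "w s y \<le> flow_step w s y h"
    using margin by (simp add: w_fixed_point[OF s])
qed

section \<open>Smooth fit for the solution\<close>

lemma jump_gain_has_derivative:
  assumes v: "admissible v" and s: "s \<in> states" and t: "0 < t"
  shows "(jump_gain v s y has_real_derivative l * exp (- q * t) * v (- s) (y * exp (b s * t))) (at t)"
proof -
  have "(jump_gain v s y has_real_derivative l * exp (- q * t) * v (- s) (y * exp (b s * t))) (at t within {0..t + 1})"
    unfolding jump_gain_def using t
    by (intro integral_has_real_derivative jump_gain_continuous[OF v s]) auto
  then show ?thesis
    using at_within_Icc_at[of 0 t "t + 1"] t by simp
qed

text \<open>Only a Lipschitz bound is known for \<open>w s\<close>, so the derivative comes from an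
  explicit formula. From a price \<open>z\<close> slightly upstream, the flow step is an equality
  and expresses \<open>w s\<close> near \<open>y\<close> through the constant \<open>w s z\<close>
  and a jump integral; the latter is differentiable in time because \<open>w (- s)\<close> is
  continuous. Upward drift allows time to be exchanged for price by a logarithm.\<close>

lemma w_has_derivative:
  assumes s: "s \<in> states" and b: "0 < b s" and y: "0 < y" and cont: "y - a < w s y"
  shows "(w s has_real_derivative (q * w s y - l * w (- s) y) / (b s * y)) (at y)"
proof -
  let ?z = "\<lambda>h. y * exp (- (b s * h))"
  \<comment> \<open>At \<open>h = 0\<close> this is the strict margin at \<open>y\<close>. By
    continuity a margin remains at the upstream price \<open>?z h\<close>, for the horizon
    \<open>2 * h\<close>: the price \<open>y\<close> is reached at time \<open>h\<close>, inside
    that horizon, which yields a two-sided derivative.\<close>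
  have "isCont (\<lambda>h. w s (?z h) - (?z h - a + 2 * h * (l * \<kappa> * ?z h + a * q))) 0"
    using admissible_continuous[OF admissible_w s, of UNIV]
    by (intro continuous_intros isCont_o2[of 0 ?z "w s"]) (auto simp: continuous_on_eq_continuous_at)
  then have "((\<lambda>h. w s (?z h) - (?z h - a + 2 * h * (l * \<kappa> * ?z h + a * q)))
      \<longlongrightarrow> w s y - (y - a)) (at_right 0)"
    by (auto simp: isCont_def intro: filterlim_mono[OF _ order_refl at_le])
  then have "\<forall>\<^sub>F h in at_right 0. 0 < w s (?z h) - (?z h - a + 2 * h * (l * \<kappa> * ?z h + a * q))"
    using cont by (intro order_tendstoD) auto
  from this obtain h where h: "0 < h" "?z h - a + 2 * h * (l * \<kappa> * ?z h + a * q) < w s (?z h)"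
  proof -
    assume *: "\<forall>\<^sub>F h in at_right 0. 0 < w s (?z h) - (?z h - a + 2 * h * (l * \<kappa> * ?z h + a * q))"
    then obtain e where "0 < e" "\<And>h. 0 < h \<Longrightarrow> h < e \<Longrightarrow> 0 < w s (?z h) - (?z h - a + 2 * h * (l * \<kappa> * ?z h + a * q))"
      unfolding eventually_at_right_field by blast
    from this(1) this(2)[of "e / 2"] show ?thesis
      by (intro that[of "e / 2"]) simp_all
  qed
  define z where "z = ?z h"
  have z: "0 < z" "z * exp (b s * h) = y" "y / z = exp (b s * h)"
    using y by (auto simp: z_def exp_minus inverse_eq_divide)
  have eq: "w s (z * exp (b s * x)) = exp (q * x) * (w s z - jump_gain w s z x)" if x: "0 \<le> x" "x \<le> 2 * h" for x
  proof -
    have "x * (l * \<kappa> * z + a * q) \<le> 2 * h * (l * \<kappa> * z + a * q)"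
      using x z pos \<kappa>_ge q_pos by (intro mult_right_mono) auto
    then have "flow_step w s z x = w s z"
      using h(2) z x by (intro flow_step_eq_w[OF s]) (auto simp: z_def)
    then show ?thesis
      by (simp add: flow_step_def exp_minus field_simps)
  qed
  let ?x = "\<lambda>\<zeta>. ln (\<zeta> / z) / b s"
  have x: "?x y = h"
    using b by (simp add: z)
  define D where "D = (q * w s y - l * w (- s) y) / (b s * y)"
  have d1: "(?x has_real_derivative 1 / (b s * y)) (at y)"
    using y z b by (auto intro!: derivative_eq_intros simp: field_simps)
  have d2: "((\<lambda>x. exp (q * x) * (w s z - jump_gain w s z x)) has_real_derivative
      q * w s y - l * w (- s) y) (at h)"
  proof -
    have "((\<lambda>x. exp (q * x) * (w s z - jump_gain w s z x)) has_real_derivative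
        q * (exp (q * h) * (w s z - jump_gain w s z h))
        - l * (exp (q * h) * exp (- q * h)) * w (- s) (z * exp (b s * h))) (at h)"
      by (rule derivative_eq_intros refl jump_gain_has_derivative[OF admissible_w s h(1)])+ (simp add: algebra_simps)
    moreover have "exp (q * h) * exp (- q * h) = 1"
      by (simp add: exp_minus)
    moreover have "exp (q * h) * (w s z - jump_gain w s z h) = w s y"
      using eq[of h] h(1) z(2) by simp
    ultimately show ?thesis
      using z(2) by simp
  qed
  have "((\<lambda>\<zeta>. exp (q * ?x \<zeta>) * (w s z - jump_gain w s z (?x \<zeta>))) has_real_derivative
      (q * w s y - l * w (- s) y) * (1 / (b s * y))) (at y)"
    by (rule DERIV_chain2[OF _ d1]) (simp add: x d2)
  moreover have "\<forall>\<^sub>F \<zeta> in nhds y. exp (q * ?x \<zeta>) * (w s z - jump_gain w s z (?x \<zeta>)) = w s \<zeta>"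
  proof -
    have "\<forall>\<^sub>F \<zeta> in nhds y. \<zeta> \<in> {z<..<z * exp (b s * (2 * h))}"
    proof (rule eventually_nhds_in_open)
      show "y \<in> {z<..<z * exp (b s * (2 * h))}"
        using b h(1) z(1) unfolding z(2)[symmetric] by auto
    qed auto
    then show ?thesis
    proof eventually_elim
      fix \<zeta> assume \<zeta>: "\<zeta> \<in> {z<..<z * exp (b s * (2 * h))}"
      have "\<zeta> / z < exp (b s * (2 * h))"
        using \<zeta> z by (simp add: divide_less_eq mult.commute)
      then have "ln (\<zeta> / z) < b s * (2 * h)"
        using \<zeta> z ln_less_cancel_iff[of "\<zeta> / z" "exp (b s * (2 * h))"] by simp
      then have "?x \<zeta> \<le> 2 * h"
        using b by (simp add: divide_le_eq mult.commute)
      moreover have "0 \<le> ?x \<zeta>"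
        using \<zeta> z b by auto
      ultimately have "w s (z * exp (b s * ?x \<zeta>)) = exp (q * ?x \<zeta>) * (w s z - jump_gain w s z (?x \<zeta>))"
        by (rule eq[rotated])
      then show "exp (q * ?x \<zeta>) * (w s z - jump_gain w s z (?x \<zeta>)) = w s \<zeta>"
        using \<zeta> z b by simp
    qed
  qed
  ultimately show ?thesis
    by (subst (asm) DERIV_cong_ev[OF refl _ refl]) auto
qed

lemma smooth_fit_w:
  assumes s: "s \<in> states" and b: "0 < b s" and u: "0 < u" and stop: "w s u = u - a"
    and cont: "\<And>y. 0 < y \<Longrightarrow> y < u \<Longrightarrow> y - a < w s y"
  shows "smooth_fit (w s) u"
proof -
  define D where "D y = (q * w s y - l * w (- s) y) / (b s * y)" for y
  have deriv: "(w s has_real_derivative D y) (at y)" if "0 < y" "y < u" for y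
    unfolding D_def by (rule w_has_derivative[OF s b that(1) cont[OF that]])
  have near: "\<forall>\<^sub>F y in at_left u. 0 < y \<and> y < u"
    using u by (intro eventually_conj eventually_at_left_field[THEN iffD2]) auto
  have w_cont: "isCont (w r) y" if "r \<in> states" for r y
    using admissible_continuous[OF admissible_w that, of UNIV] by (simp add: continuous_on_eq_continuous_at)
  have "isCont D u"
    unfolding D_def using u b by (intro continuous_intros w_cont s neg_state) auto
  then have lim: "(D \<longlongrightarrow> D u) (at_left u)"
    by (auto simp: isCont_def intro: filterlim_mono[OF _ order_refl at_le])
  have "D u \<le> 1"
  proof (rule ccontr)
    assume "\<not> D u \<le> 1"
    then have "\<forall>\<^sub>F y in at_left u. 1 < D y"
      using lim by (intro order_tendstoD) auto
    with near have "\<forall>\<^sub>F y in at_left u. (0 < y \<and> y < u) \<and> 1 < D y"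
      by (rule eventually_conj)
    then obtain y0 where y0: "y0 < u" "\<And>y. y0 < y \<Longrightarrow> y < u \<Longrightarrow> 0 < y \<and> 1 < D y"
      unfolding eventually_at_left_field by blast
    define y where "y = (y0 + u) / 2"
    have y: "y0 < y" "y < u"
      using y0(1) by (auto simp: y_def)
    obtain z where z: "y < z" "z < u" "w s u - w s y = (u - y) * D z"
    proof -
      have "\<exists>d z. y < z \<and> z < u \<and> (w s has_real_derivative d) (at z) \<and> w s u - w s y = (u - y) * d"
      proof (rule MVT[OF y(2)])
        show "continuous_on {y..u} (w s)"
          by (rule admissible_continuous[OF admissible_w s])
        show "w s differentiable at x" if "y < x" "x < u" for x
          using deriv[of x] y0(2)[of x] y that by (auto simp: real_differentiable_def)
      qed
      then obtain d z where "y < z" "z < u" "(w s has_real_derivative d) (at z)" "w s u - w s y = (u - y) * d"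
        by blast
      moreover have "D z = d"
        using deriv[of z] y0(2)[of z] y calculation by (auto intro: DERIV_unique)
      ultimately show ?thesis
        using that by blast
    qed
    have "(u - y) * 1 < (u - y) * D z"
      using y0(2)[of z] z y by (intro mult_strict_left_mono) auto
    then have "u - y < w s u - w s y"
      using z(3) by simp
    moreover have "y - a < w s y"
      using cont[of y] y0(2)[of y] y by blast
    ultimately show False
      using stop by linarith
  qed
  moreover have "1 \<le> D u"
  proof -
    \<comment> \<open>The initial slope of the gain from waiting at \<open>u\<close>. It cannot be
      positive, since stopping at once is already optimal; with \<open>w s u = u - a\<close> its
      being at most \<open>0\<close> rearranges to \<open>1 \<le> D u\<close>.\<close>
    have "(stop_gain w s u has_real_derivative
        l * w (- s) u + (b s - q) * u + q * a) (at 0 within {0..1})"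
    proof -
      have "(jump_gain w s u has_real_derivative l * exp (- q * 0) * w (- s) (u * exp (b s * 0))) (at 0 within {0..1})"
        unfolding jump_gain_def
        by (intro integral_has_real_derivative jump_gain_continuous[OF admissible_w s]) auto
      then show ?thesis
        unfolding stop_gain_def by (auto intro!: derivative_eq_intros simp: algebra_simps)
    qed
    then have "((\<lambda>t. (stop_gain w s u t - stop_gain w s u 0) / (t - 0)) \<longlongrightarrow>
        l * w (- s) u + (b s - q) * u + q * a) (at 0 within {0..1})"
      by (simp add: has_field_derivative_iff)
    moreover have "\<forall>\<^sub>F t in at 0 within {0..1}. (stop_gain w s u t - stop_gain w s u 0) / (t - 0) \<le> 0"
    proof -
      have "\<forall>\<^sub>F t in at 0 within {0..1}. t \<in> {0..1} - {0::real}"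
        by (auto simp: eventually_at_filter)
      then show ?thesis
      proof eventually_elim
        fix t :: real assume t: "t \<in> {0..1} - {0}"
        have "stop_gain w s u t \<le> u - a"
          using stop_gain_le_best[OF admissible_w s, of t u] w_fixed_point[OF s] stop t by simp
        then show "(stop_gain w s u t - stop_gain w s u 0) / (t - 0) \<le> 0"
          using t by (simp add: stop_gain_def jump_gain_def divide_le_0_iff)
      qed
    qed
    moreover have "at 0 within {0..1::real} \<noteq> bot"
      by (simp add: trivial_limit_within islimpt_Icc)
    ultimately have "l * w (- s) u + (b s - q) * u + q * a \<le> 0"
      by (intro tendsto_upperbound)
    then show ?thesis
      using u b by (simp add: D_def stop field_simps)
  qed
  ultimately have "D u = 1"
    by simp
  moreover have "(deriv (w s) \<longlongrightarrow> D u) (at_left u)"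
    by (rule Lim_transform_eventually[OF lim])
      (use near in eventually_elim, auto intro!: DERIV_imp_deriv[symmetric] deriv)
  moreover have "\<forall>\<^sub>F y in at_left u. w s differentiable at y"
    using near by eventually_elim (use deriv in \<open>auto simp: real_differentiable_def\<close>)
  ultimately show ?thesis
    by (simp add: smooth_fit_def)
qed

text \<open>In the down state the price loses value at rate \<open>d = q - b (-1)\<close> while
  waiting, and jumps recover at most \<open>l * \<kappa>\<close>, which is strictly less. The price
  \<open>y\<close> balances this net loss \<open>y * (d - l * \<kappa>)\<close> against the saving
  \<open>a * q\<close> from paying \<open>a\<close> later, so the bound on the initial slope of the
  gain is \<open>0\<close>; it remains to see that no later time does better.\<close>

lemma w_down_stops:
  assumes b: "0 < b (-1)"
  shows "\<exists>y\<ge>0. w (-1) y = y - a"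
proof -
  define d where "d = q - b (-1)"
  define y where "y = a * q / (d - l * \<kappa>)"
  have d: "0 < d - l * \<kappa>" "0 < d"
    using \<kappa>_down rate_pos[of "-1"] by (auto simp: d_def q_def b_def)
  have y: "0 \<le> y" "y * (d - l * \<kappa>) = a * q"
    using d pos q_pos by (auto simp: y_def)
  have s: "-1 \<in> states"
    by simp
  have "best_gain w (-1) y \<le> y - a"
  proof (rule best_gain_le)
    fix t :: real assume t: "0 \<le> t"
    define E where "E = exp (- (d * t))"
    have E: "0 \<le> E" "E \<le> 1"
      using d t by (auto simp: E_def)
    \<comment> \<open>The aim is \<open>d * (1 - exp (- (q * t))) \<le> q * (1 - E)\<close>, which
      says that \<open>(1 - exp (- (x * t))) / x\<close> does not increase from \<open>x = d\<close>
      to the larger \<open>x = q = d + b (-1)\<close>. The quantity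
      \<open>b (-1) * d * t * E\<close> lies between the two sides once their common part
      \<open>d * (1 - E)\<close> is removed.\<close>
    have "d * t * E \<le> 1 - E"
    proof -
      have "(1 + d * t) * E \<le> exp (d * t) * E"
        using E by (intro mult_right_mono exp_ge_add_one_self) auto
      then show ?thesis
        by (simp add: E_def exp_minus algebra_simps)
    qed
    then have e1: "b (-1) * (d * t * E) \<le> b (-1) * (1 - E)"
      using b by (intro mult_left_mono) auto
    have e2: "E * d - E * d * exp (- (b (-1) * t)) \<le> E * d * (b (-1) * t)"
    proof -
      have "E * d * (1 - b (-1) * t) \<le> E * d * exp (- (b (-1) * t))"
        using exp_ge_add_one_self[of "- (b (-1) * t)"] E d by (intro mult_left_mono) auto
      then show ?thesis
        by (simp add: algebra_simps)
    qed
    have "exp (- (q * t)) = E * exp (- (b (-1) * t))"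
      by (simp add: E_def d_def exp_add[symmetric] algebra_simps)
    then have "d * (1 - exp (- (q * t))) = d * (1 - E) + (E * d - E * d * exp (- (b (-1) * t)))"
      by (simp add: algebra_simps)
    also have "\<dots> \<le> d * (1 - E) + E * d * (b (-1) * t)"
      using e2 by (rule add_left_mono)
    also have "\<dots> = d * (1 - E) + b (-1) * (d * t * E)"
      by simp
    also have "\<dots> \<le> d * (1 - E) + b (-1) * (1 - E)"
      using e1 by (rule add_left_mono)
    finally have "d * (1 - exp (- (q * t))) \<le> (d + b (-1)) * (1 - E)"
      by (simp only: distrib_right)
    then have "a * (d * (1 - exp (- (q * t)))) \<le> a * (q * (1 - E))"
      using pos by (intro mult_left_mono) (auto simp: d_def)
    also have "\<dots> = y * (d - l * \<kappa>) * (1 - E)"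
      by (simp add: y)
    finally have key: "d * (a * (1 - exp (- (q * t)))) \<le> d * (y * (1 - E)) - l * \<kappa> * y * (1 - E)"
      by (simp add: algebra_simps)
    have "jump_gain w (-1) y t \<le> l * \<kappa> * y * ((1 - E) / d)"
      using jump_gain_diff_le[OF admissible_w s t, of y 0] y jump_gain_0[OF admissible_w s]
      by (simp add: c_def E_def d_def)
    then have "d * jump_gain w (-1) y t \<le> l * \<kappa> * y * (1 - E)"
      using d by (simp add: field_simps)
    with key have "d * (jump_gain w (-1) y t + a * (1 - exp (- (q * t)))) \<le> d * (y * (1 - E))"
      by (simp add: algebra_simps)
    then have "jump_gain w (-1) y t + a * (1 - exp (- (q * t))) \<le> y * (1 - E)"
      using d by simp
    moreover have "exp (- q * t) * (y * exp (b (-1) * t) - a) = y * E - a * exp (- (q * t))"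
      using exp_rate[of t "-1"] by (simp add: E_def d_def algebra_simps)
    ultimately show "stop_gain w (-1) y t \<le> y - a"
      unfolding stop_gain_def by (simp only:) (simp add: right_diff_distrib)
  qed
  then have "w (-1) y = y - a"
    using w_fixed_point[OF s] payoff_le_w[OF s, of y] by (intro antisym) simp_all
  then show ?thesis
    using y by blast
qed

section \<open>From the fixed point to the threshold\<close>

lemma smooth_fit_cong:
  assumes "\<And>y. 0 < y \<Longrightarrow> f y = f' y" "0 < u" "smooth_fit f' u"
  shows "smooth_fit f u"
proof -
  have ev: "\<forall>\<^sub>F z in nhds y. f z = f' z" if "0 < y" for y
    using eventually_nhds_in_open[of "{0<..}" y] that
    by (auto elim!: eventually_mono simp: assms(1))
  have near: "\<forall>\<^sub>F y in at_left u. 0 < y"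
    using assms(2) by (intro eventually_at_left_field[THEN iffD2]) auto
  have "\<forall>\<^sub>F y in at_left u. deriv f' y = deriv f y"
    using near by eventually_elim (auto intro!: deriv_cong_ev ev elim!: eventually_mono[OF ev])
  then have "(deriv f \<longlongrightarrow> 1) (at_left u)"
    using assms(3) by (auto simp: smooth_fit_def intro: Lim_transform_eventually)
  moreover have "\<forall>\<^sub>F y in at_left u. f' differentiable at y"
    using assms(3) by (simp add: smooth_fit_def)
  with near have "\<forall>\<^sub>F y in at_left u. f differentiable at y"
    by eventually_elim (auto simp: real_differentiable_def DERIV_cong_ev[OF refl ev refl])
  ultimately show ?thesis
    by (simp add: smooth_fit_def)
qed

text \<open>By continuity the stopping set is closed, so its infimum is a point where
  \<open>w\<close> equals the payoff, and \<open>w\<close> exceeds the payoff strictly below it.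
  Nonnegativity of \<open>w\<close> places that point at \<open>a\<close> or above, hence away from
  \<open>0\<close>.\<close>

lemma smooth_fit_threshold:
  assumes s: "s \<in> states" and b: "0 < b s" and fin: "\<exists>y\<ge>0. f y = y - a"
    and f: "\<And>y. 0 \<le> y \<Longrightarrow> f y = w s y"
  shows "Inf (ereal ` {y. 0 \<le> y \<and> f y = y - a}) < \<infinity>"
    and "smooth_fit f (real_of_ereal (Inf (ereal ` {y. 0 \<le> y \<and> f y = y - a})))"
proof -
  define S where "S = {y. 0 \<le> y \<and> w s y = y - a}"
  have S: "{y. 0 \<le> y \<and> f y = y - a} = S"
    using f by (auto simp: S_def)
  have ne: "S \<noteq> {}"
    using fin f by (auto simp: S_def)
  have bdd: "bdd_below S"
    by (auto simp: S_def intro!: bdd_belowI[of _ 0])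
  have "closed S"
  proof -
    have "S = {0..} \<inter> {y. w s y = y - a}"
      by (auto simp: S_def)
    moreover have "closed {y. w s y = y - a}"
      by (intro closed_Collect_eq admissible_continuous[OF admissible_w s] continuous_intros)
    ultimately show ?thesis
      by auto
  qed
  then have u: "Inf S \<in> S"
    by (rule closed_contains_Inf[OF ne bdd])
  have Inf: "Inf (ereal ` S) = ereal (Inf S)"
    using ereal_Inf'[OF bdd ne] by simp
  then show "Inf (ereal ` {y. 0 \<le> y \<and> f y = y - a}) < \<infinity>"
    unfolding S by simp
  have "0 \<le> w s (Inf S)"
    by (rule admissible_nonneg[OF admissible_w s])
  then have pos_u: "0 < Inf S"
    using u pos by (simp add: S_def)
  have "smooth_fit (w s) (Inf S)"
  proof (rule smooth_fit_w[OF s b pos_u])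
    show "w s (Inf S) = Inf S - a"
      using u by (simp add: S_def)
    fix y assume y: "0 < y" "y < Inf S"
    then have "y \<notin> S"
      using cInf_lower[OF _ bdd, of y] by auto
    then show "y - a < w s y"
      using y payoff_le_w[OF s, of y] by (simp add: S_def)
  qed
  then have "smooth_fit f (Inf S)"
    by (rule smooth_fit_cong[rotated 2]) (use f pos_u in auto)
  then show "smooth_fit f (real_of_ereal (Inf (ereal ` {y. 0 \<le> y \<and> f y = y - a})))"
    unfolding S Inf by simp
qed

end

section \<open>The chain over short time intervals\<close>

context two_state_chain
begin

abbreviation past :: "real \<Rightarrow> 'a measure" where
  "past t \<equiv> natural_filtration (space (P 1)) \<xi> (ennreal t)"

abbreviation trans_prob :: "real \<Rightarrow> real \<Rightarrow> real \<Rightarrow> real" where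
  "trans_prob h x y \<equiv> measure (P x) {\<omega> \<in> space (P x). \<xi> h \<omega> = y}"

section \<open>Measurability of the chain, of its time integral and of the price\<close>

lemma sets_P: "s \<in> states \<Longrightarrow> sets (P s) = sets (P 1)"
  using same_events by auto

lemma space_P: "s \<in> states \<Longrightarrow> space (P s) = space (P 1)"
  by (rule sets_eq_imp_space_eq[OF sets_P])

lemma chain_measurable: "s \<in> states \<Longrightarrow> 0 \<le> t \<Longrightarrow> \<xi> t \<in> borel_measurable (P s)"
  using measurable_chain[of t] measurable_cong_sets[OF sets_P refl, of s borel] by blast

lemma space_past: "space (past t) = space (P 1)"
  by (simp add: natural_filtration_def space_measure_of_conv)

lemma natural_events_subset: "natural_events (space (P 1)) \<xi> t \<subseteq> sets (P 1)"
  using measurable_chain by (auto simp: natural_events_def intro: measurable_sets)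

lemma sets_past: "sets (past t) = sigma_sets (space (P 1)) (natural_events (space (P 1)) \<xi> (ennreal t))"
  unfolding natural_filtration_def by (rule sets_measure_of) (auto simp: natural_events_def)

lemma subalgebra_past: "s \<in> states \<Longrightarrow> subalgebra (P s) (past t)"
  unfolding subalgebra_def
  using sets.sigma_sets_subset[OF natural_events_subset, of "ennreal t"] sets_P[of s] space_P[of s]
  by (simp only: sets_past space_past)

lemma past_measurable: "0 \<le> u \<Longrightarrow> u \<le> t \<Longrightarrow> \<xi> u \<in> borel_measurable (past t)"
  by (rule measurableI)
    (auto simp: space_past sets_past natural_events_def intro!: sigma_sets.Basic exI[of _ u] ennreal_leI)

lemma past_measurable_P:
  "s \<in> states \<Longrightarrow> f \<in> borel_measurable (past t) \<Longrightarrow> f \<in> borel_measurable (P s)"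
  by (rule measurable_from_subalg[OF subalgebra_past])

lemma chain_right_constant:
  assumes "\<omega> \<in> space (P 1)" "0 \<le> u"
  obtains e where "0 < e" "\<And>v. u \<le> v \<Longrightarrow> v < u + e \<Longrightarrow> \<xi> v \<omega> = \<xi> u \<omega>"
proof -
  obtain J where J: "finite J"
    "\<And>u' v. 0 \<le> u' \<Longrightarrow> u' \<le> v \<Longrightarrow> v \<le> u + 1 \<Longrightarrow> {u'<..v} \<inter> J = {} \<Longrightarrow> \<xi> u' \<omega> = \<xi> v \<omega>"
    using paths[OF assms(1)] assms(2) unfolding rc_piecewise_constant_def
    by (metis add_nonneg_nonneg zero_le_one)
  \<comment> \<open>The distance to the next listed jump time. The entry \<open>1\<close> keeps the
    minimum defined when there is none and confines \<open>v\<close> to the horizon on which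
    \<open>J\<close> is valid.\<close>
  define e where "e = Min (insert 1 ((\<lambda>j. j - u) ` {j \<in> J. u < j}))"
  have "0 < e"
    using J(1) by (auto simp: e_def)
  moreover have "\<xi> v \<omega> = \<xi> u \<omega>" if "u \<le> v" "v < u + e" for v
  proof (rule J(2)[symmetric])
    have "e \<le> 1"
      unfolding e_def using J(1) by (intro Min_le) auto
    then show "v \<le> u + 1"
      using that by simp
    have "e \<le> j - u" if "j \<in> J" "u < j" for j
      unfolding e_def using J(1) that by (intro Min_le) auto
    then show "{u<..v} \<inter> J = {}"
      using that by force
  qed (use assms that in auto)
  ultimately show ?thesis
    by (rule that)
qed

text \<open>Sampling the path at the next grid point converges pointwise because paths are
  right-continuous.\<close>

lemma chain_jointly_measurable:
  assumes t0: "0 \<le> t0" "t0 \<le> t"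
  shows "(\<lambda>(u, \<omega>). \<xi> (max t0 (min u t)) \<omega>) \<in> borel_measurable (borel \<Otimes>\<^sub>M past t)"
proof -
  define r where "r n u = real_of_int \<lceil>u * real (Suc n)\<rceil> / real (Suc n)" for n u
  have meas: "(\<lambda>(u, \<omega>). \<xi> (max t0 (min (r n u) t)) \<omega>) \<in> borel_measurable (borel \<Otimes>\<^sub>M past t)" for n
  proof -
    \<comment> \<open>The rounded time has countably many values, so it suffices to fix the integer.
      Clamping to the interval from \<open>t0\<close> to \<open>t\<close> makes each sample
      measurable for the past of \<open>t\<close>.\<close>
    have "(\<lambda>p. \<xi> (max t0 (min (real_of_int (case p of (u, \<omega>) \<Rightarrow> \<lceil>u * real (Suc n)\<rceil>) / real (Suc n)) t)) (snd p))
        \<in> borel_measurable (borel \<Otimes>\<^sub>M past t)"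
    proof (rule measurable_compose_countable[where
          f = "\<lambda>i p. \<xi> (max t0 (min (real_of_int i / real (Suc n)) t)) (snd p)"])
      fix i :: int
      have "\<xi> (max t0 (min (real_of_int i / real (Suc n)) t)) \<in> borel_measurable (past t)"
        using t0 by (intro past_measurable) auto
      then show "(\<lambda>p. \<xi> (max t0 (min (real_of_int i / real (Suc n)) t)) (snd p)) \<in> borel_measurable (borel \<Otimes>\<^sub>M past t)"
        by measurable
      show "(\<lambda>p. case p of (u, \<omega>) \<Rightarrow> \<lceil>u * real (Suc n)\<rceil>) \<in> measurable (borel \<Otimes>\<^sub>M past t) (count_space UNIV)"
        by measurable
    qed
    then show ?thesis
      by (simp add: r_def split_beta')
  qed
  have lim: "(\<lambda>n. case p of (u, \<omega>) \<Rightarrow> \<xi> (max t0 (min (r n u) t)) \<omega>)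
      \<longlonglongrightarrow> (case p of (u, \<omega>) \<Rightarrow> \<xi> (max t0 (min u t)) \<omega>)"
    if p: "p \<in> space (borel \<Otimes>\<^sub>M past t)" for p
  proof -
    obtain u \<omega> where u: "p = (u, \<omega>)" "\<omega> \<in> space (P 1)"
      using p by (auto simp: space_pair_measure space_past)
    have r: "u \<le> r n u" "r n u \<le> u + 1 / real (Suc n)" for n
    proof -
      have m: "0 < real (Suc n)"
        by simp
      have "u * real (Suc n) \<le> real_of_int \<lceil>u * real (Suc n)\<rceil>"
        "real_of_int \<lceil>u * real (Suc n)\<rceil> \<le> u * real (Suc n) + 1"
        by linarith+
      then show "u \<le> r n u" "r n u \<le> u + 1 / real (Suc n)"
        using m unfolding r_def by (simp_all only: pos_le_divide_eq pos_divide_le_eq distrib_right) simp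
    qed
    have "(\<lambda>n. r n u) \<longlonglongrightarrow> u"
    proof (rule tendsto_sandwich[where f = "\<lambda>_. u"])
      show "(\<lambda>n. u + 1 / real (Suc n)) \<longlonglongrightarrow> u"
        using tendsto_add[OF tendsto_const LIMSEQ_inverse_real_of_nat, of u] by (simp add: inverse_eq_divide)
    qed (use r in auto)
    then have lim: "(\<lambda>n. max t0 (min (r n u) t)) \<longlonglongrightarrow> max t0 (min u t)"
      by (intro tendsto_intros)
    have "0 \<le> max t0 (min u t)"
      using t0 by simp
    then obtain e where e: "0 < e" "\<And>v. max t0 (min u t) \<le> v \<Longrightarrow> v < max t0 (min u t) + e \<Longrightarrow> \<xi> v \<omega> = \<xi> (max t0 (min u t)) \<omega>"
      using chain_right_constant[OF u(2)] by metis
    have "\<forall>\<^sub>F n in sequentially. max t0 (min (r n u) t) < max t0 (min u t) + e"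
      using lim e(1) by (intro order_tendstoD) auto
    then have "\<forall>\<^sub>F n in sequentially. \<xi> (max t0 (min (r n u) t)) \<omega> = \<xi> (max t0 (min u t)) \<omega>"
      by eventually_elim (use r in \<open>auto intro!: e(2) max.mono min.mono\<close>)
    then show ?thesis
      unfolding u by (simp add: tendsto_eventually)
  qed
  show ?thesis
    by (rule borel_measurable_LIMSEQ_real[OF lim meas])
qed

lemma path_set_integrable:
  assumes "0 \<le> t0" "t0 \<le> t" "\<omega> \<in> space (P 1)"
  shows "set_integrable lborel {t0..t} (\<lambda>u. \<xi> u \<omega>)"
proof -
  have "(\<lambda>u. \<xi> (max t0 (min u t)) \<omega>) \<in> borel_measurable lborel"
    using measurable_compose[OF measurable_Pair2'[of \<omega> "past t" borel] chain_jointly_measurable[OF assms(1,2)]] assms(3)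
    by (simp add: space_past)
  then have "set_integrable lborel {t0..t} (\<lambda>u. \<xi> (max t0 (min u t)) \<omega>)"
    unfolding set_integrable_def
  proof (intro integrableI_bounded_set_indicator[where B = 1])
    have "\<bar>\<xi> (max t0 (min u t)) \<omega>\<bar> \<le> 1" for u
      using chain_in_states[of "max t0 (min u t)" \<omega>] assms by fastforce
    then show "AE u \<in> {t0..t} in lborel. norm (\<xi> (max t0 (min u t)) \<omega>) \<le> 1"
      by (intro AE_I2 impI) (simp only: real_norm_def)
  qed (use assms in \<open>auto simp: emeasure_lborel_Icc_eq\<close>)
  then show ?thesis
    by (rule set_integrable_cong[THEN iffD1, rotated 3]) auto
qed

lemma path_integrable:
  "0 \<le> t0 \<Longrightarrow> \<omega> \<in> space (P 1) \<Longrightarrow> (\<lambda>u. \<xi> u \<omega>) integrable_on {t0..t}"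
  using set_borel_integral_eq_integral(1)[OF path_set_integrable] by (cases "t0 \<le> t") auto

lemma path_integral_measurable:
  assumes "0 \<le> t"
  shows "(\<lambda>\<omega>. integral {0..t} (\<lambda>u. \<xi> u \<omega>)) \<in> borel_measurable (past t)"
proof -
  have "(\<lambda>\<omega>. \<integral>u. indicator {0..t} u * \<xi> (max 0 (min u t)) \<omega> \<partial>lborel) \<in> borel_measurable (past t)"
  proof (rule lborel.borel_measurable_lebesgue_integral)
    have "(\<lambda>p. \<xi> (max 0 (min (snd p) t)) (fst p)) \<in> borel_measurable (past t \<Otimes>\<^sub>M borel)"
      using measurable_compose[OF measurable_pair_swap' chain_jointly_measurable[OF order_refl assms]]
      by (simp add: split_beta')
    then show "(\<lambda>(\<omega>, u). indicator {0..t} u * \<xi> (max 0 (min u t)) \<omega>) \<in> borel_measurable (past t \<Otimes>\<^sub>M lborel)"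
      unfolding split_beta' by measurable
  qed
  moreover have "(\<integral>u. indicator {0..t} u * \<xi> (max 0 (min u t)) \<omega> \<partial>lborel) = integral {0..t} (\<lambda>u. \<xi> u \<omega>)"
    if "\<omega> \<in> space (past t)" for \<omega>
  proof -
    have "(\<integral>u. indicator {0..t} u * \<xi> (max 0 (min u t)) \<omega> \<partial>lborel) = (LINT u:{0..t}|lborel. \<xi> u \<omega>)"
      unfolding set_lebesgue_integral_def by (rule Bochner_Integration.integral_cong) (auto simp: indicator_def)
    also have "\<dots> = integral {0..t} (\<lambda>u. \<xi> u \<omega>)"
      using that assms by (intro set_borel_integral_eq_integral(2) path_set_integrable) (auto simp: space_past)
    finally show ?thesis .
  qed
  ultimately show ?thesis
    by (subst measurable_cong[symmetric]) auto
qed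

lemma price_measurable:
  assumes "0 \<le> t"
  shows "price \<mu> \<sigma> \<xi> y t \<in> borel_measurable (past t)"
  using path_integral_measurable[OF assms] unfolding price_def by measurable

section \<open>First-order transition probabilities, the Markov property for functions, and the mean
  deviation of the path\<close>

lemma trans_prob_near_0:
  assumes "0 < e"
  obtains h0 where "0 < h0"
    "\<And>h x y. 0 \<le> h \<Longrightarrow> h < h0 \<Longrightarrow> x \<in> states \<Longrightarrow> y \<in> states
      \<Longrightarrow> \<bar>trans_prob h x y - (if x = y then 1 - l * h else l * h)\<bar> \<le> e * h"
proof -
  have at_0: "trans_prob 0 x y = (if x = y then 1 else 0)" if xy: "x \<in> states" "y \<in> states" for x y
  proof -
    interpret prob_space "P x"
      by (rule prob[OF xy(1)])
    have m: "{\<omega> \<in> space (P x). \<xi> 0 \<omega> = y} \<in> events"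
      using chain_measurable[OF xy(1), of 0] by measurable
    show ?thesis
    proof (cases "x = y")
      case True
      then show ?thesis
        using start[OF xy(1)] m prob_Collect_eq_1[of "\<lambda>\<omega>. \<xi> 0 \<omega> = y"] by simp
    next
      case False
      then show ?thesis
        using start[OF xy(1)] m prob_Collect_eq_0[of "\<lambda>\<omega>. \<xi> 0 \<omega> = y"] by (auto elim: eventually_mono)
    qed
  qed
  have "\<exists>h0>0. \<forall>h. 0 \<le> h \<and> h < h0 \<longrightarrow> \<bar>trans_prob h x y - (if x = y then 1 - l * h else l * h)\<bar> \<le> e * h"
    if xy: "x \<in> states" "y \<in> states" for x y
  proof -
    obtain d where d: "0 < d" "\<And>h. 0 \<le> h \<Longrightarrow> norm (h - 0) < d \<Longrightarrow>
        norm (trans_prob h x y - trans_prob 0 x y - generator l x y * (h - 0)) \<le> e * norm (h - 0)"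
      using rates[OF xy] assms unfolding has_field_derivative_def has_derivative_within_alt by (auto simp: mult.commute)
    then have "\<bar>trans_prob h x y - (if x = y then 1 - l * h else l * h)\<bar> \<le> e * h" if "0 \<le> h" "h < d" for h
      using d(2)[of h] that at_0[OF xy] by (auto simp: generator_def algebra_simps split: if_splits)
    then show ?thesis
      using d(1) by blast
  qed
  \<comment> \<open>There are only four pairs of states, so one step bound serves them all. This
    uniformity lets later estimates ignore where the chain is.\<close>
  then have "\<forall>p\<in>states \<times> states. \<exists>h0>0. \<forall>h. 0 \<le> h \<and> h < h0 \<longrightarrow>
      \<bar>trans_prob h (fst p) (snd p) - (if fst p = snd p then 1 - l * h else l * h)\<bar> \<le> e * h"
    by (intro ballI) (simp only: mem_Times_iff)
  from bchoice[OF this] obtain H where H: "\<forall>p\<in>states \<times> states. 0 < H p \<and> (\<forall>h. 0 \<le> h \<and> h < H p \<longrightarrow>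
      \<bar>trans_prob h (fst p) (snd p) - (if fst p = snd p then 1 - l * h else l * h)\<bar> \<le> e * h)"
    by (elim exE)
  show ?thesis
  proof (rule that)
    show "0 < Min (H ` (states \<times> states))"
      using H by (subst Min_gr_iff) auto
    fix h x y
    assume *: "0 \<le> h" "h < Min (H ` (states \<times> states))" "x \<in> states" "y \<in> states"
    have xy: "(x, y) \<in> states \<times> states"
      using *(3,4) by (rule SigmaI)
    then have "Min (H ` (states \<times> states)) \<le> H (x, y)"
      by (intro Min_le imageI) auto
    then show "\<bar>trans_prob h x y - (if x = y then 1 - l * h else l * h)\<bar> \<le> e * h"
      using bspec[OF H xy] less_le_trans[OF *(2)] *(1) unfolding fst_conv snd_conv by blast
  qed
qed

text \<open>The assumption on events says precisely that \<open>trans_prob h x y\<close> times the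
  indicator of \<open>\<xi> t = x\<close> has the defining integrals of a conditional expectation
  given the past. A bounded factor known from the past can then be taken out.\<close>

lemma markov_bounded:
  assumes s: "s \<in> states" and t: "0 \<le> t" and h: "0 \<le> h" and xy: "x \<in> states" "y \<in> states"
    and f: "f \<in> borel_measurable (past t)" and bound: "\<And>\<omega>. \<omega> \<in> space (P 1) \<Longrightarrow> \<bar>f \<omega>\<bar> \<le> C"
  shows "(\<integral>\<omega>. f \<omega> * indicator {\<omega> \<in> space (P 1). \<xi> t \<omega> = x \<and> \<xi> (t + h) \<omega> = y} \<omega> \<partial>P s)
    = trans_prob h x y * (\<integral>\<omega>. f \<omega> * indicator {\<omega> \<in> space (P 1). \<xi> t \<omega> = x} \<omega> \<partial>P s)"
proof -
  interpret prob_space "P s"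
    by (rule prob[OF s])
  interpret finite_measure_subalgebra "P s" "past t"
    by unfold_locales (rule subalgebra_past[OF s])
  define g where "g = (indicator {\<omega> \<in> space (P 1). \<xi> t \<omega> = x \<and> \<xi> (t + h) \<omega> = y} :: 'a \<Rightarrow> real)"
  define g' where "g' = (indicator {\<omega> \<in> space (P 1). \<xi> t \<omega> = x} :: 'a \<Rightarrow> real)"
  have [measurable]: "\<xi> t \<in> borel_measurable (P s)" "\<xi> (t + h) \<in> borel_measurable (P s)"
    using t h by (auto intro: chain_measurable[OF s])
  have [measurable]: "\<xi> t \<in> borel_measurable (past t)"
    using t by (intro past_measurable) auto
  have g_meas: "g \<in> borel_measurable (P s)"
    unfolding g_def space_P[OF s, symmetric] by measurable
  have g'_meas: "g' \<in> borel_measurable (past t)"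
  proof -
    have "{\<omega> \<in> space (past t). \<xi> t \<omega> = x} \<in> sets (past t)"
      by measurable
    then show ?thesis
      unfolding g'_def by (simp add: space_past)
  qed
  have [measurable]: "g' \<in> borel_measurable (P s)" "f \<in> borel_measurable (P s)"
    by (rule past_measurable_P[OF s g'_meas] past_measurable_P[OF s f])+
  have int_g: "integrable (P s) g" "integrable (P s) g'"
    using g_meas \<open>g' \<in> borel_measurable (P s)\<close>
    by (auto intro!: integrable_const_bound[where B = 1] simp: g_def g'_def abs_indicator split: split_indicator)
  have "AE \<omega> in P s. real_cond_exp (P s) (past t) g \<omega> = trans_prob h x y * g' \<omega>"
  proof (rule real_cond_exp_charact)
    fix A assume A: "A \<in> sets (past t)"
    have A': "A \<in> sets (P s)" "A \<subseteq> space (P 1)"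
      using A subalg sets.sets_into_space[OF A] unfolding subalgebra_def space_past by blast+
    have "(LINT \<omega>:A|P s. g \<omega>) = measure (P s) {\<omega> \<in> A. \<xi> t \<omega> = x \<and> \<xi> (t + h) \<omega> = y}"
    proof -
      have "(LINT \<omega>:A|P s. g \<omega>) = (\<integral>\<omega>. indicator {\<omega> \<in> A. \<xi> t \<omega> = x \<and> \<xi> (t + h) \<omega> = y} \<omega> \<partial>P s)"
        unfolding set_lebesgue_integral_def g_def using A'(2)
        by (intro Bochner_Integration.integral_cong) (auto simp: indicator_def)
      then show ?thesis
        using A' by (simp add: Int_absorb2 space_P[OF s] subset_eq)
    qed
    moreover have "(LINT \<omega>:A|P s. trans_prob h x y * g' \<omega>) = trans_prob h x y * measure (P s) {\<omega> \<in> A. \<xi> t \<omega> = x}"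
    proof -
      have "(LINT \<omega>:A|P s. trans_prob h x y * g' \<omega>) = (\<integral>\<omega>. trans_prob h x y * indicator {\<omega> \<in> A. \<xi> t \<omega> = x} \<omega> \<partial>P s)"
        unfolding set_lebesgue_integral_def g'_def using A'(2)
        by (intro Bochner_Integration.integral_cong) (auto simp: indicator_def)
      then show ?thesis
        using A' by (simp add: Int_absorb2 space_P[OF s] subset_eq)
    qed
    ultimately show "(LINT \<omega>:A|P s. g \<omega>) = (LINT \<omega>:A|P s. trans_prob h x y * g' \<omega>)"
      using markov[OF s t h A xy] by (simp only: mult.commute)
  qed (use int_g g'_meas in auto)
  then have "(\<integral>\<omega>. f \<omega> * real_cond_exp (P s) (past t) g \<omega> \<partial>P s) = (\<integral>\<omega>. f \<omega> * (trans_prob h x y * g' \<omega>) \<partial>P s)"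
    using g_meas by (intro integral_cong_AE) (auto elim: eventually_mono)
  moreover have "(\<integral>\<omega>. f \<omega> * real_cond_exp (P s) (past t) g \<omega> \<partial>P s) = (\<integral>\<omega>. f \<omega> * g \<omega> \<partial>P s)"
  proof (rule real_cond_exp_intg)
    show "integrable (P s) (\<lambda>\<omega>. f \<omega> * g \<omega>)"
    proof (rule integrable_const_bound[where B = C])
      have "\<bar>f \<omega>\<bar> * \<bar>g \<omega>\<bar> \<le> C" if "\<omega> \<in> space (P s)" for \<omega>
        using bound[of \<omega>] that by (auto simp: space_P[OF s] g_def indicator_def)
      then show "AE \<omega> in P s. norm (f \<omega> * g \<omega>) \<le> C"
        by (intro AE_I2) (simp add: abs_mult)
    qed (use g_meas in measurable)
  qed (use f g_meas in auto)
  ultimately show ?thesis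
    unfolding g_def[symmetric] g'_def[symmetric] by (simp add: mult.left_commute[of "f _"])
qed

text \<open>Controls the error made in the path integral by freezing the state at time
  \<open>t\<close> for a duration \<open>h\<close>.\<close>

definition deviation :: "real \<Rightarrow> real \<Rightarrow> 'a \<Rightarrow> real" where
  "deviation t h \<omega> = integral {t..t + h} (\<lambda>u. \<bar>\<xi> u \<omega> - \<xi> t \<omega>\<bar>)"

lemma deviation_set_integrable:
  assumes "0 \<le> t" "0 \<le> h" "\<omega> \<in> space (P 1)"
  shows "set_integrable lborel {t..t + h} (\<lambda>u. \<bar>\<xi> u \<omega> - \<xi> t \<omega>\<bar>)"
  using assms
  by (intro set_integrable_abs set_integral_diff path_set_integrable)
    (auto simp: set_integrable_def emeasure_lborel_Icc_eq)

lemma deviation_nonneg: "0 \<le> t \<Longrightarrow> 0 \<le> h \<Longrightarrow> \<omega> \<in> space (P 1) \<Longrightarrow> 0 \<le> deviation t h \<omega>"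
  unfolding deviation_def
  using set_borel_integral_eq_integral(1)[OF deviation_set_integrable, of t h \<omega>]
  by (intro integral_nonneg) auto

lemma abs_path_integral_diff_le:
  assumes "0 \<le> t" "0 \<le> h" "\<omega> \<in> space (P 1)"
  shows "\<bar>integral {t..t + h} (\<lambda>u. \<xi> u \<omega>) - \<xi> t \<omega> * h\<bar> \<le> deviation t h \<omega>"
proof -
  have int: "(\<lambda>u. \<xi> u \<omega>) integrable_on {t..t + h}" "(\<lambda>u. \<xi> t \<omega>) integrable_on {t..t + h}"
    using path_integrable[OF assms(1,3)] by auto
  have "integral {t..t + h} (\<lambda>u. \<xi> u \<omega> - \<xi> t \<omega>) = integral {t..t + h} (\<lambda>u. \<xi> u \<omega>) - \<xi> t \<omega> * h"
    using assms by (simp add: integral_diff[OF int])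
  moreover have "norm (integral {t..t + h} (\<lambda>u. \<xi> u \<omega> - \<xi> t \<omega>)) \<le> deviation t h \<omega>"
    unfolding deviation_def
    using set_borel_integral_eq_integral(1)[OF deviation_set_integrable[OF assms]] int
    by (intro integral_norm_bound_integral integrable_diff) auto
  ultimately show ?thesis
    by simp
qed

lemma measurable_past_ident:
  assumes "s \<in> states"
  shows "(\<lambda>\<omega>. \<omega>) \<in> measurable (P s) (past t)"
  using subalgebra_past[OF assms, of t] unfolding subalgebra_def
  by (intro measurableI) (auto simp: Int_absorb2 sets.sets_into_space)

text \<open>By Fubini the mean is an integral over \<open>u\<close> of the mean of
  \<open>\<bar>\<xi> u - \<xi> t\<bar>\<close>. That variable is \<open>2\<close> on the two events
  of a changed state, each of probability at most \<open>k\<close>, and \<open>0\<close> otherwise;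
  hence the factor \<open>4\<close>. As \<open>k\<close> is later of order \<open>h\<close>, the
  bound is of second order.\<close>

lemma expected_deviation:
  assumes s: "s \<in> states" and t: "0 \<le> t" and h: "0 \<le> h"
    and change: "\<And>r x. 0 \<le> r \<Longrightarrow> r \<le> h \<Longrightarrow> x \<in> states \<Longrightarrow> trans_prob r x (- x) \<le> k" and k: "0 \<le> k"
  shows "integrable (P s) (deviation t h)" and "(\<integral>\<omega>. deviation t h \<omega> \<partial>P s) \<le> 4 * k * h"
proof -
  interpret prob_space "P s"
    by (rule prob[OF s])
  interpret pair_sigma_finite "P s" lborel ..
  define F where "F \<omega> u = indicator {t..t + h} u * \<bar>\<xi> (max t (min u (t + h))) \<omega> - \<xi> t \<omega>\<bar>" for \<omega> u
  have \<xi>_meas: "\<xi> u \<in> borel_measurable (P s)" if "0 \<le> u" for u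
    by (rule chain_measurable[OF s that])
  have F_meas: "(\<lambda>(\<omega>, u). F \<omega> u) \<in> borel_measurable (P s \<Otimes>\<^sub>M lborel)"
  proof -
    have "(\<lambda>p. (snd p, fst p)) \<in> measurable (P s \<Otimes>\<^sub>M lborel) (borel \<Otimes>\<^sub>M past (t + h))"
      using measurable_compose[OF measurable_fst measurable_past_ident[OF s]] by (intro measurable_Pair) auto
    from measurable_compose[OF this chain_jointly_measurable[of t "t + h"]]
    have [measurable]: "(\<lambda>p. \<xi> (max t (min (snd p) (t + h))) (fst p)) \<in> borel_measurable (P s \<Otimes>\<^sub>M lborel)"
      using t h by simp
    have [measurable]: "\<xi> t \<in> borel_measurable (P s)"
      by (rule \<xi>_meas[OF t])
    show ?thesis
      unfolding split_beta' F_def by measurable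
  qed
  have F_int: "integrable lborel (F \<omega>)" "(\<integral>u. F \<omega> u \<partial>lborel) = deviation t h \<omega>"
    if "\<omega> \<in> space (P s)" for \<omega>
  proof -
    have \<omega>: "\<omega> \<in> space (P 1)"
      using that by (simp add: space_P[OF s])
    have eq: "F \<omega> = (\<lambda>u. indicator {t..t + h} u *\<^sub>R \<bar>\<xi> u \<omega> - \<xi> t \<omega>\<bar>)"
      by (auto simp: F_def fun_eq_iff indicator_def)
    show "integrable lborel (F \<omega>)"
      using deviation_set_integrable[OF t h \<omega>] unfolding eq set_integrable_def .
    show "(\<integral>u. F \<omega> u \<partial>lborel) = deviation t h \<omega>"
      using set_borel_integral_eq_integral(2)[OF deviation_set_integrable[OF t h \<omega>]]
      unfolding eq set_lebesgue_integral_def deviation_def .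
  qed
  have F_nonneg: "0 \<le> F \<omega> u" for \<omega> u
    by (simp add: F_def)
  have inner: "(\<integral>\<^sup>+\<omega>. ennreal (F \<omega> u) \<partial>P s) \<le> ennreal (4 * k) * indicator {t..t + h} u" for u
  proof (cases "u \<in> {t..t + h}")
    case True
    have u: "0 \<le> u"
      using True t by simp
    have [measurable]: "\<xi> t \<in> borel_measurable (P s)" "\<xi> u \<in> borel_measurable (P s)"
      using t u by (auto intro: \<xi>_meas)
    have prob_change: "prob {\<omega> \<in> space (P 1). \<xi> t \<omega> = x \<and> \<xi> u \<omega> = - x} \<le> k" if x: "x \<in> states" for x
    proof -
      have "prob {\<omega> \<in> space (P 1). \<xi> t \<omega> = x \<and> \<xi> (t + (u - t)) \<omega> = - x}
          = prob {\<omega> \<in> space (P 1). \<xi> t \<omega> = x} * trans_prob (u - t) x (- x)"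
        using True x t sets.top[of "past t"] unfolding space_past by (intro markov[OF s]) auto
      also have "\<dots> \<le> 1 * k"
        using True x by (intro mult_mono change) auto
      finally show ?thesis
        by simp
    qed
    have "(\<integral>\<^sup>+\<omega>. ennreal (F \<omega> u) \<partial>P s)
        = (\<integral>\<^sup>+\<omega>. 2 * indicator ({\<omega> \<in> space (P 1). \<xi> t \<omega> = 1 \<and> \<xi> u \<omega> = - 1}
          \<union> {\<omega> \<in> space (P 1). \<xi> t \<omega> = - 1 \<and> \<xi> u \<omega> = - (- 1)}) \<omega> \<partial>P s)"
    proof (rule nn_integral_cong)
      fix \<omega> assume "\<omega> \<in> space (P s)"
      then have "\<omega> \<in> space (P 1)" "\<xi> t \<omega> \<in> states" "\<xi> u \<omega> \<in> states"
        using t u chain_in_states by (auto simp: space_P[OF s])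
      then show "ennreal (F \<omega> u) = 2 * indicator ({\<omega> \<in> space (P 1). \<xi> t \<omega> = 1 \<and> \<xi> u \<omega> = - 1}
          \<union> {\<omega> \<in> space (P 1). \<xi> t \<omega> = - 1 \<and> \<xi> u \<omega> = - (- 1)}) \<omega>"
        using True by (auto simp: F_def)
    qed
    also have "\<dots> = 2 * emeasure (P s) ({\<omega> \<in> space (P 1). \<xi> t \<omega> = 1 \<and> \<xi> u \<omega> = - 1}
          \<union> {\<omega> \<in> space (P 1). \<xi> t \<omega> = - 1 \<and> \<xi> u \<omega> = - (- 1)})"
      unfolding space_P[OF s, symmetric] by (intro nn_integral_cmult_indicator) measurable
    also have "\<dots> \<le> 2 * (ennreal k + ennreal k)"
    proof (rule mult_left_mono)
      show "emeasure (P s) ({\<omega> \<in> space (P 1). \<xi> t \<omega> = 1 \<and> \<xi> u \<omega> = - 1}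
          \<union> {\<omega> \<in> space (P 1). \<xi> t \<omega> = - 1 \<and> \<xi> u \<omega> = - (- 1)}) \<le> ennreal k + ennreal k"
        using prob_change[of 1] prob_change[of "-1"] 
        by (intro order_trans[OF emeasure_subadditive] add_mono)
          (auto simp: emeasure_eq_measure space_P[OF s, symmetric] ennreal_leI)
    qed simp
    also have "\<dots> = ennreal (4 * k)"
    proof -
      have "2 * (ennreal k + ennreal k) = ennreal 2 * ennreal (k + k)"
        using k by (simp only: ennreal_plus[OF k k, symmetric] ennreal_numeral)
      also have "\<dots> = ennreal (2 * (k + k))"
        using k by (intro ennreal_mult[symmetric]) auto
      finally show ?thesis
        by simp
    qed
    finally show ?thesis
      using True by simp
  qed (simp add: F_def)
  have dev_meas: "deviation t h \<in> borel_measurable (P s)"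
  proof -
    have "(\<lambda>\<omega>. \<integral>u. F \<omega> u \<partial>lborel) \<in> borel_measurable (P s)"
      by (rule lborel.borel_measurable_lebesgue_integral[OF F_meas])
    then show ?thesis
      by (subst measurable_cong[where g = "\<lambda>\<omega>. \<integral>u. F \<omega> u \<partial>lborel"]) (auto simp: F_int)
  qed
  have "(\<integral>\<^sup>+\<omega>. ennreal (deviation t h \<omega>) \<partial>P s) = (\<integral>\<^sup>+\<omega>. \<integral>\<^sup>+u. ennreal (F \<omega> u) \<partial>lborel \<partial>P s)"
    by (intro nn_integral_cong) (simp add: nn_integral_eq_integral F_int F_nonneg)
  also have "\<dots> = (\<integral>\<^sup>+u. \<integral>\<^sup>+\<omega>. ennreal (F \<omega> u) \<partial>P s \<partial>lborel)"
    using F_meas by (intro Fubini'[symmetric]) (simp add: split_beta')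
  also have "\<dots> \<le> (\<integral>\<^sup>+u. ennreal (4 * k) * indicator {t..t + h} u \<partial>lborel)"
    by (intro nn_integral_mono inner)
  also have "\<dots> = ennreal (4 * k * h)"
    using h k by (simp add: nn_integral_cmult_indicator emeasure_lborel_Icc_eq ennreal_mult)
  finally have le: "(\<integral>\<^sup>+\<omega>. ennreal (deviation t h \<omega>) \<partial>P s) \<le> ennreal (4 * k * h)" .
  have nonneg: "AE \<omega> in P s. 0 \<le> deviation t h \<omega>"
    using t h by (intro AE_I2 deviation_nonneg) (auto simp: space_P[OF s])
  show int: "integrable (P s) (deviation t h)"
    using le by (intro integrableI_nonneg dev_meas nonneg) (auto simp: less_top[symmetric] top_unique)
  show "(\<integral>\<omega>. deviation t h \<omega> \<partial>P s) \<le> 4 * k * h"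
    using le h k unfolding nn_integral_eq_integral[OF int nonneg] by (simp add: ennreal_le_iff)
qed

lemma path_integral_le:
  assumes "0 \<le> t" "0 \<le> h" "\<omega> \<in> space (P 1)"
  shows "\<bar>integral {t..t + h} (\<lambda>u. \<xi> u \<omega>)\<bar> \<le> h"
proof -
  have "norm (integral {t..t + h} (\<lambda>u. \<xi> u \<omega>)) \<le> integral {t..t + h} (\<lambda>_. 1)"
  proof (intro integral_norm_bound_integral path_integrable assms)
    fix u assume "u \<in> {t..t + h}"
    then show "norm (\<xi> u \<omega>) \<le> 1"
      using chain_in_states[of u \<omega>] assms by auto
  qed auto
  then show ?thesis
    using assms by simp
qed

section \<open>Mean change of a function of state and price over one short step\<close>

context
  fixes \<mu> \<sigma> y :: real
  assumes l_nonneg: "0 \<le> l" and \<mu>: "0 \<le> \<mu>" and \<sigma>: "0 \<le> \<sigma>" and y: "0 \<le> y"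
begin

abbreviation Y :: "real \<Rightarrow> 'a \<Rightarrow> real" where
  "Y \<equiv> price \<mu> \<sigma> \<xi> y"

lemma price_add:
  assumes "0 \<le> t" "0 \<le> h" "\<omega> \<in> space (P 1)"
  shows "Y (t + h) \<omega> = Y t \<omega> * exp (\<mu> * h + \<sigma> * integral {t..t + h} (\<lambda>u. \<xi> u \<omega>))"
proof -
  have "integral {0..t} (\<lambda>u. \<xi> u \<omega>) + integral {t..t + h} (\<lambda>u. \<xi> u \<omega>) = integral {0..t + h} (\<lambda>u. \<xi> u \<omega>)"
    using assms by (intro Henstock_Kurzweil_Integration.integral_combine path_integrable) auto
  then show ?thesis
    unfolding price_def by (simp only: flip: \<open>_ = integral {0..t + h} _\<close>) (simp add: exp_add[symmetric] algebra_simps)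
qed

lemma exponent_le:
  assumes "\<bar>i\<bar> \<le> h"
  shows "\<mu> * h + \<sigma> * i \<le> (\<mu> + \<sigma>) * h"
  using mult_left_mono[of i h \<sigma>] assms \<sigma> by (simp add: algebra_simps)

lemma price_nonneg: "0 \<le> Y t \<omega>"
  using y by (simp add: price_def)

lemma price_le:
  assumes "0 \<le> t" "t \<le> T" "\<omega> \<in> space (P 1)"
  shows "Y t \<omega> \<le> y * exp ((\<mu> + \<sigma>) * T)"
proof -
  have "\<mu> * t + \<sigma> * integral {0..t} (\<lambda>u. \<xi> u \<omega>) \<le> (\<mu> + \<sigma>) * t"
    using path_integral_le[of 0 t \<omega>] assms by (intro exponent_le) auto
  also have "\<dots> \<le> (\<mu> + \<sigma>) * T"
    using assms \<mu> \<sigma> by (intro mult_left_mono) auto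
  finally show ?thesis
    unfolding price_def using y by (intro mult_left_mono) auto
qed

lemma price_step_le:
  assumes t: "0 \<le> t" and h: "0 \<le> h" and T: "t + h \<le> T" and \<omega>: "\<omega> \<in> space (P 1)"
  shows "\<bar>Y (t + h) \<omega> - Y t \<omega> * exp ((\<mu> + \<sigma> * \<xi> t \<omega>) * h)\<bar>
    \<le> y * exp ((\<mu> + \<sigma>) * T) * \<sigma> * deviation t h \<omega>"
proof -
  define i where "i = integral {t..t + h} (\<lambda>u. \<xi> u \<omega>)"
  have "\<bar>exp (\<mu> * h + \<sigma> * i) - exp (\<mu> * h + \<sigma> * (\<xi> t \<omega> * h))\<bar>
      \<le> exp ((\<mu> + \<sigma>) * h) * \<bar>(\<mu> * h + \<sigma> * i) - (\<mu> * h + \<sigma> * (\<xi> t \<omega> * h))\<bar>"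
  proof (rule exp_diff_le; rule exponent_le)
    show "\<bar>i\<bar> \<le> h"
      unfolding i_def by (rule path_integral_le[OF t h \<omega>])
    show "\<bar>\<xi> t \<omega> * h\<bar> \<le> h"
      using chain_in_states[OF t \<omega>] h by auto
  qed
  also have "\<bar>(\<mu> * h + \<sigma> * i) - (\<mu> * h + \<sigma> * (\<xi> t \<omega> * h))\<bar> = \<sigma> * \<bar>i - \<xi> t \<omega> * h\<bar>"
    using \<sigma> by (simp add: right_diff_distrib[symmetric] abs_mult)
  finally have e: "\<bar>exp (\<mu> * h + \<sigma> * i) - exp (\<mu> * h + \<sigma> * (\<xi> t \<omega> * h))\<bar>
      \<le> exp ((\<mu> + \<sigma>) * h) * (\<sigma> * \<bar>i - \<xi> t \<omega> * h\<bar>)" .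
  have "Y (t + h) \<omega> - Y t \<omega> * exp ((\<mu> + \<sigma> * \<xi> t \<omega>) * h)
      = Y t \<omega> * (exp (\<mu> * h + \<sigma> * i) - exp (\<mu> * h + \<sigma> * (\<xi> t \<omega> * h)))"
    unfolding price_add[OF t h \<omega>] i_def by (simp add: algebra_simps)
  then have "\<bar>Y (t + h) \<omega> - Y t \<omega> * exp ((\<mu> + \<sigma> * \<xi> t \<omega>) * h)\<bar>
      = Y t \<omega> * \<bar>exp (\<mu> * h + \<sigma> * i) - exp (\<mu> * h + \<sigma> * (\<xi> t \<omega> * h))\<bar>"
    by (simp add: abs_mult price_nonneg)
  also have "\<dots> \<le> (y * exp ((\<mu> + \<sigma>) * t)) * (exp ((\<mu> + \<sigma>) * h) * (\<sigma> * \<bar>i - \<xi> t \<omega> * h\<bar>))"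
    using y by (intro mult_mono e price_le t \<omega>) auto
  also have "\<dots> = y * exp ((\<mu> + \<sigma>) * (t + h)) * (\<sigma> * \<bar>i - \<xi> t \<omega> * h\<bar>)"
    by (simp add: distrib_left exp_add)
  also have "\<dots> \<le> y * exp ((\<mu> + \<sigma>) * T) * (\<sigma> * deviation t h \<omega>)"
    using y \<sigma> \<mu> T abs_path_integral_diff_le[OF t h \<omega>] unfolding i_def[symmetric]
    by (intro mult_mono mult_left_mono exp_le_cancel_iff[THEN iffD2]) auto
  finally show ?thesis
    by (simp add: mult.assoc)
qed

lemma one_step:
  assumes lip: "\<And>s z z'. s \<in> states \<Longrightarrow> \<bar>v s z - v s z'\<bar> \<le> L * \<bar>z - z'\<bar>" and L: "0 \<le> L"
    and e: "0 < e"
  obtains h0 where "0 < h0"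
    "\<And>h t s A. 0 \<le> h \<Longrightarrow> h < h0 \<Longrightarrow> 0 \<le> t \<Longrightarrow> t + h \<le> T \<Longrightarrow> s \<in> states \<Longrightarrow> A \<in> sets (past t) \<Longrightarrow>
      \<bar>(\<integral>\<omega>. indicator A \<omega> * v (\<xi> (t + h) \<omega>) (Y (t + h) \<omega>) \<partial>P s)
        - (\<integral>\<omega>. indicator A \<omega> * ((1 - l * h) * v (\<xi> t \<omega>) (Y t \<omega> * exp ((\<mu> + \<sigma> * \<xi> t \<omega>) * h))
            + l * h * v (- \<xi> t \<omega>) (Y t \<omega> * exp ((\<mu> + \<sigma> * \<xi> t \<omega>) * h))) \<partial>P s)\<bar> \<le> e * h"
proof -
  define m where "m = y * exp ((\<mu> + \<sigma>) * T)"
  define C where "C = \<bar>v 1 0\<bar> + \<bar>v (-1) 0\<bar> + L * m"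
  have m: "0 \<le> m"
    using y by (simp add: m_def)
  have v_bound: "\<bar>v s z\<bar> \<le> C" if "s \<in> states" "0 \<le> z" "z \<le> m" for s z
  proof -
    have "\<bar>v s z\<bar> \<le> \<bar>v s 0\<bar> + L * z"
      using lip[OF that(1), of z 0] that(2) by simp
    also have "L * z \<le> L * m"
      using that L by (intro mult_left_mono) auto
    finally show ?thesis
      using that(1) by (auto simp: C_def)
  qed
  have v_meas: "v s \<in> borel_measurable borel" if "s \<in> states" for s
  proof (rule borel_measurable_continuous_onI, rule lipschitz_on_continuous_on)
    show "L-lipschitz_on UNIV (v s)"
      using lip[OF that] L by (intro lipschitz_onI) (auto simp: dist_real_def)
  qed
  have C: "0 \<le> C"
    using v_bound[of 1 0] m by simp
  \<comment> \<open>Four pairs of states, each contributing at most \<open>C * e' * h\<close>, are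
    to use up at most half of \<open>e * h\<close>; the deviation, through \<open>K\<close>, gets
    the other half.\<close>
  define e' where "e' = e / (2 * (4 * C + 1))"
  define K where "K = L * (m * \<sigma>) * (4 * (l + 1))"
  have e': "0 < e'" "4 * C * e' \<le> e / 2"
    using e C by (auto simp: e'_def field_simps)
  obtain h1 where h1: "0 < h1" "\<And>h x y. 0 \<le> h \<Longrightarrow> h < h1 \<Longrightarrow> x \<in> states \<Longrightarrow> y \<in> states
      \<Longrightarrow> \<bar>trans_prob h x y - (if x = y then 1 - l * h else l * h)\<bar> \<le> e' * h"
    by (rule trans_prob_near_0[OF e'(1)]) (rule that; assumption)
  \<comment> \<open>A crude version with error \<open>h\<close> suffices here: it bounds the
    probability of a change within \<open>h\<close> by \<open>(l + 1) * h\<close>, the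
    \<open>k\<close> of the deviation estimate.\<close>
  obtain h2 where h2: "0 < h2" "\<And>h x y. 0 \<le> h \<Longrightarrow> h < h2 \<Longrightarrow> x \<in> states \<Longrightarrow> y \<in> states
      \<Longrightarrow> \<bar>trans_prob h x y - (if x = y then 1 - l * h else l * h)\<bar> \<le> 1 * h"
    by (rule trans_prob_near_0[OF zero_less_one]) (rule that; assumption)
  define h0 where "h0 = min (min h1 h2) (e / (2 * (\<bar>K\<bar> + 1)))"
  show ?thesis
  proof (rule that)
    show "0 < h0"
      using h1 h2 e by (auto simp: h0_def)
    fix h t s A
    assume h: "0 \<le> h" "h < h0" and t: "0 \<le> t" "t + h \<le> T" and s: "s \<in> states" and A: "A \<in> sets (past t)"
    interpret prob_space "P s"
      by (rule prob[OF s])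
    have sp: "space (P s) = space (P 1)"
      by (rule space_P[OF s])
    define Z where "Z x \<omega> = Y t \<omega> * exp ((\<mu> + \<sigma> * x) * h)" for x \<omega>
    define k where "k x x' = (if x = x' then 1 - l * h else l * h)" for x x' :: real
    define f where "f x x' \<omega> = indicator A \<omega> * v x' (Z x \<omega>)" for x x' \<omega>
    have Z: "0 \<le> Z x \<omega>" "Z x \<omega> \<le> m" if "x \<in> states" "\<omega> \<in> space (P 1)" for x \<omega>
    proof -
      show "0 \<le> Z x \<omega>"
        by (simp add: Z_def price_nonneg)
      have "\<mu> * h + \<sigma> * (x * h) \<le> (\<mu> + \<sigma>) * h"
        using that h by (intro exponent_le) auto
      then have "Z x \<omega> \<le> (y * exp ((\<mu> + \<sigma>) * t)) * exp ((\<mu> + \<sigma>) * h)"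
        unfolding Z_def using y that(2) t
        by (intro mult_mono price_le) (auto simp: algebra_simps)
      also have "\<dots> = y * exp ((\<mu> + \<sigma>) * (t + h))"
        by (simp add: distrib_left exp_add)
      also have "\<dots> \<le> m"
        unfolding m_def using y \<mu> \<sigma> t by (intro mult_left_mono) (auto intro!: mult_left_mono)
      finally show "Z x \<omega> \<le> m" .
    qed
    have f_meas: "f x x' \<in> borel_measurable (past t)" if "x' \<in> states" for x x'
    proof -
      have [measurable]: "price \<mu> \<sigma> \<xi> y t \<in> borel_measurable (past t)" "v x' \<in> borel_measurable borel"
        by (rule price_measurable[OF t(1)] v_meas[OF that])+
      show ?thesis
        using A unfolding f_def Z_def by measurable
    qed
    have f_bound: "\<bar>f x x' \<omega>\<bar> \<le> C" if "x \<in> states" "x' \<in> states" "\<omega> \<in> space (P 1)" for x x' \<omega>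
      using v_bound[OF that(2) Z[OF that(1,3)]] C by (simp add: f_def indicator_def abs_mult)
    have [measurable]: "\<xi> t \<in> borel_measurable (P s)" "\<xi> (t + h) \<in> borel_measurable (P s)"
      using t h by (auto intro: chain_measurable[OF s])
    have [measurable]: "f x x' \<in> borel_measurable (P s)" if "x' \<in> states" for x x'
      by (rule past_measurable_P[OF s f_meas[OF that]])
    have f_int: "integrable (P s) (\<lambda>\<omega>. f x x' \<omega> * indicator B \<omega>)"
      if "x \<in> states" "x' \<in> states" "B \<in> sets (P s)" for x x' B
    proof (rule integrable_const_bound[where B = C])
      show "AE \<omega> in P s. norm (f x x' \<omega> * indicator B \<omega>) \<le> C"
        using f_bound[OF that(1,2)] C by (intro AE_I2) (simp add: sp indicator_def)
      have [measurable]: "f x x' \<in> borel_measurable (P s)"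
        by (rule past_measurable_P[OF s f_meas[OF that(2)]])
      show "(\<lambda>\<omega>. f x x' \<omega> * indicator B \<omega>) \<in> borel_measurable (P s)"
        using that(3) by measurable
    qed
    define S where "S x = {\<omega> \<in> space (P 1). \<xi> t \<omega> = x}" for x
    define S' where "S' x x' = {\<omega> \<in> space (P 1). \<xi> t \<omega> = x \<and> \<xi> (t + h) \<omega> = x'}" for x x'
    have S_meas: "S x \<in> sets (P s)" "S' x x' \<in> sets (P s)" for x x'
      unfolding S_def S'_def sp[symmetric] by measurable
    \<comment> \<open>The true quantity, the one with frozen price but true new state, and the one
      with frozen price and first-order transition probabilities.\<close>
    let ?a = "\<lambda>\<omega>. indicator A \<omega> * v (\<xi> (t + h) \<omega>) (Y (t + h) \<omega>)"
    let ?b = "\<lambda>\<omega>. indicator A \<omega> * v (\<xi> (t + h) \<omega>) (Z (\<xi> t \<omega>) \<omega>)"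
    let ?c = "\<lambda>\<omega>. indicator A \<omega> * ((1 - l * h) * v (\<xi> t \<omega>) (Z (\<xi> t \<omega>) \<omega>) + l * h * v (- \<xi> t \<omega>) (Z (\<xi> t \<omega>) \<omega>))"
    have b_eq: "?b \<omega> = (\<Sum>x\<in>states. \<Sum>x'\<in>states. f x x' \<omega> * indicator (S' x x') \<omega>)"
      and c_eq: "?c \<omega> = (\<Sum>x\<in>states. \<Sum>x'\<in>states. k x x' * (f x x' \<omega> * indicator (S x) \<omega>))"
      if "\<omega> \<in> space (P s)" for \<omega>
    proof -
      have "\<xi> t \<omega> = -1 \<or> \<xi> t \<omega> = 1" "\<xi> (t + h) \<omega> = -1 \<or> \<xi> (t + h) \<omega> = 1" "\<omega> \<in> space (P 1)"
        using that chain_in_states[of t \<omega>] chain_in_states[of "t + h" \<omega>] t h by (auto simp: sp)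
      then show "?b \<omega> = (\<Sum>x\<in>states. \<Sum>x'\<in>states. f x x' \<omega> * indicator (S' x x') \<omega>)"
        "?c \<omega> = (\<Sum>x\<in>states. \<Sum>x'\<in>states. k x x' * (f x x' \<omega> * indicator (S x) \<omega>))"
        unfolding sum_states by (auto simp: f_def S_def S'_def k_def indicator_def distrib_left)
    qed
    have b_int: "integrable (P s) ?b"
      by (rule Bochner_Integration.integrable_cong[OF refl b_eq, THEN iffD2])
        (assumption, intro Bochner_Integration.integrable_sum f_int S_meas)
    have "\<bar>(\<integral>\<omega>. ?a \<omega> \<partial>P s) - (\<integral>\<omega>. ?b \<omega> \<partial>P s)\<bar> \<le> K * h * h"
    proof -
      have ab: "\<bar>?a \<omega> - ?b \<omega>\<bar> \<le> L * (m * \<sigma>) * deviation t h \<omega>" if "\<omega> \<in> space (P s)" for \<omega>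
      proof -
        have \<omega>: "\<omega> \<in> space (P 1)"
          using that by (simp add: sp)
        have "\<bar>?a \<omega> - ?b \<omega>\<bar> \<le> \<bar>v (\<xi> (t + h) \<omega>) (Y (t + h) \<omega>) - v (\<xi> (t + h) \<omega>) (Z (\<xi> t \<omega>) \<omega>)\<bar>"
          by (simp add: indicator_def)
        also have "\<dots> \<le> L * \<bar>Y (t + h) \<omega> - Z (\<xi> t \<omega>) \<omega>\<bar>"
          using t h \<omega> by (intro lip chain_in_states) auto
        also have "\<dots> \<le> L * (m * \<sigma> * deviation t h \<omega>)"
          unfolding m_def Z_def using price_step_le[OF t(1) h(1) t(2) \<omega>] L by (intro mult_left_mono) auto
        finally show ?thesis
          by (simp add: mult.assoc)
      qed
      have dev: "integrable (P s) (deviation t h)" "(\<integral>\<omega>. deviation t h \<omega> \<partial>P s) \<le> 4 * ((l + 1) * h) * h"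
      proof -
        have "trans_prob r x (- x) \<le> (l + 1) * h" if "0 \<le> r" "r \<le> h" "x \<in> states" for r x
        proof -
          have "\<bar>trans_prob r x (- x) - l * r\<bar> \<le> 1 * r"
            using h2(2)[of r x "- x"] that h by (auto simp: h0_def)
          then have "trans_prob r x (- x) \<le> (l + 1) * r"
            by (simp add: distrib_right abs_le_iff)
          also have "\<dots> \<le> (l + 1) * h"
            using that l_nonneg by (intro mult_left_mono) auto
          finally show ?thesis .
        qed
        moreover have "0 \<le> (l + 1) * h"
          using h l_nonneg by simp
        ultimately show "integrable (P s) (deviation t h)" "(\<integral>\<omega>. deviation t h \<omega> \<partial>P s) \<le> 4 * ((l + 1) * h) * h"
          using expected_deviation[OF s t(1) h(1), of "(l + 1) * h"] by auto
      qed
      have a_int: "integrable (P s) ?a"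
      proof -
        have [measurable]: "?a \<in> borel_measurable (P s)"
        proof -
          have [measurable]: "Y (t + h) \<in> borel_measurable (P s)" "A \<in> sets (P s)"
            "v 1 \<in> borel_measurable borel" "v (-1) \<in> borel_measurable borel"
            using past_measurable_P[OF s price_measurable[of "t + h"]] t h A subalgebra_past[OF s, of t] v_meas
            by (auto simp: subalgebra_def)
          have "?a \<in> borel_measurable (P s) \<longleftrightarrow> (\<lambda>\<omega>. indicator A \<omega> * (if \<xi> (t + h) \<omega> = 1 then v 1 (Y (t + h) \<omega>) else v (-1) (Y (t + h) \<omega>)))
              \<in> borel_measurable (P s)"
          proof (rule measurable_cong)
            fix \<omega> assume "\<omega> \<in> space (P s)"
            then show "?a \<omega> = indicator A \<omega> * (if \<xi> (t + h) \<omega> = 1 then v 1 (Y (t + h) \<omega>) else v (-1) (Y (t + h) \<omega>))"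
              using chain_in_states[of "t + h" \<omega>] t h by (auto simp: sp)
          qed
          then show ?thesis
            by simp
        qed
        have "integrable (P s) (\<lambda>\<omega>. ?a \<omega> - ?b \<omega>)"
        proof (rule Bochner_Integration.integrable_bound)
          show "integrable (P s) (\<lambda>\<omega>. L * (m * \<sigma>) * deviation t h \<omega>)"
            using dev(1) by simp
          show "(\<lambda>\<omega>. ?a \<omega> - ?b \<omega>) \<in> borel_measurable (P s)"
            using b_int by measurable
          show "AE \<omega> in P s. norm (?a \<omega> - ?b \<omega>) \<le> norm (L * (m * \<sigma>) * deviation t h \<omega>)"
            unfolding real_norm_def by (intro AE_I2 order_trans[OF ab abs_ge_self])
        qed
        from Bochner_Integration.integrable_add[OF this b_int] show ?thesis
          by simp
      qed
      have "\<bar>(\<integral>\<omega>. ?a \<omega> \<partial>P s) - (\<integral>\<omega>. ?b \<omega> \<partial>P s)\<bar> = \<bar>\<integral>\<omega>. ?a \<omega> - ?b \<omega> \<partial>P s\<bar>"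
        by (simp only: Bochner_Integration.integral_diff[OF a_int b_int])
      also have "\<dots> \<le> (\<integral>\<omega>. \<bar>?a \<omega> - ?b \<omega>\<bar> \<partial>P s)"
        by (rule integral_abs_bound)
      also have "\<dots> \<le> (\<integral>\<omega>. L * (m * \<sigma>) * deviation t h \<omega> \<partial>P s)"
        using a_int b_int dev(1) ab by (intro integral_mono) auto
      also have "\<dots> = L * (m * \<sigma>) * (\<integral>\<omega>. deviation t h \<omega> \<partial>P s)"
        by simp
      also have "\<dots> \<le> L * (m * \<sigma>) * (4 * ((l + 1) * h) * h)"
        using dev(2) L m \<sigma> by (intro mult_left_mono) auto
      finally show ?thesis
        by (simp add: K_def mult_ac)
    qed
    also have "K * h * h \<le> e / 2 * h"
    proof (rule mult_right_mono)
      have "K * h \<le> (\<bar>K\<bar> + 1) * h"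
        using h by (intro mult_right_mono) auto
      also have "\<dots> \<le> (\<bar>K\<bar> + 1) * (e / (2 * (\<bar>K\<bar> + 1)))"
        using h by (intro mult_left_mono) (auto simp: h0_def)
      also have "\<dots> = e / 2"
        by (simp add: divide_simps)
      finally show "K * h \<le> e / 2" .
    qed (rule h)
    finally have ab: "\<bar>(\<integral>\<omega>. ?a \<omega> \<partial>P s) - (\<integral>\<omega>. ?b \<omega> \<partial>P s)\<bar> \<le> e / 2 * h" .
    define I where "I x x' = (\<integral>\<omega>. f x x' \<omega> * indicator (S x) \<omega> \<partial>P s)" for x x'
    have b_integral: "(\<integral>\<omega>. ?b \<omega> \<partial>P s) = (\<Sum>x\<in>states. \<Sum>x'\<in>states. trans_prob h x x' * I x x')"
    proof -
      have "(\<integral>\<omega>. ?b \<omega> \<partial>P s) = (\<integral>\<omega>. (\<Sum>x\<in>states. \<Sum>x'\<in>states. f x x' \<omega> * indicator (S' x x') \<omega>) \<partial>P s)"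
        by (rule Bochner_Integration.integral_cong[OF refl b_eq])
      also have "\<dots> = (\<Sum>x\<in>states. \<Sum>x'\<in>states. (\<integral>\<omega>. f x x' \<omega> * indicator (S' x x') \<omega> \<partial>P s))"
        unfolding sum_states by (simp add: f_int S_meas)
      also have "\<dots> = (\<Sum>x\<in>states. \<Sum>x'\<in>states. trans_prob h x x' * I x x')"
        unfolding I_def S_def S'_def
        by (intro sum.cong refl markov_bounded[OF s t(1) h(1) _ _ f_meas f_bound])
      finally show ?thesis .
    qed
    have c_integral: "(\<integral>\<omega>. ?c \<omega> \<partial>P s) = (\<Sum>x\<in>states. \<Sum>x'\<in>states. k x x' * I x x')"
    proof -
      have "(\<integral>\<omega>. ?c \<omega> \<partial>P s) = (\<integral>\<omega>. (\<Sum>x\<in>states. \<Sum>x'\<in>states. k x x' * (f x x' \<omega> * indicator (S x) \<omega>)) \<partial>P s)"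
        by (rule Bochner_Integration.integral_cong[OF refl c_eq])
      also have "\<dots> = (\<Sum>x\<in>states. \<Sum>x'\<in>states. k x x' * I x x')"
        unfolding I_def sum_states by (simp add: f_int S_meas)
      finally show ?thesis .
    qed
    have I_bound: "\<bar>I x x'\<bar> \<le> C" if "x \<in> states" "x' \<in> states" for x x'
    proof -
      have "\<bar>I x x'\<bar> \<le> (\<integral>\<omega>. \<bar>f x x' \<omega> * indicator (S x) \<omega>\<bar> \<partial>P s)"
        unfolding I_def by (rule integral_abs_bound)
      also have "\<dots> \<le> (\<integral>\<omega>. C \<partial>P s)"
        using f_bound[OF that] C f_int[OF that S_meas(1)]
        by (intro integral_mono integrable_abs) (auto simp: sp indicator_def)
      finally show ?thesis
        by (simp add: prob_space)
    qed
    have "\<bar>(\<integral>\<omega>. ?b \<omega> \<partial>P s) - (\<integral>\<omega>. ?c \<omega> \<partial>P s)\<bar> = \<bar>\<Sum>x\<in>states. \<Sum>x'\<in>states. (trans_prob h x x' - k x x') * I x x'\<bar>"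
      unfolding b_integral c_integral by (simp add: algebra_simps)
    also have "\<dots> \<le> (\<Sum>x\<in>states. \<Sum>x'\<in>states. \<bar>(trans_prob h x x' - k x x') * I x x'\<bar>)"
      by (intro order_trans[OF sum_abs] sum_mono order_refl)
    also have "\<dots> \<le> (\<Sum>x\<in>states. \<Sum>x'\<in>states. e' * h * C)"
    proof (intro sum_mono)
      fix x x' :: real
      assume xx: "x \<in> states" "x' \<in> states"
      have "\<bar>trans_prob h x x' - k x x'\<bar> \<le> e' * h"
        unfolding k_def using h by (intro h1(2) xx) (auto simp: h0_def)
      then show "\<bar>(trans_prob h x x' - k x x') * I x x'\<bar> \<le> e' * h * C"
        unfolding abs_mult using e' h by (intro mult_mono I_bound xx) auto
    qed
    also have "\<dots> = (4 * C * e') * h"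
      by simp
    also have "\<dots> \<le> e / 2 * h"
      using e' h by (intro mult_right_mono) auto
    finally have "\<bar>(\<integral>\<omega>. ?b \<omega> \<partial>P s) - (\<integral>\<omega>. ?c \<omega> \<partial>P s)\<bar> \<le> e / 2 * h" .
    moreover have "e / 2 * h + e / 2 * h = e * h"
      by simp
    ultimately have "\<bar>(\<integral>\<omega>. ?a \<omega> \<partial>P s) - (\<integral>\<omega>. ?c \<omega> \<partial>P s)\<bar> \<le> e * h"
      using ab by linarith
    then show "\<bar>(\<integral>\<omega>. indicator A \<omega> * v (\<xi> (t + h) \<omega>) (Y (t + h) \<omega>) \<partial>P s)
        - (\<integral>\<omega>. indicator A \<omega> * ((1 - l * h) * v (\<xi> t \<omega>) (Y t \<omega> * exp ((\<mu> + \<sigma> * \<xi> t \<omega>) * h))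
            + l * h * v (- \<xi> t \<omega>) (Y t \<omega> * exp ((\<mu> + \<sigma> * \<xi> t \<omega>) * h))) \<partial>P s)\<bar> \<le> e * h"
      unfolding Z_def .
  qed
qed

end

end

section \<open>Verification\<close>

locale stopping_problem = stopping_data l \<mu> \<sigma> a \<rho> \<kappa> + two_state_chain l P \<xi>
  for l \<mu> \<sigma> a \<rho> \<kappa> :: real and P :: "real \<Rightarrow> 'a measure" and \<xi> :: "real \<Rightarrow> 'a \<Rightarrow> real"
begin

abbreviation prc :: "real \<Rightarrow> real \<Rightarrow> 'a \<Rightarrow> real" where
  "prc \<equiv> price \<mu> \<sigma> \<xi>"

abbreviation completed :: "ennreal \<Rightarrow> 'a measure" where
  "completed \<equiv> completed_filtration P \<xi>"

section \<open>One step of the discounted process compared with the flow step\<close>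

lemma abs_b_le: "s \<in> states \<Longrightarrow> \<bar>b s\<bar> \<le> \<mu> + \<sigma>"
  using pos by (auto simp: b_def)

text \<open>The first-order expression produced by \<open>one_step\<close>, still without its
  discount factor.\<close>

definition euler_step :: "(real \<Rightarrow> real \<Rightarrow> real) \<Rightarrow> real \<Rightarrow> real \<Rightarrow> real \<Rightarrow> real" where
  "euler_step v s z h = (1 - l * h) * v s (z * exp (b s * h)) + l * h * v (- s) (z * exp (b s * h))"

text \<open>Both sides have the same first-order expansion in \<open>h\<close>. The jump integral
  differs from the rectangle \<open>l * h * exp (- \<rho> * h) * V\<close> by second order because
  its integrand moves by order \<open>h\<close>, and \<open>exp (- (l * h))\<close> differs from
  \<open>1 - l * h\<close> by at most \<open>(l * h)\<^sup>2\<close>. The constant is uniform for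
  prices up to \<open>m\<close>.\<close>

lemma euler_step_approx:
  assumes v: "admissible v"
  obtains D where "0 \<le> D" "\<And>s z h. s \<in> states \<Longrightarrow> 0 \<le> z \<Longrightarrow> z \<le> m \<Longrightarrow> 0 \<le> h \<Longrightarrow> h \<le> 1 \<Longrightarrow>
      \<bar>flow_step v s z h - exp (- \<rho> * h) * euler_step v s z h\<bar> \<le> D * h\<^sup>2"
proof -
  define E where "E = exp (\<mu> + \<sigma>)"
  define K where "K = \<kappa> * (\<bar>m\<bar> * E)"
  define D where "D = K * l\<^sup>2 + l * (K * (q + \<rho>) + K * (\<mu> + \<sigma>))"
  have K: "0 \<le> K"
    using \<kappa>_ge by (simp add: K_def E_def)
  have D: "0 \<le> D"
    unfolding D_def using K pos q_pos by (intro add_nonneg_nonneg mult_nonneg_nonneg) auto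
  have "\<bar>flow_step v s z h - exp (- \<rho> * h) * euler_step v s z h\<bar> \<le> D * h\<^sup>2"
    if s: "s \<in> states" and z: "0 \<le> z" "z \<le> m" and h: "0 \<le> h" "h \<le> 1" for s z h
  proof -
    have bE: "exp (b s * r) \<le> E" if "0 \<le> r" "r \<le> h" for r
    proof -
      have "b s * r \<le> \<bar>b s\<bar> * r"
        using that by (intro mult_right_mono) auto
      also have "\<dots> \<le> (\<mu> + \<sigma>) * 1"
        using that h abs_b_le[OF s] by (intro mult_mono) auto
      finally show ?thesis
        by (simp add: E_def)
    qed
    have v_le: "v s' (z * exp (b s * r)) \<le> K" if "s' \<in> states" "0 \<le> r" "r \<le> h" for s' r
    proof -
      have "v s' (z * exp (b s * r)) \<le> c s' * (z * exp (b s * r))"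
        using admissible_le[OF v that(1), of "z * exp (b s * r)"] z by simp
      also have "\<dots> \<le> K"
        unfolding K_def using z c_le_\<kappa>[of s'] \<kappa>_ge bE[OF that(2,3)]
        by (intro mult_mono) auto
      finally show ?thesis .
    qed
    have v_diff: "\<bar>v s' (z * exp (b s * r)) - v s' (z * exp (b s * h))\<bar> \<le> K * ((\<mu> + \<sigma>) * h)"
      if "s' \<in> states" "0 \<le> r" "r \<le> h" for s' r
    proof -
      have "\<bar>v s' (z * exp (b s * r)) - v s' (z * exp (b s * h))\<bar> \<le> c s' * \<bar>z * exp (b s * r) - z * exp (b s * h)\<bar>"
        by (rule admissible_lipschitz[OF v that(1)])
      also have "\<dots> = c s' * (z * \<bar>exp (b s * r) - exp (b s * h)\<bar>)"
        using z by (simp add: right_diff_distrib[symmetric] abs_mult)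
      also have "\<dots> \<le> \<kappa> * (\<bar>m\<bar> * (E * ((\<mu> + \<sigma>) * h)))"
      proof -
        have "\<bar>exp (b s * r) - exp (b s * h)\<bar> \<le> exp (\<mu> + \<sigma>) * \<bar>b s * r - b s * h\<bar>"
          using bE[OF that(2,3)] bE[of h] h unfolding E_def by (intro exp_diff_le) auto
        also have "\<bar>b s * r - b s * h\<bar> = \<bar>b s\<bar> * (h - r)"
          using that by (simp add: right_diff_distrib[symmetric] abs_mult)
        also have "\<dots> \<le> (\<mu> + \<sigma>) * h"
          using that abs_b_le[OF s] pos by (intro mult_mono) auto
        finally have "\<bar>exp (b s * r) - exp (b s * h)\<bar> \<le> E * ((\<mu> + \<sigma>) * h)"
          by (simp add: E_def)
        then show ?thesis
          using z c_le_\<kappa>[of s'] \<kappa>_ge by (intro mult_mono) auto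
      qed
      finally show ?thesis
        by (simp add: K_def mult.assoc)
    qed
    define V where "V = v (- s) (z * exp (b s * h))"
    have ns: "- s \<in> states"
      by (rule neg_state[OF s])
    have "\<bar>jump_gain v s z h - l * h * exp (- \<rho> * h) * V\<bar> \<le> l * (K * (q + \<rho>) + K * (\<mu> + \<sigma>)) * h * h"
    proof -
      let ?f = "\<lambda>r. l * exp (- q * r) * v (- s) (z * exp (b s * r))"
      have int: "?f integrable_on {0..h}" "(\<lambda>r. l * exp (- \<rho> * h) * V) integrable_on {0..h}"
        by (rule jump_gain_integrable[OF v s] integrable_const_ivl)+
      have diff: "jump_gain v s z h - l * h * exp (- \<rho> * h) * V = integral {0..h} (\<lambda>r. ?f r - l * exp (- \<rho> * h) * V)"
        unfolding integral_diff[OF int] jump_gain_def using h by simp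
      have "norm (integral {0..h} (\<lambda>r. ?f r - l * exp (- \<rho> * h) * V))
          \<le> integral {0..h} (\<lambda>r. l * (K * (q + \<rho>) + K * (\<mu> + \<sigma>)) * h)"
      proof (rule integral_norm_bound_integral)
        show "(\<lambda>r. ?f r - l * exp (- \<rho> * h) * V) integrable_on {0..h}"
          by (rule integrable_diff[OF int])
        fix r assume r: "r \<in> {0..h}"
        have "\<bar>exp (- q * r) - exp (- \<rho> * h)\<bar> \<le> exp 0 * \<bar>- q * r - - \<rho> * h\<bar>"
          using r h q_pos pos by (intro exp_diff_le) auto
        also have "\<dots> \<le> q * r + \<rho> * h"
          using r h q_pos pos by (auto simp: abs_le_iff)
        also have "\<dots> \<le> (q + \<rho>) * h"
          using r q_pos by (simp add: distrib_right)
        finally have e: "\<bar>exp (- q * r) - exp (- \<rho> * h)\<bar> \<le> (q + \<rho>) * h" .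
        have "\<bar>exp (- q * r) * v (- s) (z * exp (b s * r)) - exp (- \<rho> * h) * V\<bar>
            = \<bar>(exp (- q * r) - exp (- \<rho> * h)) * v (- s) (z * exp (b s * r))
              + exp (- \<rho> * h) * (v (- s) (z * exp (b s * r)) - V)\<bar>"
          by (simp add: algebra_simps)
        also have "\<dots> \<le> \<bar>exp (- q * r) - exp (- \<rho> * h)\<bar> * v (- s) (z * exp (b s * r))
              + exp (- \<rho> * h) * \<bar>v (- s) (z * exp (b s * r)) - V\<bar>"
          using abs_triangle_ineq admissible_nonneg[OF v ns] by (metis abs_exp_cancel abs_mult abs_of_nonneg)
        also have "\<dots> \<le> (q + \<rho>) * h * K + 1 * (K * ((\<mu> + \<sigma>) * h))"
          unfolding V_def using e r h pos q_pos v_le[OF ns, of r] v_diff[OF ns, of r] admissible_nonneg[OF v ns]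
          by (intro add_mono mult_mono) auto
        finally have "l * \<bar>exp (- q * r) * v (- s) (z * exp (b s * r)) - exp (- \<rho> * h) * V\<bar>
            \<le> l * ((q + \<rho>) * h * K + 1 * (K * ((\<mu> + \<sigma>) * h)))"
          using pos by (intro mult_left_mono) auto
        also have "\<dots> = l * (K * (q + \<rho>) + K * (\<mu> + \<sigma>)) * h"
          by (simp add: algebra_simps)
        also have "l * \<bar>exp (- q * r) * v (- s) (z * exp (b s * r)) - exp (- \<rho> * h) * V\<bar>
            = norm (?f r - l * exp (- \<rho> * h) * V)"
          using pos by (simp add: abs_mult mult.assoc right_diff_distrib[symmetric])
        finally show "norm (?f r - l * exp (- \<rho> * h) * V) \<le> l * (K * (q + \<rho>) + K * (\<mu> + \<sigma>)) * h" .
      qed auto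
      also have "\<dots> = l * (K * (q + \<rho>) + K * (\<mu> + \<sigma>)) * h * h"
        using h by simp
      finally show ?thesis
        unfolding diff real_norm_def .
    qed
    moreover have "\<bar>(exp (- q * h) - exp (- \<rho> * h) * (1 - l * h)) * v s (z * exp (b s * h))\<bar> \<le> K * l\<^sup>2 * h\<^sup>2"
    proof -
      have "exp (- q * h) - exp (- \<rho> * h) * (1 - l * h) = exp (- \<rho> * h) * (exp (- (l * h)) - (1 - l * h))"
        by (simp add: q_def exp_add[symmetric] algebra_simps)
      also have "\<bar>\<dots>\<bar> \<le> 1 * (l * h)\<^sup>2"
        unfolding abs_mult using exp_minus_bounds(1,3)[of "l * h"] pos h by (intro mult_mono) auto
      finally have "\<bar>exp (- q * h) - exp (- \<rho> * h) * (1 - l * h)\<bar> \<le> (l * h)\<^sup>2"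
        by simp
      then have "\<bar>exp (- q * h) - exp (- \<rho> * h) * (1 - l * h)\<bar> * v s (z * exp (b s * h)) \<le> (l * h)\<^sup>2 * K"
        using v_le[OF s, of h] h admissible_nonneg[OF v s] by (intro mult_mono) auto
      then show ?thesis
        using admissible_nonneg[OF v s] by (simp add: abs_mult power_mult_distrib mult_ac)
    qed
    moreover have "flow_step v s z h - exp (- \<rho> * h) * euler_step v s z h
        = (jump_gain v s z h - l * h * exp (- \<rho> * h) * V)
          + (exp (- q * h) - exp (- \<rho> * h) * (1 - l * h)) * v s (z * exp (b s * h))"
      unfolding flow_step_def euler_step_def V_def by (simp add: algebra_simps)
    moreover have "D * h\<^sup>2 = l * (K * (q + \<rho>) + K * (\<mu> + \<sigma>)) * h * h + K * l\<^sup>2 * h\<^sup>2"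
      by (simp add: D_def power2_eq_square algebra_simps)
    ultimately show ?thesis
      by linarith
  qed
  with D show ?thesis
    by (rule that)
qed

text \<open>Measurability of \<open>v\<close> is known in the price for each of the two states
  separately, so the expression is split by the current state. The sign \<open>m\<close> covers both
  the current and the opposite state.\<close>

lemma state_fun_measurable:
  assumes v: "admissible v" and t: "0 \<le> u" "u \<le> t" and f: "f \<in> borel_measurable (past t)"
    and m: "m = 1 \<or> m = - 1"
  shows "(\<lambda>x. v (m * \<xi> u x) (f x)) \<in> borel_measurable (past t)"
proof -
  have [measurable]: "v s \<in> borel_measurable borel" if "s \<in> states" for s
    by (rule borel_measurable_continuous_onI[OF admissible_continuous[OF v that]])
  have [measurable]: "\<xi> u \<in> borel_measurable (past t)" "f \<in> borel_measurable (past t)"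
    by (rule past_measurable[OF t] f)+
  have "(\<lambda>x. if \<xi> u x = 1 then v m (f x) else v (- m) (f x)) \<in> borel_measurable (past t)"
    using m by (elim disjE) simp_all
  then show ?thesis
  proof (rule measurable_cong[THEN iffD1, rotated])
    fix x assume "x \<in> space (past t)"
    then show "(if \<xi> u x = 1 then v m (f x) else v (- m) (f x)) = v (m * \<xi> u x) (f x)"
      using chain_in_states[OF t(1), of x] by (auto simp: space_past)
  qed
qed

definition disc :: "(real \<Rightarrow> real \<Rightarrow> real) \<Rightarrow> real \<Rightarrow> real \<Rightarrow> 'a \<Rightarrow> real" where
  "disc v y t x = exp (- \<rho> * t) * v (\<xi> t x) (prc y t x)"

lemma disc_measurable:
  "admissible v \<Longrightarrow> 0 \<le> t \<Longrightarrow> disc v y t \<in> borel_measurable (past t)"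
  unfolding disc_def
  using state_fun_measurable[of v t t "prc y t" 1] by (simp add: price_measurable)

lemma disc_nonneg: "admissible v \<Longrightarrow> 0 \<le> t \<Longrightarrow> x \<in> space (P 1) \<Longrightarrow> 0 \<le> disc v y t x"
  unfolding disc_def by (intro mult_nonneg_nonneg admissible_nonneg[of v] chain_in_states) auto

lemma disc_le:
  assumes v: "admissible v" and t: "0 \<le> t" "t \<le> T" and x: "x \<in> space (P 1)" and y: "0 \<le> y"
  shows "disc v y t x \<le> \<kappa> * (y * exp ((\<mu> + \<sigma>) * T))"
proof -
  have p: "0 \<le> prc y t x" "prc y t x \<le> y * exp ((\<mu> + \<sigma>) * T)"
    using price_nonneg[of \<mu> \<sigma> y t x] price_le[of \<mu> \<sigma> y t T x] pos y t x by auto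
  have "v (\<xi> t x) (prc y t x) \<le> c (\<xi> t x) * \<bar>prc y t x\<bar>"
    by (intro admissible_le v chain_in_states t x)
  also have "\<dots> \<le> \<kappa> * (y * exp ((\<mu> + \<sigma>) * T))"
    using p c_le_\<kappa> \<kappa>_ge by (intro mult_mono) auto
  finally have "v (\<xi> t x) (prc y t x) \<le> \<kappa> * (y * exp ((\<mu> + \<sigma>) * T))" .
  moreover have "exp (- \<rho> * t) * v (\<xi> t x) (prc y t x) \<le> v (\<xi> t x) (prc y t x)"
    using pos t x by (intro mult_left_le_one_le admissible_nonneg[OF v] chain_in_states) auto
  ultimately show ?thesis
    by (simp add: disc_def)
qed

lemma disc_integrable:
  assumes "admissible v" "0 \<le> t" "0 \<le> y" "s \<in> states"
  shows "integrable (P s) (disc v y t)"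
proof -
  interpret prob_space "P s"
    by (rule prob[OF assms(4)])
  show ?thesis
    using disc_le[OF assms(1,2) order_refl _ assms(3)] disc_nonneg[OF assms(1,2)]
    by (intro integrable_const_bound[where B = "\<kappa> * (y * exp ((\<mu> + \<sigma>) * t))"]
        past_measurable_P[OF assms(4) disc_measurable[OF assms(1,2)]])
      (auto simp: space_P[OF assms(4)])
qed

text \<open>Turns a pointwise comparison of \<open>flow_step v\<close> with some
  \<open>\<phi>\<close> into a comparison of expectations on events of the past. The upper form
  gives the supermartingale property and the decay of the linear bound, the lower form the
  submartingale property while running.\<close>

lemma disc_step:
  assumes v: "admissible v" and y: "0 \<le> y" and e: "0 < e"
  obtains h0 where "0 < h0"
    "\<And>h t s A \<phi>. 0 \<le> h \<Longrightarrow> h < h0 \<Longrightarrow> 0 \<le> t \<Longrightarrow> t + h \<le> T \<Longrightarrow> s \<in> states \<Longrightarrow> A \<in> sets (past t) \<Longrightarrow>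
      integrable (P s) \<phi> \<Longrightarrow>
      (\<And>x. x \<in> A \<Longrightarrow> flow_step v (\<xi> t x) (prc y t x) h \<le> \<phi> x) \<Longrightarrow>
      (integral_on (P s) A (disc v y (t + h))) \<le> exp (- \<rho> * t) * (integral_on (P s) A \<phi>) + e * h"
    "\<And>h t s A \<phi>. 0 \<le> h \<Longrightarrow> h < h0 \<Longrightarrow> 0 \<le> t \<Longrightarrow> t + h \<le> T \<Longrightarrow> s \<in> states \<Longrightarrow> A \<in> sets (past t) \<Longrightarrow>
      integrable (P s) \<phi> \<Longrightarrow>
      (\<And>x. x \<in> A \<Longrightarrow> \<phi> x \<le> flow_step v (\<xi> t x) (prc y t x) h) \<Longrightarrow>
      exp (- \<rho> * t) * (integral_on (P s) A \<phi>) \<le> (integral_on (P s) A (disc v y (t + h))) + e * h"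
proof -
  define m where "m = y * exp ((\<mu> + \<sigma>) * T)"
  obtain D where D: "0 \<le> D" "\<And>s z h. s \<in> states \<Longrightarrow> 0 \<le> z \<Longrightarrow> z \<le> m \<Longrightarrow> 0 \<le> h \<Longrightarrow> h \<le> 1 \<Longrightarrow>
      \<bar>flow_step v s z h - exp (- \<rho> * h) * euler_step v s z h\<bar> \<le> D * h\<^sup>2"
    by (rule euler_step_approx[OF v, of m]) (rule that; assumption)
  have lip: "\<bar>v s z - v s z'\<bar> \<le> \<kappa> * \<bar>z - z'\<bar>" if "s \<in> states" for s z z'
    by (rule order_trans[OF admissible_lipschitz[OF v that] mult_right_mono[OF c_le_\<kappa>]]) simp
  have "0 \<le> l" "0 \<le> \<mu>" "0 \<le> \<sigma>" "0 \<le> \<kappa>"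
    using pos \<kappa>_ge by auto
  note one_step = one_step[OF this(1-3) y lip this(4), where e = "e / 2" and T = T]
  obtain h1 where h1: "0 < h1"
    "\<And>h t s A. 0 \<le> h \<Longrightarrow> h < h1 \<Longrightarrow> 0 \<le> t \<Longrightarrow> t + h \<le> T \<Longrightarrow> s \<in> states \<Longrightarrow> A \<in> sets (past t) \<Longrightarrow>
      \<bar>(\<integral>x. indicator A x * v (\<xi> (t + h) x) (prc y (t + h) x) \<partial>P s)
        - (\<integral>x. indicator A x * ((1 - l * h) * v (\<xi> t x) (prc y t x * exp ((\<mu> + \<sigma> * \<xi> t x) * h))
            + l * h * v (- \<xi> t x) (prc y t x * exp ((\<mu> + \<sigma> * \<xi> t x) * h))) \<partial>P s)\<bar> \<le> e / 2 * h"
    using e by - (rule one_step, assumption, simp, rule that; assumption)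
  \<comment> \<open>Half of \<open>e * h\<close> pays for \<open>one_step\<close>, half for the
    quadratic error \<open>D * h\<^sup>2\<close>; adding \<open>1\<close> to \<open>D\<close> avoids
    a vanishing denominator.\<close>
  define h0 where "h0 = min (min h1 1) (e / (2 * (D + 1)))"
  have main: "\<bar>(integral_on (P s) A (disc v y (t + h)))
      - exp (- \<rho> * t) * (\<integral>x. indicator A x * (exp (- \<rho> * h) * euler_step v (\<xi> t x) (prc y t x) h) \<partial>P s)\<bar> \<le> e / 2 * h"
    "integrable (P s) (\<lambda>x. indicator A x * (exp (- \<rho> * h) * euler_step v (\<xi> t x) (prc y t x) h))"
    "\<And>x. x \<in> space (P 1) \<Longrightarrow> \<bar>flow_step v (\<xi> t x) (prc y t x) h - exp (- \<rho> * h) * euler_step v (\<xi> t x) (prc y t x) h\<bar> \<le> e / 2 * h"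
    if h: "0 \<le> h" "h < h0" and t: "0 \<le> t" "t + h \<le> T" and s: "s \<in> states" and A: "A \<in> sets (past t)" for h t s A
  proof -
    interpret prob_space "P s"
      by (rule prob[OF s])
    have sp: "space (P s) = space (P 1)"
      by (rule space_P[OF s])
    let ?N = "\<lambda>x. euler_step v (\<xi> t x) (prc y t x) h"
    have step: "\<bar>(\<integral>x. indicator A x * v (\<xi> (t + h) x) (prc y (t + h) x) \<partial>P s)
        - (\<integral>x. indicator A x * ?N x \<partial>P s)\<bar> \<le> e / 2 * h"
      using h1(2)[OF h(1) _ t s A] h by (simp add: euler_step_def b_def h0_def)
    have eq1: "(integral_on (P s) A (disc v y (t + h)))
        = exp (- \<rho> * (t + h)) * (\<integral>x. indicator A x * v (\<xi> (t + h) x) (prc y (t + h) x) \<partial>P s)"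
      by (simp add: disc_def mult.left_commute[of "indicator A _"])
    have eq2: "exp (- \<rho> * t) * (\<integral>x. indicator A x * (exp (- \<rho> * h) * ?N x) \<partial>P s)
        = exp (- \<rho> * (t + h)) * (\<integral>x. indicator A x * ?N x \<partial>P s)"
      by (simp add: mult.left_commute[of "indicator A _"] distrib_left exp_diff exp_minus divide_inverse)
    have "\<bar>exp (- \<rho> * (t + h)) * ((\<integral>x. indicator A x * v (\<xi> (t + h) x) (prc y (t + h) x) \<partial>P s)
        - (\<integral>x. indicator A x * ?N x \<partial>P s))\<bar> \<le> 1 * (e / 2 * h)"
      unfolding abs_mult using step pos t h by (intro mult_mono) auto
    then show "\<bar>(integral_on (P s) A (disc v y (t + h)))
      - exp (- \<rho> * t) * (\<integral>x. indicator A x * (exp (- \<rho> * h) * ?N x) \<partial>P s)\<bar> \<le> e / 2 * h"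
      unfolding eq1 eq2 by (simp add: right_diff_distrib)
    have price: "0 \<le> prc y t x" "prc y t x \<le> m" if "x \<in> space (P 1)" for x
      using price_nonneg[of \<mu> \<sigma> y t x] price_le[of \<mu> \<sigma> y t T x] pos y t h that by (auto simp: m_def)
    show close: "\<bar>flow_step v (\<xi> t x) (prc y t x) h - exp (- \<rho> * h) * ?N x\<bar> \<le> e / 2 * h"
      if x: "x \<in> space (P 1)" for x
    proof -
      have "\<bar>flow_step v (\<xi> t x) (prc y t x) h - exp (- \<rho> * h) * ?N x\<bar> \<le> D * h\<^sup>2"
        using h by (intro D(2) chain_in_states t x price) (auto simp: h0_def)
      also have "\<dots> = D * h * h"
        by (simp add: power2_eq_square)
      also have "\<dots> \<le> e / 2 * h"
      proof (rule mult_right_mono)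
        have "D * h \<le> (D + 1) * (e / (2 * (D + 1)))"
          using D h by (intro mult_mono) (auto simp: h0_def)
        also have "\<dots> = e / 2"
          using D by (simp add: divide_simps)
        finally show "D * h \<le> e / 2" .
      qed (rule h)
      finally show ?thesis .
    qed
    show "integrable (P s) (\<lambda>x. indicator A x * (exp (- \<rho> * h) * ?N x))"
    proof (rule integrable_const_bound)
      define C where "C = \<kappa> * (m * exp ((\<mu> + \<sigma>) * h))"
      show "AE x in P s. norm (indicator A x * (exp (- \<rho> * h) * ?N x)) \<le> 1 * (1 * ((\<bar>1 - l * h\<bar> + l * h) * C))"
      proof (rule AE_I2)
        fix x assume "x \<in> space (P s)"
        then have x: "x \<in> space (P 1)"
          by (simp add: sp)
        have \<xi>: "\<xi> t x \<in> states"
          by (rule chain_in_states[OF t(1) x])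
        have C: "\<bar>v s' (prc y t x * exp (b (\<xi> t x) * h))\<bar> \<le> C" if s': "s' \<in> states" for s'
        proof -
          have "\<bar>v s' (prc y t x * exp (b (\<xi> t x) * h))\<bar> \<le> c s' * \<bar>prc y t x * exp (b (\<xi> t x) * h)\<bar>"
            using admissible_le[OF v s'] admissible_nonneg[OF v s'] by simp
          also have "\<dots> = c s' * (prc y t x * exp (b (\<xi> t x) * h))"
            using price[OF x] by simp
          also have "\<dots> \<le> C"
            unfolding C_def using price[OF x] c_le_\<kappa> \<kappa>_ge h abs_b_le[OF \<xi>]
            by (intro mult_mono exp_le_cancel_iff[THEN iffD2] mult_right_mono) auto
          finally show ?thesis .
        qed
        have C0: "0 \<le> C"
          using C[OF s] by linarith
        have "\<bar>?N x\<bar> \<le> \<bar>1 - l * h\<bar> * C + l * h * C"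
          unfolding euler_step_def using C[OF \<xi>] C[OF neg_state[OF \<xi>]] h pos
          by (intro order_trans[OF abs_triangle_ineq] add_mono) (auto simp: abs_mult intro!: mult_left_mono)
        then have "\<bar>?N x\<bar> \<le> (\<bar>1 - l * h\<bar> + l * h) * C"
          by (simp add: distrib_right)
        then show "norm (indicator A x * (exp (- \<rho> * h) * ?N x)) \<le> 1 * (1 * ((\<bar>1 - l * h\<bar> + l * h) * C))"
          unfolding real_norm_def abs_mult using h pos
          by (intro mult_mono) (auto simp: indicator_def)
      qed
      have b_meas: "(\<lambda>x. prc y t x * exp (b (\<xi> t x) * h)) \<in> borel_measurable (past t)"
      proof -
        have [measurable]: "prc y t \<in> borel_measurable (past t)" "\<xi> t \<in> borel_measurable (past t)"
          using t by (auto intro: price_measurable past_measurable)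
        show ?thesis
          unfolding b_def by measurable
      qed
      have v_meas: "(\<lambda>x. v (\<xi> t x) (prc y t x * exp (b (\<xi> t x) * h))) \<in> borel_measurable (past t)"
        "(\<lambda>x. v (- \<xi> t x) (prc y t x * exp (b (\<xi> t x) * h))) \<in> borel_measurable (past t)"
        using state_fun_measurable[OF v t(1) order_refl b_meas, of 1] state_fun_measurable[OF v t(1) order_refl b_meas, of "- 1"]
        by simp_all
      show "(\<lambda>x. indicator A x * (exp (- \<rho> * h) * ?N x)) \<in> borel_measurable (P s)"
        unfolding euler_step_def
        by (intro past_measurable_P[OF s, of _ t] borel_measurable_times borel_measurable_add
            borel_measurable_const borel_measurable_indicator v_meas A)
    qed
  qed
  have ind_int: "integrable (P s) (\<lambda>x. indicator A x * f x)" "A \<in> sets (P s)" "A \<subseteq> space (P 1)"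
    if "s \<in> states" "A \<in> sets (past t)" "integrable (P s) f" for s A t and f :: "'a \<Rightarrow> real"
  proof -
    show A: "A \<in> sets (P s)"
      using subalgebra_past[OF that(1), of t] that(2) by (auto simp: subalgebra_def)
    show "integrable (P s) (\<lambda>x. indicator A x * f x)"
      using integrable_mult_indicator[OF A that(3)] by simp
    show "A \<subseteq> space (P 1)"
      using sets.sets_into_space[OF A] space_P[OF that(1)] by simp
  qed
  have shift: "(\<integral>x. indicator A x * (\<phi> x + k) \<partial>P s) \<le> (integral_on (P s) A \<phi>) + k"
    "(\<integral>x. indicator A x * (\<phi> x - k) \<partial>P s) \<ge> (integral_on (P s) A \<phi>) - k"
    "integrable (P s) (\<lambda>x. indicator A x * (\<phi> x + k))" "integrable (P s) (\<lambda>x. indicator A x * (\<phi> x - k))"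
    if "s \<in> states" "A \<in> sets (past t)" "integrable (P s) \<phi>" "0 \<le> k"
    for s A t and \<phi> :: "'a \<Rightarrow> real" and k :: real
  proof -
    interpret prob_space "P s"
      by (rule prob[OF that(1)])
    have int: "integrable (P s) (\<lambda>x. indicator A x * \<phi> x)" "integrable (P s) (\<lambda>x. k * indicator A x)"
      using ind_int(1,2)[OF that(1-3)] integrable_real_indicator[of A] by (auto simp: less_top[symmetric])
    have k: "(\<integral>x. k * indicator A x \<partial>P s) \<le> k"
      using ind_int(2)[OF that(1-3)] that(4) mult_left_mono[OF prob_le_1[of A] that(4)] by simp
    have eq: "(\<lambda>x. indicator A x * (\<phi> x + k)) = (\<lambda>x. indicator A x * \<phi> x + k * indicator A x)"
      "(\<lambda>x. indicator A x * (\<phi> x - k)) = (\<lambda>x. indicator A x * \<phi> x - k * indicator A x)"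
      by (auto simp: algebra_simps)
    show "integrable (P s) (\<lambda>x. indicator A x * (\<phi> x + k))" "integrable (P s) (\<lambda>x. indicator A x * (\<phi> x - k))"
      unfolding eq using int by auto
    show "(\<integral>x. indicator A x * (\<phi> x + k) \<partial>P s) \<le> (integral_on (P s) A \<phi>) + k"
      "(\<integral>x. indicator A x * (\<phi> x - k) \<partial>P s) \<ge> (integral_on (P s) A \<phi>) - k"
      unfolding eq Bochner_Integration.integral_add[OF int] Bochner_Integration.integral_diff[OF int] using k by auto
  qed
  show ?thesis
  proof (rule that)
    show "0 < h0"
      using h1 e D by (auto simp: h0_def)
    fix h t s A and \<phi> :: "'a \<Rightarrow> real"
    assume h: "0 \<le> h" "h < h0" and t: "0 \<le> t" "t + h \<le> T" and s: "s \<in> states" and A: "A \<in> sets (past t)"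
      and \<phi>: "integrable (P s) \<phi>"
    note main = main[OF h t s A]
    have eh: "0 \<le> e / 2 * h" 
      using e h by simp
    have disc1: "0 \<le> exp (- \<rho> * t)" "exp (- \<rho> * t) * (e / 2 * h) \<le> 1 * (e / 2 * h)"
      by (rule exp_ge_zero, rule mult_right_mono[OF _ eh]) (use pos t in simp)
    have eh2: "e / 2 * h + e / 2 * h = e * h"
      by simp
    note shift = shift[OF s A \<phi> eh]
    have x: "x \<in> space (P 1)" if "x \<in> A" for x
      using ind_int(3)[OF s A \<phi>] that by blast
    let ?N = "\<lambda>x. exp (- \<rho> * h) * euler_step v (\<xi> t x) (prc y t x) h"
    {
      assume le: "\<And>x. x \<in> A \<Longrightarrow> flow_step v (\<xi> t x) (prc y t x) h \<le> \<phi> x"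
      have "(\<integral>x. indicator A x * ?N x \<partial>P s) \<le> (\<integral>x. indicator A x * (\<phi> x + e / 2 * h) \<partial>P s)"
      proof (rule integral_mono[OF main(2) shift(3)])
        fix x
        show "indicator A x * ?N x \<le> indicator A x * (\<phi> x + e / 2 * h)"
        proof (cases "x \<in> A")
          case True
          have "?N x \<le> \<phi> x + e / 2 * h"
            using le[OF True] main(3)[OF x[OF True]] by linarith
          then show ?thesis
            by (simp add: True)
        qed simp
      qed
      then have "(\<integral>x. indicator A x * ?N x \<partial>P s) \<le> (integral_on (P s) A \<phi>) + e / 2 * h"
        using shift(1) by linarith
      from mult_left_mono[OF this disc1(1)] eh2
      show "(integral_on (P s) A (disc v y (t + h))) \<le> exp (- \<rho> * t) * (integral_on (P s) A \<phi>) + e * h"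
        using main(1) disc1(2) unfolding distrib_left by linarith
    }
    {
      assume le: "\<And>x. x \<in> A \<Longrightarrow> \<phi> x \<le> flow_step v (\<xi> t x) (prc y t x) h"
      have "(\<integral>x. indicator A x * (\<phi> x - e / 2 * h) \<partial>P s) \<le> (\<integral>x. indicator A x * ?N x \<partial>P s)"
      proof (rule integral_mono[OF shift(4) main(2)])
        fix x
        show "indicator A x * (\<phi> x - e / 2 * h) \<le> indicator A x * ?N x"
        proof (cases "x \<in> A")
          case True
          have "\<phi> x - e / 2 * h \<le> ?N x"
            using le[OF True] main(3)[OF x[OF True]] by linarith
          then show ?thesis
            by (simp add: True)
        qed simp
      qed
      then have "(integral_on (P s) A \<phi>) \<le> (\<integral>x. indicator A x * ?N x \<partial>P s) + e / 2 * h"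
        using shift(2) by linarith
      from mult_left_mono[OF this disc1(1)] eh2
      show "exp (- \<rho> * t) * (integral_on (P s) A \<phi>) \<le> (integral_on (P s) A (disc v y (t + h))) + e * h"
        using main(1) disc1(2) unfolding distrib_left by linarith
    }
  qed
qed

section \<open>Events of the completed filtration\<close>

lemma space_completed: "space (completed t) = space (P 1)"
  by (simp add: completed_filtration_def space_measure_of_conv)

lemma sets_completed: "sets (completed t) = sigma_sets (space (P 1))
    (natural_events (space (P 1)) \<xi> t \<union> {N. \<forall>s\<in>states. \<exists>N'\<in>null_sets (P s). N \<subseteq> N'})"
  unfolding completed_filtration_def
proof (rule sets_measure_of)
  have "{N. \<forall>s\<in>states. \<exists>N'\<in>null_sets (P s). N \<subseteq> N'} \<subseteq> Pow (space (P 1))"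
  proof (intro subsetI PowI)
    fix N x assume "N \<in> {N. \<forall>s\<in>states. \<exists>N'\<in>null_sets (P s). N \<subseteq> N'}" and x: "x \<in> N"
    then obtain N' where "N' \<in> null_sets (P 1)" "N \<subseteq> N'"
      by auto
    then show "x \<in> space (P 1)"
      using x sets.sets_into_space[OF null_setsD2] by blast
  qed
  moreover have "natural_events (space (P 1)) \<xi> t \<subseteq> Pow (space (P 1))"
    by (auto simp: natural_events_def)
  ultimately show "natural_events (space (P 1)) \<xi> t \<union> {N. \<forall>s\<in>states. \<exists>N'\<in>null_sets (P s). N \<subseteq> N'} \<subseteq> Pow (space (P 1))"
    by (rule Un_least[rotated])
qed

text \<open>Sets that agree with an event of the past up to a null set of \<open>P s\<close> are
  closed under complement and countable union, and they contain all generators. This is needed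
  because the Markov property speaks only of events of the uncompleted past.\<close>

lemma completed_event:
  assumes s: "s \<in> states" and A: "A \<in> sets (completed (ennreal t))"
  shows "\<exists>A'\<in>sets (past t). \<exists>N\<in>null_sets (P s). A - A' \<union> (A' - A) \<subseteq> N"
  using A unfolding sets_completed
proof (induction rule: sigma_sets.induct)
  case (Basic A)
  then show ?case
  proof
    assume "A \<in> natural_events (space (P 1)) \<xi> (ennreal t)"
    then have "A \<in> sets (past t)"
      unfolding sets_past by (rule sigma_sets.Basic)
    then show ?case
      by (intro bexI[of _ A] bexI[of _ "{}"]) auto
  next
    assume "A \<in> {N. \<forall>s\<in>states. \<exists>N'\<in>null_sets (P s). N \<subseteq> N'}"
    then obtain N where "N \<in> null_sets (P s)" "A \<subseteq> N"
      using s by blast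
    then show ?case
      by (intro bexI[of _ "{}"] bexI[of _ N]) auto
  qed
next
  case Empty
  then show ?case
    by (intro bexI[of _ "{}"]) auto
next
  case (Compl A)
  then obtain A' N where A': "A' \<in> sets (past t)" "N \<in> null_sets (P s)" "A - A' \<union> (A' - A) \<subseteq> N"
    by blast
  have "space (P 1) - A' \<in> sets (past t)"
    using sets.compl_sets[OF A'(1)] by (simp add: space_past)
  then show ?case
    using A'(2,3) by (intro bexI[of _ "space (P 1) - A'"] bexI[of _ N]) auto
next
  case (Union A)
  have "\<forall>i. \<exists>A'. A' \<in> sets (past t) \<and> (\<exists>N\<in>null_sets (P s). A i - A' \<union> (A' - A i) \<subseteq> N)"
    using Union.IH unfolding Bex_def by (rule allI)
  from choice[OF this] obtain A' where
    A': "\<forall>i. A' i \<in> sets (past t) \<and> (\<exists>N\<in>null_sets (P s). A i - A' i \<union> (A' i - A i) \<subseteq> N)"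
    by (elim exE)
  then have "\<forall>i. \<exists>N. N \<in> null_sets (P s) \<and> A i - A' i \<union> (A' i - A i) \<subseteq> N"
    unfolding Bex_def by (intro allI) (erule allE, erule conjunct2)
  from choice[OF this] obtain N where
    N: "\<forall>i. N i \<in> null_sets (P s) \<and> A i - A' i \<union> (A' i - A i) \<subseteq> N i"
    by (elim exE)
  have "(\<Union>i. A' i) \<in> sets (past t)"
    using A' by (intro sets.countable_UN) auto
  moreover have "(\<Union>i. N i) \<in> null_sets (P s)"
    using N by (intro null_sets_UN) blast
  moreover have "(\<Union>i. A i) - (\<Union>i. A' i) \<union> ((\<Union>i. A' i) - (\<Union>i. A i)) \<subseteq> (\<Union>i. N i)"
    using N by fast
  ultimately show ?case
    by (intro bexI[of _ "\<Union>i. A' i"] bexI[of _ "\<Union>i. N i"])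
qed

text \<open>\<open>A\<close> itself is measurable only for the completion: it is
  \<open>A' - N\<close> together with a part of the null set \<open>N\<close>. Integrals over
  \<open>A\<close> and \<open>A'\<close> agree, so estimates can be made on
  \<open>A'\<close>.\<close>

lemma completed_event_integral:
  assumes s: "s \<in> states" and A: "A \<in> sets (completed (ennreal t))"
  obtains A' where "A' \<in> sets (past t)" "A \<in> sets (completion (P s))"
    "\<And>f :: 'a \<Rightarrow> real. f \<in> borel_measurable (P s) \<Longrightarrow>
      (integral_on (completion (P s)) A f) = (integral_on (P s) A' f)"
proof -
  obtain A' N where A': "A' \<in> sets (past t)" "N \<in> null_sets (P s)" "A - A' \<union> (A' - A) \<subseteq> N"
    using completed_event[OF assms] by blast
  have A'_P: "A' \<in> sets (P s)"
    using A'(1) subalgebra_past[OF s, of t] by (auto simp: subalgebra_def)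
  have "A \<inter> N \<in> sets (completion (P s))"
    by (rule null_setsD2[OF null_sets_completion_subset[OF Int_lower2 null_sets_completionI[OF A'(2)]]])
  moreover have "A' - N \<in> sets (completion (P s))"
    by (intro sets.Diff sets_completionI_sets A'_P null_setsD2[OF A'(2)])
  ultimately have "(A' - N) \<union> (A \<inter> N) \<in> sets (completion (P s))"
    by (rule sets.Un[rotated])
  also have "(A' - N) \<union> (A \<inter> N) = A"
    using A'(3) by blast
  finally have A_c: "A \<in> sets (completion (P s))" .
  have "(integral_on (completion (P s)) A f) = (integral_on (P s) A' f)"
    if f: "f \<in> borel_measurable (P s)" for f :: "'a \<Rightarrow> real"
  proof -
    have [measurable]: "f \<in> borel_measurable (completion (P s))" "A' \<in> sets (completion (P s))"
      using f A'_P by (auto intro: measurable_completion)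
    have "AE x in completion (P s). x \<notin> N"
      using A'(2) by (intro AE_completion AE_not_in)
    then have "(integral_on (completion (P s)) A f) = (integral_on (completion (P s)) A' f)"
      using A_c A'(3) by (intro integral_cong_AE) (auto elim!: eventually_mono simp: indicator_def)
    also have "\<dots> = (integral_on (P s) A' f)"
      using f A'_P by (intro integral_completion) auto
    finally show ?thesis .
  qed
  then show ?thesis
    by (rule that[OF A'(1) A_c])
qed

section \<open>No stopping time earns more than the fixed point\<close>

lemma disc_eq: "exp (- \<rho> * t) * (\<integral>x. indicator A x * v (\<xi> t x) (prc y t x) \<partial>P s)
    = (integral_on (P s) A (disc v y t))"
  by (simp add: disc_def mult.left_commute[of "indicator A _"])

lemma state_fun_integrable:
  assumes "admissible v" "0 \<le> t" "0 \<le> y" "s \<in> states"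
  shows "integrable (P s) (\<lambda>x. v (\<xi> t x) (prc y t x))"
proof -
  have "integrable (P s) (\<lambda>x. exp (\<rho> * t) * disc v y t x)"
    using disc_integrable[OF assms] by simp
  then show ?thesis
    by (simp add: disc_def mult.assoc[symmetric] exp_add[symmetric])
qed

text \<open>The supermartingale property up to \<open>e * h\<close> per step; over a grid of total
  length \<open>T\<close> the errors add up to \<open>e * T\<close>, and \<open>e\<close> is
  arbitrary.\<close>

lemma disc_w_supermartingale:
  assumes y: "0 \<le> y" and e: "0 < e"
  obtains h0 where "0 < h0" "\<And>h t s A. 0 \<le> h \<Longrightarrow> h < h0 \<Longrightarrow> 0 \<le> t \<Longrightarrow> t + h \<le> T \<Longrightarrow> s \<in> states \<Longrightarrow>
      A \<in> sets (completed (ennreal t)) \<Longrightarrow>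
      (integral_on (completion (P s)) A (disc w y (t + h)))
        \<le> (integral_on (completion (P s)) A (disc w y t)) + e * h"
proof (rule disc_step[OF admissible_w y e, where T = T])
  fix h0 :: real
  assume h0: "0 < h0"
  assume step: "\<And>h t s A \<phi>. 0 \<le> h \<Longrightarrow> h < h0 \<Longrightarrow> 0 \<le> t \<Longrightarrow> t + h \<le> T \<Longrightarrow> s \<in> states \<Longrightarrow> A \<in> sets (past t) \<Longrightarrow>
      integrable (P s) \<phi> \<Longrightarrow>
      (\<And>x. x \<in> A \<Longrightarrow> flow_step w (\<xi> t x) (prc y t x) h \<le> \<phi> x) \<Longrightarrow>
      (integral_on (P s) A (disc w y (t + h))) \<le> exp (- \<rho> * t) * (integral_on (P s) A \<phi>) + e * h"
  show thesis
  proof (rule that[OF h0])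
    fix h t s A
    assume h: "0 \<le> h" "h < h0" and t: "0 \<le> t" "t + h \<le> T" and s: "s \<in> states"
      and A: "A \<in> sets (completed (ennreal t))"
    obtain A' where A': "A' \<in> sets (past t)"
      "\<And>f :: 'a \<Rightarrow> real. f \<in> borel_measurable (P s) \<Longrightarrow>
      (integral_on (completion (P s)) A f) = (integral_on (P s) A' f)"
      by (rule completed_event_integral[OF s A]) (rule that; assumption)
    have disc_P: "disc w y u \<in> borel_measurable (P s)" if "0 \<le> u" for u
      by (rule past_measurable_P[OF s disc_measurable[OF admissible_w that]])
    have "(integral_on (P s) A' (disc w y (t + h))) \<le>
        exp (- \<rho> * t) * (\<integral>x. indicator A' x * w (\<xi> t x) (prc y t x) \<partial>P s) + e * h"
    proof (rule step[OF h t s A'(1) state_fun_integrable[OF admissible_w t(1) y s]])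
      fix x assume "x \<in> A'"
      then have "x \<in> space (P 1)"
        using sets.sets_into_space[OF A'(1)] by (auto simp: space_past)
      then show "flow_step w (\<xi> t x) (prc y t x) h \<le> w (\<xi> t x) (prc y t x)"
        by (intro flow_step_le_w chain_in_states t h)
    qed
    then show "(integral_on (completion (P s)) A (disc w y (t + h)))
        \<le> (integral_on (completion (P s)) A (disc w y t)) + e * h"
      unfolding disc_eq using t h by (simp add: A'(2) disc_P)
  qed
qed

lemma disc_initial:
  assumes s: "s \<in> states" and v: "admissible v"
  shows "(\<integral>x. disc v y 0 x \<partial>P s) = v s y"
proof -
  interpret prob_space "P s"
    by (rule prob[OF s])
  have "(\<integral>x. disc v y 0 x \<partial>P s) = (\<integral>x. v s y \<partial>P s)"
  proof (rule integral_cong_AE)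
    show "disc v y 0 \<in> borel_measurable (P s)"
      by (rule past_measurable_P[OF s disc_measurable[OF v order_refl]])
    show "AE x in P s. disc v y 0 x = v s y"
      using start[OF s] by eventually_elim (simp add: disc_def price_def)
  qed simp
  then show ?thesis
    by (simp add: prob_space)
qed

definition payoff :: "real \<Rightarrow> real \<Rightarrow> 'a \<Rightarrow> real" where
  "payoff y t x = exp (- \<rho> * t) * (prc y t x - a)"

lemma payoff_le_disc: "0 \<le> t \<Longrightarrow> x \<in> space (P 1) \<Longrightarrow> payoff y t x \<le> disc w y t x"
  unfolding payoff_def disc_def by (intro mult_left_mono payoff_le_w chain_in_states) auto

text \<open>Bounds what can be lost by postponing stopping to the next grid point. The exponent of
  the discounted price moves at speed at most \<open>\<mu> + \<sigma> + \<rho>\<close>, at a level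
  of at most \<open>y * exp ((\<mu> + \<sigma>) * T)\<close>, and postponement lowers the discounted
  \<open>a\<close>.\<close>

lemma payoff_modulus:
  assumes y: "0 \<le> y" and t: "0 \<le> t" "t \<le> t'" "t' \<le> T" and x: "x \<in> space (P 1)"
  shows "payoff y t x \<le> payoff y t' x + (y * exp ((\<mu> + \<sigma>) * T) * (\<mu> + \<sigma> + \<rho>) + a * \<rho>) * (t' - t)"
proof -
  define I where "I u = integral {0..u} (\<lambda>u. \<xi> u x)" for u
  define i where "i = integral {t..t'} (\<lambda>u. \<xi> u x)"
  have I: "I t' = I t + i"
    unfolding I_def i_def using t x
    by (intro Henstock_Kurzweil_Integration.integral_combine[symmetric] path_integrable) auto
  have i: "\<bar>i\<bar> \<le> t' - t"
    using path_integral_le[of t "t' - t" x] t x pos by (simp add: i_def)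
  have bound: "(\<mu> - \<rho>) * u + \<sigma> * I u \<le> (\<mu> + \<sigma>) * T" if "0 \<le> u" "u \<le> T" for u
  proof -
    have "\<bar>I u\<bar> \<le> u"
      using path_integral_le[of 0 u x] that x pos by (simp add: I_def)
    then have "\<sigma> * I u \<le> \<sigma> * u" "\<sigma> * u \<le> \<sigma> * T" "\<mu> * u \<le> \<mu> * T" "0 \<le> \<rho> * u"
      using pos that by (auto intro!: mult_left_mono)
    then show ?thesis
      by (simp add: algebra_simps)
  qed
  have payoff: "payoff y u x = y * exp ((\<mu> - \<rho>) * u + \<sigma> * I u) - a * exp (- \<rho> * u)" for u
    by (simp add: payoff_def price_def I_def algebra_simps exp_add[symmetric])
  have "exp ((\<mu> - \<rho>) * t + \<sigma> * I t) - exp ((\<mu> - \<rho>) * t' + \<sigma> * I t')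
      \<le> exp ((\<mu> + \<sigma>) * T) * \<bar>((\<mu> - \<rho>) * t + \<sigma> * I t) - ((\<mu> - \<rho>) * t' + \<sigma> * I t')\<bar>"
    using exp_diff_le[OF bound bound, of t t'] t by simp
  also have "\<bar>((\<mu> - \<rho>) * t + \<sigma> * I t) - ((\<mu> - \<rho>) * t' + \<sigma> * I t')\<bar> \<le> (\<mu> + \<sigma> + \<rho>) * (t' - t)"
  proof -
    have "\<bar>\<sigma> * i\<bar> \<le> \<sigma> * (t' - t)"
      unfolding abs_mult using pos i by (intro mult_mono) auto
    moreover have "\<bar>(\<mu> - \<rho>) * (t' - t)\<bar> \<le> (\<mu> + \<rho>) * (t' - t)"
      unfolding abs_mult using pos t by (intro mult_mono) auto
    ultimately show ?thesis
      unfolding I by (simp add: algebra_simps abs_le_iff)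
  qed
  finally have "exp ((\<mu> - \<rho>) * t + \<sigma> * I t) - exp ((\<mu> - \<rho>) * t' + \<sigma> * I t')
      \<le> exp ((\<mu> + \<sigma>) * T) * ((\<mu> + \<sigma> + \<rho>) * (t' - t))"
    by simp
  then have "y * (exp ((\<mu> - \<rho>) * t + \<sigma> * I t) - exp ((\<mu> - \<rho>) * t' + \<sigma> * I t'))
      \<le> y * (exp ((\<mu> + \<sigma>) * T) * ((\<mu> + \<sigma> + \<rho>) * (t' - t)))"
    using y by (rule mult_left_mono)
  moreover have "a * (exp (- \<rho> * t') - exp (- \<rho> * t)) \<le> a * 0"
    using pos t by (intro mult_left_mono) auto
  moreover have "0 \<le> a * \<rho> * (t' - t)"
    using pos t by simp
  ultimately show ?thesis
    unfolding payoff by (simp add: algebra_simps)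
qed

text \<open>Rounding \<open>\<tau>\<close> up to the grid gives a discrete stopping rule, because
  not having stopped by \<open>n * h\<close> is an event of the completed filtration at that time.
  \<open>telescope\<close> bounds the mean of the discounted \<open>w\<close> at the rounded time,
  \<open>w\<close> dominates the payoff, and the modulus pays for the rounding.\<close>

lemma truncated_reward_le:
  assumes s: "s \<in> states" and y: "0 \<le> y" and \<tau>: "stopping_time completed \<tau>" and T: "0 < T"
    and int: "integrable (completion (P s)) (\<lambda>x. reward \<mu> \<sigma> a \<rho> \<xi> y (\<tau> x) x)"
  shows "(\<integral>x. (if \<tau> x \<le> ennreal T then reward \<mu> \<sigma> a \<rho> \<xi> y (\<tau> x) x else 0) \<partial>completion (P s)) \<le> w s y"
proof (rule field_le_epsilon)
  fix \<epsilon> :: real assume \<epsilon>: "0 < \<epsilon>"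
  \<comment> \<open>The supermartingale errors sum to \<open>e * T\<close> and the rounding costs at
    most \<open>e\<close>, together \<open>e * (T + 1)\<close>.\<close>
  define e where "e = \<epsilon> / (T + 1)"
  have e: "0 < e"
    using \<epsilon> T by (simp add: e_def)
  let ?M = "completion (P s)"
  interpret prob_space "P s"
    by (rule prob[OF s])
  have emM: "emeasure ?M (space ?M) = 1"
    by (simp add: emeasure_space_1)
  interpret M: prob_space ?M
    by (rule prob_spaceI[OF emM])
  have sp: "space (P s) = space (P 1)"
    by (rule space_P[OF s])
  define C where "C = y * exp ((\<mu> + \<sigma>) * T) * (\<mu> + \<sigma> + \<rho>) + a * \<rho>"
  have C: "0 \<le> C"
    using y pos by (simp add: C_def)
  obtain h0 where h0: "0 < h0" "\<And>h t s A. 0 \<le> h \<Longrightarrow> h < h0 \<Longrightarrow> 0 \<le> t \<Longrightarrow> t + h \<le> T \<Longrightarrow> s \<in> states \<Longrightarrow>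
      A \<in> sets (completed (ennreal t)) \<Longrightarrow>
      (integral_on (completion (P s)) A (disc w y (t + h)))
        \<le> (integral_on (completion (P s)) A (disc w y t)) + e * h"
    by (rule disc_w_supermartingale[OF y e, where T = T]) (rule that; assumption)
  obtain N :: nat where N: "T / min h0 (e / (C + 1)) < real N"
    using reals_Archimedean2 by blast
  have d: "0 < min h0 (e / (C + 1))"
    using h0 e C by auto
  have "0 < T / min h0 (e / (C + 1))"
    using T d by (rule divide_pos_pos)
  then have N0: "0 < real N"
    using N by linarith
  define h where "h = T / real N"
  have h: "0 < h" "h < h0" "C * h \<le> e" "real N * h = T"
  proof -
    have *: "h < min h0 (e / (C + 1))"
      using N d N0 unfolding h_def by (simp only: pos_divide_less_eq mult.commute)
    then show "h < h0"
      by simp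
    show "0 < h"
      using T N0 by (simp add: h_def)
    then have "C * h \<le> (C + 1) * (e / (C + 1))"
      using * C by (intro mult_mono) auto
    then show "C * h \<le> e"
      using C by simp
    show "real N * h = T"
      using N0 by (simp add: h_def)
  qed
  have grid: "real n * h \<le> T" if "n \<le> N" for n
    using that h(1) unfolding h(4)[symmetric] by (intro mult_right_mono) auto
  define B where "B n = {x \<in> space (P 1). \<not> \<tau> x \<le> ennreal (real n * h)}" for n
  define A where "A k = (case k of 0 \<Rightarrow> space ?M - B 0 | Suc n \<Rightarrow> B n - B (Suc n))" for k
  have B_ev: "B n \<in> sets (completed (ennreal (real n * h)))" for n
  proof -
    have [measurable]: "Measurable.pred (completed (ennreal (real n * h))) (\<lambda>x. \<tau> x \<le> ennreal (real n * h))"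
      using \<tau> by (simp add: stopping_time_def)
    have "{x \<in> space (completed (ennreal (real n * h))). \<not> \<tau> x \<le> ennreal (real n * h)}
        \<in> sets (completed (ennreal (real n * h)))"
      by measurable
    then show ?thesis
      by (simp only: B_def space_completed)
  qed
  have B_sets: "B n \<in> sets ?M" for n
    by (rule completed_event_integral[OF s B_ev[of n]])
  have B_mono: "B (Suc n) \<subseteq> B n" for n
  proof -
    have "ennreal (real n * h) \<le> ennreal (real (Suc n) * h)"
      using h by (intro ennreal_leI mult_right_mono) auto
    then show ?thesis
      by (auto simp: B_def dest: order_trans)
  qed
  have A_sets: "A k \<in> sets ?M" for k
    using B_sets by (auto simp: A_def split: nat.split)
  have disc_int: "integrable ?M (disc w y t)" if "0 \<le> t" for t
    using disc_integrable[OF admissible_w that y s] by (simp add: integrable_completion borel_measurable_integrable)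
  have "(\<Sum>k\<le>N. integral_on ?M (A k) (disc w y (real k * h)))
      + (integral_on ?M (B N) (disc w y (real N * h))) \<le> (\<integral>x. disc w y (real 0 * h) x \<partial>?M) + real N * (e * h)"
    unfolding A_def
  proof (rule telescope[where Z = "\<lambda>k. disc w y (real k * h)" and B = B, OF _ B_sets B_mono])
    fix n assume n: "n < N"
    have "real n * h + h \<le> T"
      using grid[of "Suc n"] n by (simp add: algebra_simps)
    then show "(integral_on ?M (B n) (disc w y (real (Suc n) * h)))
        \<le> (integral_on ?M (B n) (disc w y (real n * h))) + e * h"
      using h0(2)[of h "real n * h" s "B n"] h B_ev[of n] s by (simp add: algebra_simps)
  qed (use h in \<open>auto intro: disc_int\<close>)
  also have "(\<integral>x. disc w y (real 0 * h) x \<partial>?M) = w s y"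
    using disc_initial[OF s admissible_w, of y] disc_integrable[OF admissible_w order_refl y s]
    by (simp add: integral_completion borel_measurable_integrable)
  also have "real N * (e * h) = e * T"
    unfolding h(4)[symmetric] by simp
  finally have sum_le: "(\<Sum>k\<le>N. integral_on ?M (A k) (disc w y (real k * h)))
      + (integral_on ?M (B N) (disc w y (real N * h))) \<le> w s y + e * T" .
  \<comment> \<open>Paths that have not stopped by \<open>T\<close> earn nothing in the truncated
    reward, and their nonnegative share in the telescoped sum may be dropped.\<close>
  have last: "0 \<le> (integral_on ?M (B N) (disc w y (real N * h)))"
    using h by (intro Bochner_Integration.integral_nonneg mult_nonneg_nonneg disc_nonneg admissible_w) (auto simp: space_P[OF s])
  let ?R = "\<lambda>x. reward \<mu> \<sigma> a \<rho> \<xi> y (\<tau> x) x"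
  \<comment> \<open>From \<open>n\<close> to \<open>Suc n\<close> the left side changes only on
    \<open>A (Suc n)\<close>, where \<open>\<tau>\<close> lies after \<open>n * h\<close> and not
    after \<open>Suc n * h\<close>; the reward is compared with the discounted \<open>w\<close> at
    the right end of this interval. At index \<open>0\<close> this leaves only
    \<open>\<tau> x = 0\<close>.\<close>
  have pointwise: "(if \<tau> x \<le> ennreal (real n * h) then ?R x else 0)
      \<le> (\<Sum>k\<le>n. indicator (A k) x * (disc w y (real k * h) x + C * h))"
    if x: "x \<in> space (P 1)" and n: "n \<le> N" for x n
    using n
  proof (induction n)
    case 0
    show ?case
    proof (cases "\<tau> x = 0")
      case True
      have "payoff y 0 x \<le> disc w y 0 x"
        by (rule payoff_le_disc[OF order_refl x])
      moreover have "0 \<le> C * h"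
        using C h by simp
      moreover have "x \<in> A 0"
        using True x by (simp add: A_def B_def space_P[OF s])
      ultimately show ?thesis
        using True by (simp add: reward_def payoff_def)
    next
      case False
      then show ?thesis
        using x by (simp add: A_def B_def)
    qed
  next
    case (Suc n)
    have term_nonneg: "0 \<le> indicator (A k) x * (disc w y (real k * h) x + C * h)" for k
      using C h disc_nonneg[OF admissible_w _ x] by (intro mult_nonneg_nonneg add_nonneg_nonneg) auto
    show ?case
    proof (cases "x \<in> A (Suc n)")
      case True
      then have t: "\<tau> x \<le> ennreal (real (Suc n) * h)" "\<not> \<tau> x \<le> ennreal (real n * h)"
        by (auto simp: A_def B_def)
      define r where "r = enn2real (\<tau> x)"
      have fin: "\<tau> x \<noteq> \<infinity>"
        using t(1) by (auto simp: top_unique)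
      then have \<tau>r: "\<tau> x = ennreal r" "0 \<le> r"
        by (auto simp: r_def less_top)
      have r: "r \<le> real (Suc n) * h" "real n * h \<le> r"
        using t \<tau>r h by (auto simp: ennreal_le_iff ennreal_le_iff2)
      have "?R x = payoff y r x"
        using fin by (simp add: reward_def payoff_def r_def)
      also have "\<dots> \<le> payoff y (real (Suc n) * h) x + C * (real (Suc n) * h - r)"
        unfolding C_def by (rule payoff_modulus[OF y \<tau>r(2) r(1) grid[OF Suc.prems] x])
      also have "\<dots> \<le> disc w y (real (Suc n) * h) x + C * h"
      proof (rule add_mono)
        show "payoff y (real (Suc n) * h) x \<le> disc w y (real (Suc n) * h) x"
          using h by (intro payoff_le_disc x) auto
        show "C * (real (Suc n) * h - r) \<le> C * h"
          using r C by (intro mult_left_mono) (auto simp: algebra_simps)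
      qed
      finally have "?R x \<le> indicator (A (Suc n)) x * (disc w y (real (Suc n) * h) x + C * h)"
        using True by simp
      moreover have "0 \<le> (\<Sum>k\<le>n. indicator (A k) x * (disc w y (real k * h) x + C * h))"
        by (intro sum_nonneg term_nonneg)
      ultimately show ?thesis
        unfolding sum.atMost_Suc using t(1) by simp
    next
      case False
      then have "\<tau> x \<le> ennreal (real (Suc n) * h) \<longleftrightarrow> \<tau> x \<le> ennreal (real n * h)"
        using B_mono[of n] x by (auto simp: A_def B_def)
      then show ?thesis
        unfolding sum.atMost_Suc using Suc term_nonneg[of "Suc n"] by auto
    qed
  qed
  have T_ev: "{x \<in> space ?M. \<tau> x \<le> ennreal T} \<in> sets ?M"
  proof -
    have "{x \<in> space ?M. \<tau> x \<le> ennreal T} = space ?M - B N"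
      unfolding B_def h(4) by (auto simp: sp)
    then show ?thesis
      using B_sets by auto
  qed
  have R_int: "integrable ?M (\<lambda>x. if \<tau> x \<le> ennreal T then ?R x else 0)"
  proof (rule Bochner_Integration.integrable_cong[OF refl, THEN iffD1])
    show "integrable ?M (\<lambda>x. indicator {x \<in> space ?M. \<tau> x \<le> ennreal T} x *\<^sub>R ?R x)"
      by (rule integrable_mult_indicator[OF T_ev int])
  qed (simp add: indicator_def)
  have term_int: "integrable ?M (\<lambda>x. indicator (A k) x * disc w y (real k * h) x)"
    "integrable ?M (\<lambda>x. indicator (A k) x * (C * h))" for k
    using integrable_mult_indicator[OF A_sets disc_int[of "real k * h"], of k]
      integrable_mult_indicator[OF A_sets M.integrable_const[of "C * h"], of k] h by auto
  have "(\<integral>x. (if \<tau> x \<le> ennreal T then ?R x else 0) \<partial>?M)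
      \<le> (\<integral>x. (\<Sum>k\<le>N. indicator (A k) x * disc w y (real k * h) x) + C * h \<partial>?M)"
  proof (rule integral_mono[OF R_int])
    show "integrable ?M (\<lambda>x. (\<Sum>k\<le>N. indicator (A k) x * disc w y (real k * h) x) + C * h)"
      by (intro Bochner_Integration.integrable_add Bochner_Integration.integrable_sum term_int M.integrable_const)
    fix x assume "x \<in> space ?M"
    then have x: "x \<in> space (P 1)"
      by (simp add: sp)
    have one: "(\<Sum>k\<le>n. indicator (A k) x) + indicator (B n) x = (1 :: real)" for n
    proof (induction n)
      case 0
      show ?case
        using x by (simp add: A_def indicator_def sp)
    next
      case (Suc n)
      moreover have "indicator (A (Suc n)) x + indicator (B (Suc n)) x = (indicator (B n) x :: real)"
        using B_mono[of n] by (auto simp: A_def indicator_def)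
      ultimately show ?case
        by simp
    qed
    \<comment> \<open>The sets \<open>A k\<close> are disjoint, so the rounding error
      \<open>C * h\<close> is charged once and not at every grid point.\<close>
    have "(\<Sum>k\<le>N. indicator (A k) x) \<le> (1 :: real)"
    proof -
      have "(0 :: real) \<le> indicator (B N) x"
        by simp
      then show ?thesis
        using one[of N] by linarith
    qed
    then have "(\<Sum>k\<le>N. indicator (A k) x) * (C * h) \<le> 1 * (C * h)"
      using C h by (intro mult_right_mono) auto
    moreover have "(\<Sum>k\<le>N. indicator (A k) x * (disc w y (real k * h) x + C * h))
        = (\<Sum>k\<le>N. indicator (A k) x * disc w y (real k * h) x) + (\<Sum>k\<le>N. indicator (A k) x) * (C * h)"
      by (simp only: distrib_left sum.distrib sum_distrib_right)
    ultimately show "(if \<tau> x \<le> ennreal T then ?R x else 0) \<le> (\<Sum>k\<le>N. indicator (A k) x * disc w y (real k * h) x) + C * h"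
      using pointwise[OF x order_refl] unfolding h(4) by linarith
  qed
  also have "\<dots> = (\<Sum>k\<le>N. integral_on ?M (A k) (disc w y (real k * h))) + C * h"
    using term_int(1) M.prob_space
    by (subst Bochner_Integration.integral_add)
      (auto intro!: Bochner_Integration.integrable_sum simp del: sum_mult_indicator sum_indicator_mult
        simp: Bochner_Integration.integral_sum)
  also have "\<dots> \<le> w s y + e * T + e"
    using sum_le last h(3) by linarith
  also have "w s y + e * T + e = w s y + e * (T + 1)"
    by (simp add: distrib_left)
  also have "\<dots> = w s y + \<epsilon>"
    using T by (simp add: e_def)
  finally show "(\<integral>x. (if \<tau> x \<le> ennreal T then ?R x else 0) \<partial>?M) \<le> w s y + \<epsilon>" .
qed

text \<open>The truncated rewards converge to the full one as the horizon grows, with the absolute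
  reward itself as the dominating function; where \<open>\<tau>\<close> is infinite both are
  \<open>0\<close>.\<close>

lemma reward_le:
  assumes s: "s \<in> states" and y: "0 \<le> y" and \<tau>: "stopping_time completed \<tau>"
  shows "(\<integral>x. reward \<mu> \<sigma> a \<rho> \<xi> y (\<tau> x) x \<partial>completion (P s)) \<le> w s y"
proof (cases "integrable (completion (P s)) (\<lambda>x. reward \<mu> \<sigma> a \<rho> \<xi> y (\<tau> x) x)")
  case True
  let ?R = "\<lambda>x. reward \<mu> \<sigma> a \<rho> \<xi> y (\<tau> x) x"
  let ?M = "completion (P s)"
  have ev: "{x \<in> space ?M. \<tau> x \<le> ennreal t} \<in> sets ?M" for t
  proof -
    have "{x \<in> space (completed (ennreal t)). \<tau> x \<le> ennreal t} \<in> sets (completed (ennreal t))"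
      by (rule predE[OF stopping_timeD[OF \<tau>]])
    then have "{x \<in> space (P 1). \<tau> x \<le> ennreal t} \<in> sets ?M"
      unfolding space_completed by (rule completed_event_integral[OF s])
    then show ?thesis
      by (simp add: space_P[OF s])
  qed
  have "(\<lambda>n. \<integral>x. (if \<tau> x \<le> ennreal (real (Suc n)) then ?R x else 0) \<partial>?M) \<longlonglongrightarrow> (\<integral>x. ?R x \<partial>?M)"
  proof (rule integral_dominated_convergence[where w = "\<lambda>x. \<bar>?R x\<bar>"])
    show "?R \<in> borel_measurable ?M"
      using True by (rule borel_measurable_integrable)
    show "integrable ?M (\<lambda>x. \<bar>?R x\<bar>)"
      using True by (rule integrable_abs)
    show "(\<lambda>x. if \<tau> x \<le> ennreal (real (Suc n)) then ?R x else 0) \<in> borel_measurable ?M" for n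
      using ev[of "real (Suc n)"] borel_measurable_integrable[OF True] by (intro measurable_If) auto
    show "AE x in ?M. norm (if \<tau> x \<le> ennreal (real (Suc n)) then ?R x else 0) \<le> \<bar>?R x\<bar>" for n
      by simp
    have "(\<lambda>n. if \<tau> x \<le> ennreal (real (Suc n)) then ?R x else 0) \<longlonglongrightarrow> ?R x" for x
    proof (cases "\<tau> x = \<infinity>")
      case True
      then have "?R x = 0"
        by (simp add: reward_def)
      then show ?thesis
        by (simp cong: if_cong)
    next
      case False
      obtain m :: nat where m: "enn2real (\<tau> x) \<le> real m"
        using real_arch_simple by blast
      have "\<forall>\<^sub>F n in sequentially. (if \<tau> x \<le> ennreal (real (Suc n)) then ?R x else 0) = ?R x"
        using eventually_ge_at_top[of m]
      proof eventually_elim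
        fix n assume "m \<le> n"
        then have "ennreal (enn2real (\<tau> x)) \<le> ennreal (real (Suc n))"
          using m by (intro ennreal_leI) linarith
        then show "(if \<tau> x \<le> ennreal (real (Suc n)) then ?R x else 0) = ?R x"
          using False by (simp add: less_top)
      qed
      then show ?thesis
        by (rule tendsto_eventually)
    qed
    then show "AE x in ?M. (\<lambda>n. if \<tau> x \<le> ennreal (real (Suc n)) then ?R x else 0) \<longlonglongrightarrow> ?R x"
      by simp
  qed
  then show ?thesis
    by (rule LIMSEQ_le_const2) (intro exI[of _ 0] allI impI truncated_reward_le[OF s y \<tau> _ True], simp)
next
  \<comment> \<open>The integral of a non-integrable function is \<open>0\<close> by convention, and
    \<open>w\<close> is nonnegative.\<close>
  case False
  then show ?thesis
    using admissible_nonneg[OF admissible_w s] by (simp add: not_integrable_integral_eq)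
qed

section \<open>Exponential decay of the linear bound on admissible functions\<close>

definition linear :: "real \<Rightarrow> real \<Rightarrow> real" where
  "linear s z = c s * \<bar>z\<bar>"

lemma admissible_linear: "admissible linear"
  unfolding admissible_def linear_def
proof (intro ballI conjI allI)
  fix s z z' :: real
  show "\<bar>c s * \<bar>z\<bar> - c s * \<bar>z'\<bar>\<bar> \<le> c s * \<bar>z - z'\<bar>"
    using c_ge_1[of s] by (auto simp: right_diff_distrib[symmetric] abs_mult intro!: mult_left_mono)
qed (use order_trans[OF zero_le_one c_ge_1] in auto)

text \<open>Half of the relative excess in the strict inequality for \<open>c\<close>, minimised
  over the two states. The other half absorbs the difference between
  \<open>1 - exp (- (d * h))\<close> and \<open>d * h\<close> for small \<open>h\<close>.\<close>

definition decay :: real where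
  "decay = min (((q - b 1) * c 1 - l * c (-1)) / (2 * c 1)) (((q - b (-1)) * c (-1) - l * c 1) / (2 * c (-1)))"

lemma decay_pos: "0 < decay"
  using c_excessive[of 1] c_excessive[of "-1"] c_ge_1[of 1] c_ge_1[of "-1"]
  by (auto simp: decay_def)

lemma decay_le:
  assumes s: "s \<in> states"
  shows "decay * c s \<le> ((q - b s) * c s - l * c (- s)) / 2"
proof -
  have "decay \<le> ((q - b s) * c s - l * c (- s)) / (2 * c s)"
    using s by (auto simp: decay_def)
  then have "decay * c s \<le> ((q - b s) * c s - l * c (- s)) / (2 * c s) * c s"
    using c_ge_1[of s] by (intro mult_right_mono) auto
  also have "\<dots> = ((q - b s) * c s - l * c (- s)) / 2"
    using c_ge_1[of s] by simp
  finally show ?thesis .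
qed

lemma flow_step_linear:
  assumes s: "s \<in> states" and z: "0 \<le> z" and h: "0 \<le> h" "(q + \<sigma>) * h \<le> 1"
  shows "flow_step linear s z h \<le> (1 - decay * h) * linear s z"
proof -
  define d where "d = q - b s"
  define E where "E = exp (- (d * h))"
  define k where "k = d * c s - l * c (- s)"
  have d: "0 < d" "d \<le> q + \<sigma>"
    using rate_pos[OF s] s pos by (auto simp: d_def b_def)
  have k: "0 < k" "decay * c s \<le> k / 2"
    using c_excessive[OF s] decay_le[OF s] by (simp_all add: k_def d_def)
  have dh: "0 \<le> d * h" "d * h \<le> 1"
    using d h mult_right_mono[OF d(2) h(1)] by auto
  \<comment> \<open>Since \<open>d\<close> is at most \<open>q + \<sigma>\<close>, the bound on
    \<open>h\<close> gives \<open>d * h \<le> 1\<close>, and then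
    \<open>1 / (1 + x) \<le> 1 - x / 2\<close>. Here the factor one half in \<open>decay\<close> is
    spent.\<close>
  have E: "d * h / 2 \<le> 1 - E"
  proof -
    have "E \<le> 1 / (1 + d * h)"
      unfolding E_def by (rule exp_minus_bounds(2)[OF dh(1)])
    also have "\<dots> \<le> 1 - d * h / 2"
    proof -
      have "d * h * (d * h) \<le> d * h * 1"
        using dh by (intro mult_left_mono) auto
      then have "1 \<le> (1 - d * h / 2) * (1 + d * h)"
        by (simp add: algebra_simps)
      then show ?thesis
        using dh by (simp add: divide_le_eq)
    qed
    finally show ?thesis
      by simp
  qed
  have "jump_gain linear s z h \<le> l * c (- s) * z * ((1 - E) / d)"
    using jump_gain_diff_le[OF admissible_linear s h(1), of z 0] z
    by (simp add: jump_gain_0[OF admissible_linear s] E_def d_def)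
  moreover have "exp (- q * h) * linear s (z * exp (b s * h)) = c s * z * E"
    using exp_rate[of h s] z by (simp add: linear_def E_def d_def mult_ac)
  ultimately have "flow_step linear s z h \<le> l * c (- s) * z * ((1 - E) / d) + c s * z * E"
    by (simp add: flow_step_def)
  also have "\<dots> = c s * z - z * (k / d * (1 - E))"
    using d(1) by (simp add: k_def field_simps)
  also have "\<dots> \<le> c s * z - z * (decay * c s * h)"
  proof -
    have "decay * c s * h \<le> k / 2 * h"
      by (rule mult_right_mono[OF k(2) h(1)])
    also have "\<dots> = k / d * (d * h / 2)"
      using d(1) by simp
    also have "\<dots> \<le> k / d * (1 - E)"
      using E k d by (intro mult_left_mono) auto
    finally have "z * (decay * c s * h) \<le> z * (k / d * (1 - E))"
      using z by (rule mult_left_mono)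
    then show ?thesis
      by simp
  qed
  also have "\<dots> = (1 - decay * h) * linear s z"
    using z by (simp add: linear_def algebra_simps)
  finally show ?thesis .
qed

text \<open>The means obey a recursion with factor \<open>1 - decay * h\<close> and increment
  \<open>e * h\<close>, whose stationary value is \<open>e / decay\<close>; the rest shrinks
  geometrically. As \<open>linear\<close> dominates every admissible function, this bounds what is
  left at a late horizon.\<close>

lemma disc_linear_decay:
  assumes y: "0 \<le> y" and e: "0 < e"
  obtains h0 where "0 < h0" "\<And>h s n. 0 \<le> h \<Longrightarrow> h < h0 \<Longrightarrow> s \<in> states \<Longrightarrow> real n * h \<le> T \<Longrightarrow>
      (\<integral>x. disc linear y (real n * h) x \<partial>P s) \<le> exp (- decay * (real n * h)) * (\<kappa> * y) + e / decay"
proof (rule disc_step[OF admissible_linear y e, where T = T])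
  fix h1 :: real
  assume h1: "0 < h1"
  assume step: "\<And>h t s A \<phi>. 0 \<le> h \<Longrightarrow> h < h1 \<Longrightarrow> 0 \<le> t \<Longrightarrow> t + h \<le> T \<Longrightarrow> s \<in> states \<Longrightarrow> A \<in> sets (past t) \<Longrightarrow>
      integrable (P s) \<phi> \<Longrightarrow>
      (\<And>x. x \<in> A \<Longrightarrow> flow_step linear (\<xi> t x) (prc y t x) h \<le> \<phi> x) \<Longrightarrow>
      (integral_on (P s) A (disc linear y (t + h))) \<le> exp (- \<rho> * t) * (integral_on (P s) A \<phi>) + e * h"
  define h0 where "h0 = min h1 (min (1 / (q + \<sigma>)) (1 / decay))"
  show thesis
  proof (rule that)
    show "0 < h0"
      using h1 q_pos pos decay_pos by (simp add: h0_def)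
    fix h s and n :: nat
    assume h: "0 \<le> h" "h < h0" and s: "s \<in> states" and n: "real n * h \<le> T"
    let ?D = "\<lambda>n. \<integral>x. disc linear y (real n * h) x \<partial>P s"
    have small: "(q + \<sigma>) * h \<le> 1" "decay * h \<le> 1"
    proof -
      have "h \<le> 1 / (q + \<sigma>)" "h \<le> 1 / decay"
        using h by (simp_all add: h0_def)
      then show "(q + \<sigma>) * h \<le> 1" "decay * h \<le> 1"
        using q_pos pos decay_pos by (simp_all add: pos_le_divide_eq mult.commute)
    qed
    have drop: "(integral_on (P s) (space (P 1)) f) = (\<integral>x. f x \<partial>P s)" for f :: "'a \<Rightarrow> real"
      by (intro Bochner_Integration.integral_cong) (auto simp: space_P[OF s])
    have bound: "?D n \<le> (1 - decay * h) ^ n * (\<kappa> * y) + e / decay" if "real n * h \<le> T" for n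
      using that
    proof (induction n)
      case 0
      have "?D 0 = c s * y"
        using disc_initial[OF s admissible_linear, of y] y by (simp add: linear_def)
      also have "\<dots> \<le> \<kappa> * y"
        using c_le_\<kappa> y by (rule mult_right_mono)
      finally show ?case
        using e decay_pos by (simp add: add_increasing2)
    next
      case (Suc n)
      define t where "t = real n * h"
      have t: "0 \<le> t" "t + h \<le> T" "real (Suc n) * h = t + h"
        using h Suc.prems by (auto simp: t_def algebra_simps)
      let ?\<phi> = "\<lambda>x. (1 - decay * h) * linear (\<xi> t x) (prc y t x)"
      have "(integral_on (P s) (space (P 1)) (disc linear y (t + h)))
          \<le> exp (- \<rho> * t) * (integral_on (P s) (space (P 1)) ?\<phi>) + e * h"
      proof (rule step[OF h(1) _ t(1,2) s])
        show "h < h1"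
          using h by (simp add: h0_def)
        show "space (P 1) \<in> sets (past t)"
          using sets.top[of "past t"] by (simp add: space_past)
        show "integrable (P s) ?\<phi>"
          by (intro integrable_mult_right state_fun_integrable[OF admissible_linear t(1) y s])
        fix x assume x: "x \<in> space (P 1)"
        show "flow_step linear (\<xi> t x) (prc y t x) h \<le> ?\<phi> x"
          using y by (intro flow_step_linear chain_in_states t x h small) (simp add: price_def)
      qed
      then have "?D (Suc n) \<le> exp (- \<rho> * t) * ((1 - decay * h) * (\<integral>x. linear (\<xi> t x) (prc y t x) \<partial>P s)) + e * h"
        unfolding drop t(3) by simp
      also have "exp (- \<rho> * t) * ((1 - decay * h) * (\<integral>x. linear (\<xi> t x) (prc y t x) \<partial>P s))
          = (1 - decay * h) * ?D n"
        by (simp add: disc_def t_def)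
      also have "(1 - decay * h) * ?D n \<le> (1 - decay * h) * ((1 - decay * h) ^ n * (\<kappa> * y) + e / decay)"
        using small(2) t(2) h(1) by (intro mult_left_mono Suc.IH) (simp_all add: t_def)
      finally have "?D (Suc n) \<le> (1 - decay * h) * ((1 - decay * h) ^ n * (\<kappa> * y) + e / decay) + e * h"
        by simp
      also have "\<dots> = (1 - decay * h) ^ Suc n * (\<kappa> * y) + e / decay"
        using decay_pos by (simp add: distrib_left left_diff_distrib diff_divide_distrib)
      finally show ?case .
    qed
    have "(1 - decay * h) ^ n \<le> exp (- (decay * h)) ^ n"
      using small decay_pos h by (intro power_mono exp_minus_bounds(1)) auto
    also have "\<dots> = exp (- decay * (real n * h))"
      by (simp add: exp_of_nat_mult[symmetric] mult_ac)
    finally have "(1 - decay * h) ^ n * (\<kappa> * y) \<le> exp (- decay * (real n * h)) * (\<kappa> * y)"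
      using \<kappa>_ge y by (intro mult_right_mono) auto
    then show "(\<integral>x. disc linear y (real n * h) x \<partial>P s)
        \<le> exp (- decay * (real n * h)) * (\<kappa> * y) + e / decay"
      using bound[OF n] by linarith
  qed
qed

section \<open>Stopping times that nearly earn the fixed point\<close>

lemma past_subset_completed:
  assumes "ennreal u \<le> t"
  shows "sets (past u) \<subseteq> sets (completed t)"
  unfolding sets_past sets_completed
  by (intro sigma_sets_mono') (use assms in \<open>auto simp: natural_events_def intro: order_trans\<close>)

text \<open>Stop at the first grid point where the payoff is \<open>\<epsilon>\<close>-close to \<open>w\<close>, and never if there is none up to
  a large horizon.\<close>

lemma near_optimal_stopping:
  assumes s: "s \<in> states" and y: "0 \<le> y" and \<epsilon>: "0 < \<epsilon>"
  shows "\<exists>\<tau>. stopping_time completed \<tau> \<and>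
    w s y - 4 * \<epsilon> \<le> (\<integral>x. reward \<mu> \<sigma> a \<rho> \<xi> y (\<tau> x) x \<partial>completion (P s))"
proof -
  interpret prob_space "P s"
    by (rule prob[OF s])
  have sp: "space (P s) = space (P 1)"
    by (rule space_P[OF s])
  \<comment> \<open>Solved from \<open>exp (- x) \<le> 1 / (1 + x)\<close> at
    \<open>x = decay * T\<close>; the summand \<open>1\<close> keeps the horizon positive when
    \<open>y = 0\<close>.\<close>
  define T where "T = \<kappa> * y / (\<epsilon> * decay) + 1"
  have T: "0 < T" "exp (- decay * T) * (\<kappa> * y) \<le> \<epsilon>"
  proof -
    have ky: "0 \<le> \<kappa> * y"
      using \<kappa>_ge y by simp
    then have "0 \<le> \<kappa> * y / (\<epsilon> * decay)"
      using \<epsilon> decay_pos by simp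
    then show T0: "0 < T"
      by (simp add: T_def)
    have "\<epsilon> * decay * T = \<kappa> * y + \<epsilon> * decay"
      using \<epsilon> decay_pos by (simp add: T_def distrib_left)
    then have "\<kappa> * y \<le> \<epsilon> * (1 + decay * T)"
      using \<epsilon> decay_pos by (simp add: distrib_left mult.assoc)
    moreover have "0 < 1 + decay * T"
      using T0 decay_pos by (simp add: add_pos_pos)
    ultimately have "1 / (1 + decay * T) * (\<kappa> * y) \<le> \<epsilon>"
      by (simp add: pos_divide_le_eq)
    moreover have "exp (- decay * T) * (\<kappa> * y) \<le> 1 / (1 + decay * T) * (\<kappa> * y)"
      using exp_minus_bounds(2)[of "decay * T"] T0 decay_pos ky by (intro mult_right_mono) auto
    ultimately show "exp (- decay * T) * (\<kappa> * y) \<le> \<epsilon>"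
      by linarith
  qed
  \<comment> \<open>The first entry limits the errors accumulated up to \<open>T\<close>, the second
    the stationary term \<open>e / decay\<close> of the linear bound.\<close>
  define e where "e = min (\<epsilon> / T) (\<epsilon> * decay)"
  have e: "0 < e" "e * T \<le> \<epsilon>" "e / decay \<le> \<epsilon>"
  proof -
    show "0 < e"
      using \<epsilon> T decay_pos by (simp add: e_def)
    have "e \<le> \<epsilon> / T" "e \<le> \<epsilon> * decay"
      by (simp_all add: e_def)
    then show "e * T \<le> \<epsilon>" "e / decay \<le> \<epsilon>"
      using T(1) decay_pos by (simp_all add: pos_le_divide_eq pos_divide_le_eq)
  qed
  define m where "m = y * exp ((\<mu> + \<sigma>) * T)"
  \<comment> \<open>Largest value up to \<open>T\<close> of the rate in the margin of
    \<open>flow_step_eq_w\<close>. With \<open>h < \<epsilon> / K\<close>, a gap larger than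
    \<open>\<epsilon>\<close> between \<open>w\<close> and the payoff makes the flow step
    exact.\<close>
  define K where "K = l * \<kappa> * m + a * q"
  have K: "0 < K"
    unfolding K_def m_def using pos q_pos \<kappa>_ge y by (intro add_nonneg_pos mult_nonneg_nonneg) auto
  obtain h1 where h1: "0 < h1"
    "\<And>h t s A \<phi>. 0 \<le> h \<Longrightarrow> h < h1 \<Longrightarrow> 0 \<le> t \<Longrightarrow> t + h \<le> T \<Longrightarrow> s \<in> states \<Longrightarrow> A \<in> sets (past t) \<Longrightarrow>
      integrable (P s) \<phi> \<Longrightarrow>
      (\<And>x. x \<in> A \<Longrightarrow> \<phi> x \<le> flow_step w (\<xi> t x) (prc y t x) h) \<Longrightarrow>
      exp (- \<rho> * t) * (integral_on (P s) A \<phi>) \<le> (integral_on (P s) A (disc w y (t + h))) + e * h"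
  proof (rule disc_step[OF admissible_w y e(1), where T = T])
    fix h0 :: real
    assume "0 < h0" "\<And>h t s A \<phi>. 0 \<le> h \<Longrightarrow> h < h0 \<Longrightarrow> 0 \<le> t \<Longrightarrow> t + h \<le> T \<Longrightarrow> s \<in> states \<Longrightarrow> A \<in> sets (past t) \<Longrightarrow>
      integrable (P s) \<phi> \<Longrightarrow>
      (\<And>x. x \<in> A \<Longrightarrow> \<phi> x \<le> flow_step w (\<xi> t x) (prc y t x) h) \<Longrightarrow>
      exp (- \<rho> * t) * (integral_on (P s) A \<phi>) \<le> (integral_on (P s) A (disc w y (t + h))) + e * h"
    then show thesis
      by (rule that)
  qed
  obtain h2 where h2: "0 < h2" "\<And>h s n. 0 \<le> h \<Longrightarrow> h < h2 \<Longrightarrow> s \<in> states \<Longrightarrow> real n * h \<le> T \<Longrightarrow>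
      (\<integral>x. disc linear y (real n * h) x \<partial>P s) \<le> exp (- decay * (real n * h)) * (\<kappa> * y) + e / decay"
    by (rule disc_linear_decay[OF y e(1), where T = T]) (rule that; assumption)
  define h0 where "h0 = min (min h1 h2) (\<epsilon> / K)"
  have h0: "0 < h0"
    using h1(1) h2(1) \<epsilon> K by (simp add: h0_def)
  obtain N :: nat where N: "T / h0 < real N"
    using reals_Archimedean2 by blast
  have N0: "0 < real N"
    using N T(1) h0 divide_pos_pos[OF T(1) h0] by linarith
  define h where "h = T / real N"
  have h: "0 < h" "h < h0" "real N * h = T"
    using N N0 T(1) h0 unfolding h_def by (simp_all add: pos_divide_less_eq mult.commute)
  have grid: "real n * h \<le> T" if "n \<le> N" for n
    using that h(1) unfolding h(3)[symmetric] by (intro mult_right_mono) auto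
  define good where "good k x \<longleftrightarrow> w (\<xi> (real k * h) x) (prc y (real k * h) x) \<le> prc y (real k * h) x - a + \<epsilon>" for k x
  define B where "B n = {x \<in> space (P 1). \<forall>k\<le>n. \<not> good k x}" for n
  define A where "A k = (case k of 0 \<Rightarrow> space (P s) - B 0 | Suc n \<Rightarrow> B n - B (Suc n))" for k
  have good_ev: "{x \<in> space (P 1). good k x} \<in> sets (past (real k * h))" for k
  proof -
    have t: "0 \<le> real k * h"
      using h by simp
    have [measurable]: "prc y (real k * h) \<in> borel_measurable (past (real k * h))"
      by (rule price_measurable[OF t])
    have "(\<lambda>x. w (1 * \<xi> (real k * h) x) (prc y (real k * h) x)) \<in> borel_measurable (past (real k * h))"
      by (rule state_fun_measurable[OF admissible_w t order_refl]) measurable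
    then have [measurable]: "(\<lambda>x. w (\<xi> (real k * h) x) (prc y (real k * h) x)) \<in> borel_measurable (past (real k * h))"
      by simp
    have "{x \<in> space (past (real k * h)). w (\<xi> (real k * h) x) (prc y (real k * h) x) \<le> prc y (real k * h) x - a + \<epsilon>}
        \<in> sets (past (real k * h))"
      by measurable
    then show ?thesis
      by (simp only: good_def space_past)
  qed
  have past_mono: "sets (past (real k * h)) \<subseteq> sets (past (real n * h))" if "k \<le> n" for k n
  proof -
    have "ennreal (real k * h) \<le> ennreal (real n * h)"
      using that h by (intro ennreal_leI mult_right_mono) auto
    then show ?thesis
      unfolding sets_past by (intro sigma_sets_mono') (auto simp: natural_events_def intro: order_trans)
  qed
  have B_ev: "B n \<in> sets (past (real n * h))" for n
  proof -
    have "{x \<in> space (P 1). good k x} \<in> sets (past (real n * h))" if "k \<le> n" for k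
      using good_ev past_mono[OF that] by blast
    then have "space (past (real n * h)) - (\<Union>k\<in>{..n}. {x \<in> space (P 1). good k x}) \<in> sets (past (real n * h))"
      by (intro sets.compl_sets sets.finite_UN) auto
    also have "space (past (real n * h)) - (\<Union>k\<in>{..n}. {x \<in> space (P 1). good k x}) = B n"
      by (auto simp: B_def space_past)
    finally show ?thesis .
  qed
  have B_sets: "B n \<in> events" for n
    using B_ev[of n] subalgebra_past[OF s, of "real n * h"] by (auto simp: subalgebra_def)
  have B_mono: "B (Suc n) \<subseteq> B n" for n
    by (auto simp: B_def)
  have A_sets: "A k \<in> events" for k
    using B_sets by (auto simp: A_def split: nat.split)
  have A_iff: "x \<in> A k \<longleftrightarrow> good k x \<and> (\<forall>j<k. \<not> good j x)" if "x \<in> space (P 1)" for x k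
    using that by (cases k) (auto simp: A_def B_def sp le_Suc_eq less_Suc_eq_le)
  have disc_int: "integrable (P s) (disc w y (real k * h))" for k
    using h by (intro disc_integrable[OF admissible_w _ y s]) simp
  have neg: "(\<integral>x. indicator S x * - disc w y t x \<partial>P s) = - (integral_on (P s) S (disc w y t))" for S t
    by simp
  \<comment> \<open>Before the first good grid point the flow step is an equality, so the discounted
    \<open>w\<close> is also a submartingale up to \<open>e * h\<close>; applying
    \<open>telescope\<close> to its negative gives the lower bound.\<close>
  have "(\<Sum>k\<le>N. \<integral>x. indicator (A k) x * - disc w y (real k * h) x \<partial>P s)
      + (\<integral>x. indicator (B N) x * - disc w y (real N * h) x \<partial>P s) \<le> (\<integral>x. - disc w y (real 0 * h) x \<partial>P s) + real N * (e * h)"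
    unfolding A_def
  proof (rule telescope[where Z = "\<lambda>k x. - disc w y (real k * h) x" and B = B, OF _ B_sets B_mono])
    fix n assume n: "n < N"
    define t where "t = real n * h"
    have t: "0 \<le> t" "t + h \<le> T" "real (Suc n) * h = t + h"
      using grid[of "Suc n"] n h by (auto simp: t_def algebra_simps)
    have "exp (- \<rho> * t) * (\<integral>x. indicator (B n) x * w (\<xi> t x) (prc y t x) \<partial>P s)
        \<le> (integral_on (P s) (B n) (disc w y (t + h))) + e * h"
    proof (rule h1(2)[OF _ _ t(1,2) s B_ev[of n, folded t_def] state_fun_integrable[OF admissible_w t(1) y s]])
      show "0 \<le> h" "h < h1"
        using h by (auto simp: h0_def)
      fix x assume "x \<in> B n"
      then have x: "x \<in> space (P 1)" and not_good: "\<not> good n x"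
        by (auto simp: B_def)
      have Y: "0 \<le> prc y t x" "prc y t x \<le> m"
        using price_le[of \<mu> \<sigma> y t T x] pos y t h x by (auto simp: m_def price_def)
      have "h * (l * \<kappa> * prc y t x + a * q) \<le> h * K"
        unfolding K_def using Y h pos \<kappa>_ge by (intro mult_left_mono add_right_mono) auto
      also have "\<dots> \<le> \<epsilon> / K * K"
        using h K by (intro mult_right_mono) (auto simp: h0_def)
      also have "\<dots> = \<epsilon>"
        using K by simp
      finally have "prc y t x - a + h * (l * \<kappa> * prc y t x + a * q) < w (\<xi> t x) (prc y t x)"
        using not_good by (simp add: good_def t_def)
      then have "flow_step w (\<xi> t x) (prc y t x) h = w (\<xi> t x) (prc y t x)"
        using h by (intro flow_step_eq_w chain_in_states t x Y) auto
      then show "w (\<xi> t x) (prc y t x) \<le> flow_step w (\<xi> t x) (prc y t x) h"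
        by simp
    qed
    then show "(\<integral>x. indicator (B n) x * - disc w y (real (Suc n) * h) x \<partial>P s)
        \<le> (\<integral>x. indicator (B n) x * - disc w y (real n * h) x \<partial>P s) + e * h"
      unfolding disc_eq neg t(3) by (simp add: t_def)
  qed (use disc_int in auto)
  then have sum_ge: "w s y \<le> (\<Sum>k\<le>N. integral_on (P s) (A k) (disc w y (real k * h)))
      + (integral_on (P s) (B N) (disc w y T)) + e * T"
    using disc_initial[OF s admissible_w, of y] unfolding neg sum_negf h(3)
    by (simp add: h(3)[symmetric] mult_ac)
  \<comment> \<open>On paths still running at the horizon, \<open>w\<close> is bounded by the linear
    function, whose discounted mean has decayed by then.\<close>
  have last: "(integral_on (P s) (B N) (disc w y T)) \<le> 2 * \<epsilon>"
  proof -
    have "(integral_on (P s) (B N) (disc w y T)) \<le> (\<integral>x. disc linear y T x \<partial>P s)"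
    proof (rule integral_mono)
      show "integrable (P s) (\<lambda>x. indicator (B N) x * disc w y T x)"
        using integrable_mult_indicator[OF B_sets disc_int[of N], of N] by (simp add: h(3))
      show "integrable (P s) (disc linear y T)"
        using T(1) by (intro disc_integrable[OF admissible_linear _ y s]) simp
      fix x assume "x \<in> space (P s)"
      then have x: "x \<in> space (P 1)"
        by (simp add: sp)
      have T0: "0 \<le> T"
        using T(1) by simp
      have "indicator (B N) x * disc w y T x \<le> 1 * disc w y T x"
        using disc_nonneg[OF admissible_w T0 x, of y] by (intro mult_right_mono) auto
      also have "\<dots> \<le> disc linear y T x"
        unfolding disc_def linear_def
        using admissible_le[OF admissible_w chain_in_states[OF T0 x]] by simp
      finally show "indicator (B N) x * disc w y T x \<le> disc linear y T x" .
    qed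
    also have "\<dots> \<le> exp (- decay * T) * (\<kappa> * y) + e / decay"
      using h2(2)[of h s N] h s by (simp add: h0_def)
    also have "\<dots> \<le> 2 * \<epsilon>"
      using T(2) e(3) by linarith
    finally show ?thesis .
  qed
  define \<tau> where "\<tau> x = (if \<exists>k\<le>N. good k x then ennreal (real (LEAST k. good k x) * h) else \<infinity>)" for x
  \<comment> \<open>For finite \<open>t\<close> the value \<open>\<infinity>\<close> cannot satisfy
    \<open>\<tau> x \<le> t\<close>, so the event is a finite union over grid points up to
    \<open>t\<close>. It uses only information available by \<open>t\<close>.\<close>
  have \<tau>_le: "\<tau> x \<le> t \<longleftrightarrow> (\<exists>k\<le>N. ennreal (real k * h) \<le> t \<and> good k x)" if "t \<noteq> \<infinity>" for x t
  proof
    assume le: "\<tau> x \<le> t"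
    have ex: "\<exists>k\<le>N. good k x"
    proof (rule ccontr)
      assume "\<not> (\<exists>k\<le>N. good k x)"
      then have "\<tau> x = \<infinity>"
        by (simp only: \<tau>_def if_False)
      then show False
        using le that by (simp add: top_unique)
    qed
    then obtain k where "k \<le> N" "good k x"
      by blast
    then have "(LEAST k. good k x) \<le> N" "good (LEAST k. good k x) x"
      by (auto intro: LeastI Least_le[THEN order_trans])
    moreover have "\<tau> x = ennreal (real (LEAST k. good k x) * h)"
      using ex by (simp only: \<tau>_def if_True)
    ultimately show "\<exists>k\<le>N. ennreal (real k * h) \<le> t \<and> good k x"
      using le by metis
  next
    assume "\<exists>k\<le>N. ennreal (real k * h) \<le> t \<and> good k x"
    then obtain k where k: "k \<le> N" "ennreal (real k * h) \<le> t" "good k x"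
      by blast
    have "real (LEAST k. good k x) * h \<le> real k * h"
      using Least_le[of "\<lambda>k. good k x", OF k(3)] h by (intro mult_right_mono) auto
    then have "ennreal (real (LEAST k. good k x) * h) \<le> t"
      using k(2) ennreal_leI order_trans by blast
    moreover have "\<tau> x = ennreal (real (LEAST k. good k x) * h)"
      using k by (auto simp: \<tau>_def)
    ultimately show "\<tau> x \<le> t"
      by simp
  qed
  have stop: "stopping_time completed \<tau>"
  proof (rule stopping_timeI)
    fix t :: ennreal
    show "Measurable.pred (completed t) (\<lambda>x. \<tau> x \<le> t)"
    proof (cases "t = \<infinity>")
      case False
      have "(\<Union>k\<in>{k. k \<le> N \<and> ennreal (real k * h) \<le> t}. {x \<in> space (P 1). good k x}) \<in> sets (completed t)"
        using good_ev past_subset_completed by (intro sets.finite_UN) auto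
      also have "(\<Union>k\<in>{k. k \<le> N \<and> ennreal (real k * h) \<le> t}. {x \<in> space (P 1). good k x})
          = {x \<in> space (completed t). \<tau> x \<le> t}"
        using \<tau>_le[OF False] by (auto simp: space_completed)
      finally show ?thesis
        by (simp only: pred_def)
    qed simp
  qed
  let ?R = "\<lambda>x. reward \<mu> \<sigma> a \<rho> \<xi> y (\<tau> x) x"
  have R_eq: "?R x = (\<Sum>k\<le>N. indicator (A k) x * payoff y (real k * h) x)" if x: "x \<in> space (P 1)" for x
  proof (cases "\<exists>k\<le>N. good k x")
    case True
    define k0 where "k0 = (LEAST k. good k x)"
    obtain k where k: "k \<le> N" "good k x"
      using True by blast
    have k0: "good k0 x"
      unfolding k0_def by (rule LeastI[of "\<lambda>k. good k x", OF k(2)])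
    have k0_le: "k0 \<le> N"
      unfolding k0_def by (rule order_trans[OF Least_le[of "\<lambda>k. good k x", OF k(2)] k(1)])
    have k0_least: "\<not> good j x" if "j < k0" for j
      using that unfolding k0_def by (rule not_less_Least)
    have "x \<in> A k \<longleftrightarrow> k = k0" for k
      unfolding A_iff[OF x] using k0 k0_least by (metis linorder_neqE_nat)
    then have "(\<Sum>k\<le>N. indicator (A k) x * payoff y (real k * h) x) = (\<Sum>k\<le>N. if k = k0 then payoff y (real k * h) x else 0)"
      by (intro sum.cong) (auto simp: indicator_def)
    also have "\<dots> = payoff y (real k0 * h) x"
      using k0_le by simp
    also have "\<dots> = ?R x"
      using True h by (simp add: \<tau>_def k0_def reward_def payoff_def)
    finally show ?thesis
      by simp
  next
    case False
    then have "\<tau> x = \<infinity>"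
      by (simp only: \<tau>_def if_False)
    then have "?R x = 0"
      by (simp add: reward_def)
    moreover have "(\<Sum>k\<le>N. indicator (A k) x * payoff y (real k * h) x) = 0"
      using False A_iff[OF x] by (intro sum.neutral) (auto simp: indicator_def)
    ultimately show ?thesis
      by simp
  qed
  have payoff_int: "integrable (P s) (payoff y (real k * h))" for k
  proof -
    have t: "0 \<le> real k * h"
      using h by simp
    have Y: "prc y (real k * h) \<in> borel_measurable (P s)"
      by (rule past_measurable_P[OF s price_measurable[OF t]])
    have "integrable (P s) (prc y (real k * h))"
    proof (rule integrable_const_bound[OF _ Y])
      show "AE x in P s. norm (prc y (real k * h) x) \<le> y * exp ((\<mu> + \<sigma>) * (real k * h))"
        using price_le[of \<mu> \<sigma> y "real k * h" "real k * h"] pos y t by (intro AE_I2) (auto simp: sp price_def)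
    qed
    then show ?thesis
      unfolding payoff_def by (intro integrable_mult_right Bochner_Integration.integrable_diff) auto
  qed
  have ind_int: "integrable (P s) (\<lambda>x. indicator (A k) x * f x)" if "integrable (P s) f" for k and f :: "'a \<Rightarrow> real"
    using integrable_mult_indicator[OF A_sets that] by simp
  have sum_int: "integrable (P s) (\<lambda>x. \<Sum>k\<le>N. indicator (A k) x * payoff y (real k * h) x)"
    "integrable (P s) (\<lambda>x. \<Sum>k\<le>N. indicator (A k) x * disc w y (real k * h) x)"
    by (intro Bochner_Integration.integrable_sum ind_int payoff_int disc_int)+
  have "(\<Sum>k\<le>N. integral_on (P s) (A k) (disc w y (real k * h))) - \<epsilon>
      = (\<integral>x. (\<Sum>k\<le>N. indicator (A k) x * disc w y (real k * h) x) - \<epsilon> \<partial>P s)"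
    using sum_int(2) ind_int[OF disc_int] prob_space
    by (subst Bochner_Integration.integral_diff)
      (auto simp: Bochner_Integration.integral_sum simp del: sum_indicator_mult sum_mult_indicator)
  also have "\<dots> \<le> (\<integral>x. (\<Sum>k\<le>N. indicator (A k) x * payoff y (real k * h) x) \<partial>P s)"
  proof (rule integral_mono[OF _ sum_int(1)])
    show "integrable (P s) (\<lambda>x. (\<Sum>k\<le>N. indicator (A k) x * disc w y (real k * h) x) - \<epsilon>)"
      by (intro Bochner_Integration.integrable_diff sum_int) simp
    fix x assume "x \<in> space (P s)"
    then have x: "x \<in> space (P 1)"
      by (simp add: sp)
    have close: "disc w y (real k * h) x - \<epsilon> \<le> payoff y (real k * h) x" if "good k x" for k
    proof -
      have "exp (- \<rho> * (real k * h)) * (w (\<xi> (real k * h) x) (prc y (real k * h) x) - (prc y (real k * h) x - a))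
          \<le> exp (- \<rho> * (real k * h)) * \<epsilon>"
        using that by (intro mult_left_mono) (auto simp: good_def)
      also have "\<dots> \<le> 1 * \<epsilon>"
        using \<epsilon> pos h by (intro mult_right_mono) auto
      finally show ?thesis
        unfolding disc_def payoff_def by (simp add: right_diff_distrib)
    qed
    show "(\<Sum>k\<le>N. indicator (A k) x * disc w y (real k * h) x) - \<epsilon> \<le> (\<Sum>k\<le>N. indicator (A k) x * payoff y (real k * h) x)"
    proof (cases "\<exists>k\<le>N. x \<in> A k")
      case True
      then obtain k0 where k0: "k0 \<le> N" "x \<in> A k0"
        by blast
      have "x \<in> A k \<longleftrightarrow> k = k0" for k
        using k0(2) unfolding A_iff[OF x] by (metis linorder_neqE_nat)
      then have "(\<Sum>k\<le>N. indicator (A k) x * f k) = (\<Sum>k\<le>N. if k = k0 then f k else 0)" for f :: "nat \<Rightarrow> real"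
        by (intro sum.cong) (auto simp: indicator_def)
      then have "(\<Sum>k\<le>N. indicator (A k) x * f k) = f k0" for f :: "nat \<Rightarrow> real"
        using k0(1) by simp
      then show ?thesis
        using close[of k0] k0(2) unfolding A_iff[OF x] by simp
    next
      case False
      then have "(\<Sum>k\<le>N. indicator (A k) x * f k) = 0" for f :: "nat \<Rightarrow> real"
        by (intro sum.neutral) auto
      then show ?thesis
        using \<epsilon> by simp
    qed
  qed
  also have "\<dots> = (\<integral>x. ?R x \<partial>completion (P s))"
  proof -
    have "(\<integral>x. ?R x \<partial>completion (P s)) = (\<integral>x. (\<Sum>k\<le>N. indicator (A k) x * payoff y (real k * h) x) \<partial>completion (P s))"
      by (intro Bochner_Integration.integral_cong refl R_eq) (simp add: sp)
    then show ?thesis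
      using integral_completion[OF borel_measurable_integrable[OF sum_int(1)]] by simp
  qed
  \<comment> \<open>One \<open>\<epsilon>\<close> for the accumulated errors \<open>e * T\<close>,
    two for the paths running at the horizon, and one for the gap between \<open>w\<close> and the
    payoff at a good point.\<close>
  finally have "w s y - 4 * \<epsilon> \<le> (\<integral>x. ?R x \<partial>completion (P s))"
    using sum_ge last e(2) by linarith
  with stop show ?thesis
    by blast
qed

text \<open>The uniform upper bound also supplies the boundedness that the real supremum in
  \<open>value_fun\<close> needs in order to dominate each expected reward.\<close>

lemma value_fun_eq_w:
  assumes s: "s \<in> states" and y: "0 \<le> y"
  shows "value_fun \<mu> \<sigma> a \<rho> P \<xi> y s = w s y"
proof (rule antisym)
  let ?S = "{\<tau>. stopping_time completed \<tau>}"
  let ?E = "\<lambda>\<tau>. \<integral>x. reward \<mu> \<sigma> a \<rho> \<xi> y (\<tau> x) x \<partial>completion (P s)"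
  have le: "?E \<tau> \<le> w s y" if "\<tau> \<in> ?S" for \<tau>
    using reward_le[OF s y] that by blast
  have "(\<lambda>_. 0) \<in> ?S"
    by (simp add: stopping_time_const)
  then show "value_fun \<mu> \<sigma> a \<rho> P \<xi> y s \<le> w s y"
    unfolding value_fun_def by (intro cSUP_least le) auto
  show "w s y \<le> value_fun \<mu> \<sigma> a \<rho> P \<xi> y s"
  proof (rule field_le_epsilon)
    fix e :: real assume "0 < e"
    then obtain \<tau> where \<tau>: "\<tau> \<in> ?S" "w s y - 4 * (e / 4) \<le> ?E \<tau>"
      using near_optimal_stopping[OF s y, of "e / 4"] by auto
    have "?E \<tau> \<le> value_fun \<mu> \<sigma> a \<rho> P \<xi> y s"
      unfolding value_fun_def using \<tau>(1) le by (intro cSUP_upper bdd_aboveI2) auto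
    then show "w s y \<le> value_fun \<mu> \<sigma> a \<rho> P \<xi> y s + e"
      using \<tau>(2) by simp
  qed
qed

end

text \<open>The two inequalities place \<open>\<kappa>\<close> strictly between
  \<open>l / (X - \<sigma>)\<close> and \<open>(X + \<sigma>) / l\<close>. This interval is nonempty
  because the discount condition squares to \<open>\<sigma>\<^sup>2 + l\<^sup>2 < X\<^sup>2\<close>,
  and it reaches beyond \<open>1\<close> because \<open>l < X\<close>.\<close>

lemma excessive_weight_exists:
  fixes l \<mu> \<sigma> \<rho> :: real
  assumes "0 < l" "0 < \<sigma>" and discount: "\<rho> > \<mu> - l + sqrt (\<sigma>\<^sup>2 + l\<^sup>2)"
  shows "\<exists>\<kappa>\<ge>1. l < (l + \<rho> - (\<mu> + \<sigma>)) * \<kappa> \<and> l * \<kappa> < l + \<rho> - (\<mu> - \<sigma>)"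
proof -
  define X where "X = l + \<rho> - \<mu>"
  have X: "sqrt (\<sigma>\<^sup>2 + l\<^sup>2) < X"
    using discount by (simp add: X_def)
  have "\<sigma> \<le> sqrt (\<sigma>\<^sup>2 + l\<^sup>2)" "l \<le> sqrt (\<sigma>\<^sup>2 + l\<^sup>2)"
    using assms by (auto intro: real_le_rsqrt)
  then have "\<sigma> < X" "l < X"
    using X by linarith+
  have "\<sigma>\<^sup>2 + l\<^sup>2 < X\<^sup>2"
    using power_strict_mono[OF X, of 2] by simp
  then have "l * l < (X - \<sigma>) * (X + \<sigma>)"
    by (simp add: algebra_simps power2_eq_square)
  then have "l / (X - \<sigma>) < (X + \<sigma>) / l" "1 < (X + \<sigma>) / l"
    using \<open>\<sigma> < X\<close> \<open>l < X\<close> assms by (simp_all add: divide_simps mult.commute)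
  then have "max 1 (l / (X - \<sigma>)) < (X + \<sigma>) / l"
    by simp
  then obtain \<kappa> where "max 1 (l / (X - \<sigma>)) < \<kappa>" "\<kappa> < (X + \<sigma>) / l"
    using dense by blast
  then have "1 \<le> \<kappa>" "l < (X - \<sigma>) * \<kappa>" "l * \<kappa> < X + \<sigma>"
    using \<open>\<sigma> < X\<close> assms by (simp_all add: less_divide_eq divide_less_eq mult.commute)
  then show ?thesis
    by (intro exI[of _ \<kappa>]) (simp add: X_def algebra_simps)
qed

theorem proposition7:
  fixes l \<mu> \<sigma> a \<rho> :: real
    and P :: "real \<Rightarrow> 'a measure"
    and \<xi> :: "real \<Rightarrow> 'a \<Rightarrow> real"
  defines "g \<equiv> value_fun \<mu> \<sigma> a \<rho> P \<xi>"
    and "u \<equiv> threshold \<mu> \<sigma> a \<rho> P \<xi>"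
  assumes pos: "0 < l" "0 < \<mu>" "0 < \<sigma>" "0 < a" "0 < \<rho>"
    and chain: "two_state_chain l P \<xi>"
    and discount: "\<rho> > \<mu> - l + sqrt (\<sigma>\<^sup>2 + l\<^sup>2)"
  shows "(\<mu> - \<sigma> > 0 \<longrightarrow> u (-1) < \<infinity> \<and> smooth_fit (\<lambda>y. g y (-1)) (real_of_ereal (u (-1))))
       \<and> (u 1 < \<infinity> \<longrightarrow> smooth_fit (\<lambda>y. g y 1) (real_of_ereal (u 1)))"
proof -
  obtain \<kappa> where \<kappa>: "1 \<le> \<kappa>" "l < (l + \<rho> - (\<mu> + \<sigma>)) * \<kappa>" "l * \<kappa> < l + \<rho> - (\<mu> - \<sigma>)"
    using excessive_weight_exists[OF pos(1,3) discount] by blast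
  interpret stopping_problem l \<mu> \<sigma> a \<rho> \<kappa> P \<xi>
    using pos \<kappa> chain by (simp add: stopping_problem_def stopping_data_def)
  have g: "g y s = w s y" if "s \<in> states" "0 \<le> y" for s y
    unfolding g_def by (rule value_fun_eq_w[OF that])
  have u: "u s = Inf (ereal ` {y. 0 \<le> y \<and> g y s = y - a})" for s
    by (simp add: u_def g_def threshold_def)
  have fit: "u s < \<infinity> \<and> smooth_fit (\<lambda>y. g y s) (real_of_ereal (u s))"
    if "s \<in> states" "0 < b s" "\<exists>y\<ge>0. g y s = y - a" for s
    unfolding u using smooth_fit_threshold[OF that(1,2,3) g[OF that(1)]] by blast
  show ?thesis
  proof (intro conjI impI)
    \<comment> \<open>This is \<open>0 < b (-1)\<close>. It gives upward flow and, through
      \<open>w_down_stops\<close>, a price at which stopping is optimal, so finiteness of the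
      threshold is derived here.\<close>
    assume "\<mu> - \<sigma> > 0"
    then have b: "0 < b (-1)"
      by (simp add: b_def)
    have "\<exists>y\<ge>0. g y (-1) = y - a"
      using w_down_stops[OF b] g[of "-1"] by auto
    from fit[OF _ b this] show "u (-1) < \<infinity>" "smooth_fit (\<lambda>y. g y (-1)) (real_of_ereal (u (-1)))"
      by auto
  next
    \<comment> \<open>Upward drift holds here by positivity of the parameters. Finiteness rules out
      an empty stopping set, whose infimum in the extended reals is
      \<open>\<infinity>\<close>.\<close>
    assume fin: "u 1 < \<infinity>"
    have "\<exists>y\<ge>0. g y 1 = y - a"
    proof (rule ccontr)
      assume "\<not> (\<exists>y\<ge>0. g y 1 = y - a)"
      then have "{y. 0 \<le> y \<and> g y 1 = y - a} = {}"
        by blast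
      then have "u 1 = \<infinity>"
        unfolding u by (simp only: image_empty Inf_empty top_ereal_def)
      then show False
        using fin by simp
    qed
    moreover have "0 < b 1"
      using pos by (simp add: b_def)
    ultimately show "smooth_fit (\<lambda>y. g y 1) (real_of_ereal (u 1))"
      using fit[of 1] by simp
  qed
qed

end
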